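(* Let $X=E^{\mathbb{N}}$ where $E$ is a compact metric space, let $\mu$ be a Borel probability measure on $E$, $\mathsf{M}=(\mu\times\delta_x)_{x\in X}$, $\varepsilon>0$, and let $f\in C^{\varepsilon\log}(X,\mathbb{R})$ be a flat potential with respect to the modulus of continuity $\omega_\varepsilon(r)=\log(r_0/r)^{-\varepsilon}$ and the natural coupling $\Pi^n_{x,y}=\int_{E^n}\delta_{(\bar x^w_n,\bar y^w_n)}\,d\mu^n(w)$. Then the transfer operator $\mathscr{L}_{\mathsf{M},f}$ has a strictly positive eigenfunction $h_f\in C^{\varepsilon\log}(X,\mathbb{R})$ with respect to some positive eigenvalue $\lambda_f$, and its dual $\mathscr{L}_{\mathsf{M},f}^*$ has a conformal measure $\nu_f$ with respect to the eigenvalue $\lambda_f$. The measure $\mu_f=h_f\,d\nu_f$ (with $\int h_f\,d\nu_f=1$) is a stationary measure. If $\bar f=f+\log h_f-\log h_f\circ\sigma-\log\lambda_f$ is the normalized potential, then there is $C>0$ such that for every $\varphi\in C^{\varepsilon\log}(X,\mathbb{R})$ with $\int\varphi\,d\mu_f=0$ and every $n\geqslant1$, $$\|\mathscr{L}_{\mathsf{M},\bar f}^n\varphi\|_\infty\leqslant C\,\frac{\|\varphi\|_{\omega_\varepsilon}}{n^\varepsilon}.$$ In particular the one-sided shift $\sigma$ has polynomial decay of correlations with respect to $\mu_f$.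
   Context: $X$ has the metric $d(x,y)=\sum_{n\geqslant1}2^{-n}\min\{d_E(x_n,y_n),1\}$; $\sigma$ is the left shift and $ax=(a,x_1,x_2,\dots)$. $\omega_\varepsilon$ is considered on $[0,1]$ with $\omega_\varepsilon(0)=0$ and $r_0$ sufficiently large so that it is continuous, increasing and concave. $C^{\varepsilon\log}(X,\mathbb{R})$ is the space of bounded $g:X\to\mathbb{R}$ with $\mathrm{Hol}_{\omega_\varepsilon}(g)=\sup_{x\neq y}|g(x)-g(y)|/\omega_\varepsilon(d(x,y))<\infty$, with norm $\|g\|_{\omega_\varepsilon}=\|g\|_\infty+\mathrm{Hol}_{\omega_\varepsilon}(g)$. The measure $\mu\times\delta_x$ is the law of $ax$ with $a\sim\mu$, and $\mathscr{L}_{\mathsf{M},f}\varphi(x)=\int_Ee^{f(ax)}\varphi(ax)\,d\mu(a)$. A conformal measure for $\lambda$ is a Borel probability measure $\nu$ with $\int\mathscr{L}_{\mathsf{M},f}\varphi\,d\nu=\lambda\int\varphi\,d\nu$ for all continuous $\varphi$; $\mu_f$ stationary means $\int\mathscr{L}_{\mathsf{M},\bar f}\varphi\,d\mu_f=\int\varphi\,d\mu_f$ for all continuous $\varphi$. For $w=(r_1,\dots,r_n)\in E^n$ and $x,y\in X$, $\bar x^w_n,\bar y^w_n\in X^n$ have $j$-th components ($1\leqslant j\leqslant n$) $(r_j,\dots,r_1,x_1,x_2,\dots)$ and $(r_j,\dots,r_1,y_1,y_2,\dots)$. For $\bar x=(x_1,\dots,x_n)\in X^n$, $f^n(\bar x)=f(x_1)+\dots+f(x_n)$.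 $f$ is flat if there is $C>0$ such that for all $n\in\mathbb{N}$, all $x,y\in X$ and $\Pi^n_{x,y}$-almost all $(\bar x,\bar y)$, $|f^n(\bar x)-f^n(\bar y)|\leqslant C\,\omega_\varepsilon(d(x,y))$. Polynomial decay of correlations means: for every $\varphi\in C^{\varepsilon\log}(X,\mathbb{R})$ and $\psi\in L^1(\mu_f)$ there is $K>0$ with $\left|\int\varphi\cdot\psi\circ\sigma^n\,d\mu_f-\int\varphi\,d\mu_f\int\psi\,d\mu_f\right|\leqslant Kn^{-\varepsilon}$ for all $n\geqslant1$. *)

theory Defs
  imports "HOL-Probability.Probability"
begin

class compact_metric_space = metric_space +
  assumes compact_UNIV_metric: "compact (UNIV :: 'a set)"

(* Second countability makes the Borel sigma-algebra of a countable product of copies of E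
   coincide with the product sigma-algebra. *)
instance compact_metric_space \<subseteq> second_countable_topology
proof
  have "\<forall>e>0. \<exists>k. finite k \<and> (UNIV :: 'a set) \<subseteq> (\<Union>x\<in>k. ball x e)"
    using compact_UNIV_metric[where 'a = 'a] by (simp add: compact_eq_totally_bounded)
  then have "\<forall>n::nat. \<exists>k. finite k \<and> (UNIV :: 'a set) \<subseteq> (\<Union>x\<in>k. ball x (1 / Suc n))"
    by auto
  then obtain k where k: "\<And>n::nat. finite (k n)"
      "\<And>n::nat. (UNIV :: 'a set) \<subseteq> (\<Union>x\<in>k n. ball x (1 / Suc n))"
    by metis
  define B where "B = (\<Union>n. (\<lambda>x. ball x (1 / Suc n)) ` k n)"
  have "countable B"
    unfolding B_def using k(1) by (auto intro: countable_finite)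
  moreover have "topological_basis B"
  proof (rule topological_basisI)
    fix b assume "b \<in> B" then show "open b" by (auto simp: B_def)
  next
    fix U :: "'a set" and x assume "open U" "x \<in> U"
    then obtain e where e: "e > 0" "ball x e \<subseteq> U" by (meson open_contains_ball)
    obtain n where n: "1 / real (Suc n) < e / 2" using nat_approx_posE[of "e / 2"] e(1) by auto
    obtain y where y: "y \<in> k n" "dist y x < 1 / Suc n"
    proof -
      have "x \<in> (\<Union>x\<in>k n. ball x (1 / Suc n))" using k(2)[of n] by blast
      then show ?thesis using that by (auto simp del: of_nat_Suc)
    qed
    have "ball y (1 / Suc n) \<subseteq> ball x e"
    proof
      fix z assume "z \<in> ball y (1 / Suc n)"
      then have "dist y z < 1 / Suc n" by simp
      then have "dist x z < e"
        using y(2) n dist_triangle[of x z y] dist_commute[of x y] by linarith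
      then show "z \<in> ball x e" by simp
    qed
    then show "\<exists>b\<in>B. x \<in> b \<and> b \<subseteq> U"
      using y e(2) by (intro bexI[of _ "ball y (1 / Suc n)"]) (auto simp: B_def)
  qed
  ultimately show "\<exists>B::'a set set. countable B \<and> open = generate_topology B"
    by (metis topological_basis_imp_subbasis)
qed

(* A point of X = E^N is a function on nat whose value at n is the coordinate number n + 1.
   The metric instance of the library on nat => 'a weights the coordinates along an unspecified
   enumeration of nat, so the metric of X is defined here; it induces the product topology
   (lemma open_iff_seq_dist), which is the topology of the type. *)
type_synonym 'e sequ = "nat \<Rightarrow> 'e"

definition seq_dist :: "'e::metric_space sequ \<Rightarrow> 'e sequ \<Rightarrow> real" where
  "seq_dist x y = (\<Sum>n. (1/2) ^ Suc n * min (dist (x n) (y n)) 1)"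

lemma summable_seq_dist:
  "summable (\<lambda>n. (1/2) ^ Suc n * min (dist (x n) (y n :: 'e::metric_space)) 1 :: real)"
proof (rule summable_comparison_test')
  show "summable (\<lambda>n. (1/2 :: real) ^ n)" by (simp add: summable_geometric_iff)
next
  fix n :: nat
  have "0 \<le> min (dist (x n) (y n)) 1" "min (dist (x n) (y n)) 1 \<le> 1" by simp_all
  moreover have "(1/2 :: real) ^ Suc n \<le> (1/2) ^ n" "0 \<le> (1/2 :: real) ^ Suc n"
    by (simp_all add: power_decreasing del: power_Suc)
  ultimately have "(1/2) ^ Suc n * min (dist (x n) (y n)) 1 \<le> (1/2) ^ n * 1"
      and "0 \<le> (1/2) ^ Suc n * min (dist (x n) (y n)) 1"
    by (intro mult_mono mult_nonneg_nonneg; linarith)+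
  then show "norm ((1/2) ^ Suc n * min (dist (x n) (y n)) 1) \<le> (1/2) ^ n"
    unfolding real_norm_def by linarith
qed

lemma open_iff_seq_dist:
  fixes U :: "'e::metric_space sequ set"
  shows "open U \<longleftrightarrow> (\<forall>x\<in>U. \<exists>e>0. \<forall>y. seq_dist x y < e \<longrightarrow> y \<in> U)"
proof safe
  fix x assume U: "open U" "x \<in> U"
  show "\<exists>e>0. \<forall>y. seq_dist x y < e \<longrightarrow> y \<in> U"
  proof (rule ccontr)
    assume "\<not> ?thesis"
    then have "\<forall>k::nat. \<exists>y. seq_dist x y < 1 / Suc k \<and> y \<notin> U"
      by (meson of_nat_0_less_iff zero_less_Suc zero_less_divide_1_iff)
    then obtain y where y: "\<And>k::nat. seq_dist x (y k) < 1 / Suc k" "\<And>k. y k \<notin> U" by metis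
    have "(\<lambda>k. y k n) \<longlonglongrightarrow> x n" for n
    proof -
      have b: "(1/2) ^ Suc n * min (dist (x n) (y k n)) 1 \<le> 1 / Suc k" for k
      proof -
        have "(1/2) ^ Suc n * min (dist (x n) (y k n)) 1 \<le> seq_dist x (y k)"
          unfolding seq_dist_def
          using sum_le_suminf[OF summable_seq_dist[of x "y k"], of "{n}"] by auto
        with y(1)[of k] show ?thesis by linarith
      qed
      show ?thesis
      proof (rule metric_LIMSEQ_I)
        fix r :: real assume "r > 0"
        define q where "q = (1/2 :: real) ^ Suc n"
        have "q > 0" by (simp add: q_def)
        with \<open>r > 0\<close> have "q * min r 1 > 0" by simp
        then obtain N where N: "1 / real (Suc N) < q * min r 1" by (rule nat_approx_posE)
        have "dist (y k n) (x n) < r" if "k \<ge> N" for k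
        proof -
          have "1 / real (Suc k) \<le> 1 / real (Suc N)"
            using that by (intro divide_left_mono) auto
          then have "q * min (dist (x n) (y k n)) 1 < q * min r 1"
            using b[of k, folded q_def] N by linarith
          then have "min (dist (x n) (y k n)) 1 < min r 1"
            using \<open>q > 0\<close> by (simp only: mult_less_cancel_left_pos)
          then show ?thesis by (simp add: dist_commute min_def split: if_splits)
        qed
        then show "\<exists>no. \<forall>k\<ge>no. dist (y k n) (x n) < r" by blast
      qed
    qed
    then have "limitin (product_topology (\<lambda>i. euclidean) UNIV) y x sequentially"
      by (subst limitin_componentwise) auto
    then have "y \<longlonglongrightarrow> x"
      by (simp add: euclidean_product_topology)
    then have "eventually (\<lambda>k. y k \<in> U) sequentially"
      using U by (rule topological_tendstoD)
    then show False using y(2) by simp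
  qed
next
  assume H: "\<forall>x\<in>U. \<exists>e>0. \<forall>y. seq_dist x y < e \<longrightarrow> y \<in> U"
  show "open U"
  proof (subst open_subopen, safe)
    fix x assume "x \<in> U"
    then obtain e where e: "e > 0" "\<And>y. seq_dist x y < e \<Longrightarrow> y \<in> U" using H by blast
    have "uniform_limit UNIV (\<lambda>N y. \<Sum>n<N. (1/2) ^ Suc n * min (dist (x n) (y n)) 1)
        (seq_dist x) sequentially"
      unfolding seq_dist_def
      by (rule Weierstrass_m_test[of _ _ "\<lambda>n. (1/2) ^ Suc n"])
         (auto simp: abs_mult)
    then have "continuous_on UNIV (seq_dist x)"
      by (rule uniform_limit_theorem[rotated])
         (auto intro!: always_eventually continuous_intros continuous_on_product_coordinates)
    then have "open (seq_dist x -` {..<e})"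
      by (rule open_vimage[rotated]) simp
    moreover have "seq_dist x x = 0" by (simp add: seq_dist_def)
    ultimately show "\<exists>T. open T \<and> x \<in> T \<and> T \<subseteq> U"
      using e by (intro exI[of _ "seq_dist x -` {..<e}"]) auto
  qed
qed

definition shift :: "'e sequ \<Rightarrow> 'e sequ" where
  "shift x = (\<lambda>n. x (Suc n))"

definition prepend :: "'e \<Rightarrow> 'e sequ \<Rightarrow> 'e sequ" where
  "prepend a x = case_nat a x"

definition log_modulus :: "real \<Rightarrow> real \<Rightarrow> real \<Rightarrow> real" where
  "log_modulus \<epsilon> r0 r = (if r = 0 then 0 else ln (r0 / r) powr (- \<epsilon>))"

(* These are valued in [0, \<infinity>], so that an infinite supremum is infinite. *)
definition sup_norm :: "('e sequ \<Rightarrow> real) \<Rightarrow> ennreal" where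
  "sup_norm g = (SUP x. ennreal \<bar>g x\<bar>)"

definition Hol :: "(real \<Rightarrow> real) \<Rightarrow> ('e::metric_space sequ \<Rightarrow> real) \<Rightarrow> ennreal" where
  "Hol \<omega> g = (SUP (x, y)\<in>{(x, y). x \<noteq> y}. ennreal (\<bar>g x - g y\<bar> / \<omega> (seq_dist x y)))"

definition hol_norm :: "(real \<Rightarrow> real) \<Rightarrow> ('e::metric_space sequ \<Rightarrow> real) \<Rightarrow> ennreal" where
  "hol_norm \<omega> g = sup_norm g + Hol \<omega> g"

definition hol_space :: "(real \<Rightarrow> real) \<Rightarrow> ('e::metric_space sequ \<Rightarrow> real) set" where
  "hol_space \<omega> = {g. bounded (range g) \<and> Hol \<omega> g < \<infinity>}"

(* The family M: the member at x is the law of ax for a distributed according to \<mu>. *)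
definition prepend_kernel ::
    "'e::metric_space measure \<Rightarrow> 'e sequ \<Rightarrow> 'e sequ measure" where
  "prepend_kernel \<mu> x = distr \<mu> borel (\<lambda>a. prepend a x)"

definition transfer ::
    "('e sequ \<Rightarrow> 'e sequ measure) \<Rightarrow> ('e sequ \<Rightarrow> real) \<Rightarrow> ('e sequ \<Rightarrow> real) \<Rightarrow> 'e sequ \<Rightarrow> real" where
  "transfer M f \<phi> x = (\<integral>y. exp (f y) * \<phi> y \<partial>M x)"

lemma measurable_prepend [measurable]:
  "(\<lambda>a :: 'e::metric_space. prepend a x) \<in> borel_measurable borel"
proof (intro borel_measurable_continuous_onI continuous_on_coordinatewise_then_product)
  fix i show "continuous_on UNIV (\<lambda>a. prepend a x i)"
    unfolding prepend_def by (cases i) (auto intro: continuous_on_id)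
qed

lemma transfer_prepend_kernel:
  fixes \<mu> :: "'e::metric_space measure"
  assumes "sets \<mu> = sets borel" "f \<in> borel_measurable borel" "\<phi> \<in> borel_measurable borel"
  shows "transfer (prepend_kernel \<mu>) f \<phi> x
    = (\<integral>a. exp (f (prepend a x)) * \<phi> (prepend a x) \<partial>\<mu>)"
proof -
  have "(\<lambda>a. prepend a x) \<in> measurable \<mu> borel"
    using measurable_prepend[of x] assms(1) measurable_cong_sets by blast
  then show ?thesis
    unfolding transfer_def prepend_kernel_def using assms(2,3) by (intro integral_distr) auto
qed

(* w = (w 1, ..., w n); the j-th component is (w j, ..., w 1, x 0, x 1, ...). *)
definition orbit :: "nat \<Rightarrow> (nat \<Rightarrow> 'e) \<Rightarrow> 'e sequ \<Rightarrow> nat \<Rightarrow> 'e sequ" where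
  "orbit n w x = (\<lambda>j\<in>{1..n}. \<lambda>i. if i < j then w (j - i) else x (i - j))"

definition natural_coupling ::
    "'e::metric_space measure \<Rightarrow> nat \<Rightarrow> 'e sequ \<Rightarrow> 'e sequ \<Rightarrow>
      ((nat \<Rightarrow> 'e sequ) \<times> (nat \<Rightarrow> 'e sequ)) measure" where
  "natural_coupling \<mu> n x y =
     distr (PiM {1..n} (\<lambda>_. \<mu>)) (PiM {1..n} (\<lambda>_. borel) \<Otimes>\<^sub>M PiM {1..n} (\<lambda>_. borel))
       (\<lambda>w. (orbit n w x, orbit n w y))"

lemma measurable_orbit:
  fixes \<mu> :: "'e::compact_metric_space measure"
  assumes "sets \<mu> = sets borel"
  shows "(\<lambda>w. orbit n w x) \<in> measurable (PiM {1..n} (\<lambda>_. \<mu>)) (PiM {1..n} (\<lambda>_. borel))"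
  unfolding orbit_def
proof (rule measurable_restrict)
  fix j assume j: "j \<in> {1..n}"
  have "(\<lambda>w i. if i < j then w (j - i) else x (i - j))
      \<in> measurable (PiM {1..n} (\<lambda>_. \<mu>)) (PiM UNIV (\<lambda>_. borel))"
  proof (rule measurable_PiM_single')
    fix i :: nat
    have "(\<lambda>w. w (j - i)) \<in> measurable (PiM {1..n} (\<lambda>_. \<mu>)) borel" if "i < j"
    proof -
      have "j - i \<in> {1..n}" using that j by auto
      then have "(\<lambda>w. w (j - i)) \<in> measurable (PiM {1..n} (\<lambda>_. \<mu>)) \<mu>"
        by (rule measurable_component_singleton)
      then show ?thesis by (simp only: measurable_cong_sets[OF refl assms])
    qed
    then show "(\<lambda>w. if i < j then w (j - i) else x (i - j))
        \<in> measurable (PiM {1..n} (\<lambda>_. \<mu>)) borel"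
      by (cases "i < j") auto
  qed auto
  then show "(\<lambda>w i. if i < j then w (j - i) else x (i - j))
      \<in> measurable (PiM {1..n} (\<lambda>_. \<mu>)) borel"
    by (simp only: measurable_cong_sets[OF refl sets_PiM_equal_borel])
qed

definition birkhoff :: "('e sequ \<Rightarrow> real) \<Rightarrow> nat \<Rightarrow> (nat \<Rightarrow> 'e sequ) \<Rightarrow> real" where
  "birkhoff f n xs = (\<Sum>j=1..n. f (xs j))"

definition flat_potential ::
    "(real \<Rightarrow> real) \<Rightarrow>
     (nat \<Rightarrow> 'e::metric_space sequ \<Rightarrow> 'e sequ \<Rightarrow>
       ((nat \<Rightarrow> 'e sequ) \<times> (nat \<Rightarrow> 'e sequ)) measure) \<Rightarrow>
     ('e sequ \<Rightarrow> real) \<Rightarrow> bool" where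
  "flat_potential \<omega> P f \<longleftrightarrow> (\<exists>C>0. \<forall>n x y. AE (xs, ys) in P n x y.
      \<bar>birkhoff f n xs - birkhoff f n ys\<bar> \<le> C * \<omega> (seq_dist x y))"

definition conformal_measure ::
    "(('e::topological_space sequ \<Rightarrow> real) \<Rightarrow> 'e sequ \<Rightarrow> real) \<Rightarrow> real \<Rightarrow> 'e sequ measure \<Rightarrow> bool" where
  "conformal_measure L lam \<nu> \<longleftrightarrow> prob_space \<nu> \<and> sets \<nu> = sets borel \<and>
     (\<forall>\<phi>. continuous_on UNIV \<phi> \<longrightarrow> (\<integral>x. L \<phi> x \<partial>\<nu>) = lam * (\<integral>x. \<phi> x \<partial>\<nu>))"

definition stationary_measure ::
    "(('e::topological_space sequ \<Rightarrow> real) \<Rightarrow> 'e sequ \<Rightarrow> real) \<Rightarrow> 'e sequ measure \<Rightarrow> bool" where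
  "stationary_measure L m \<longleftrightarrow> prob_space m \<and> sets m = sets borel \<and>
     (\<forall>\<phi>. continuous_on UNIV \<phi> \<longrightarrow> (\<integral>x. L \<phi> x \<partial>m) = (\<integral>x. \<phi> x \<partial>m))"

definition normalized_potential ::
    "('e sequ \<Rightarrow> real) \<Rightarrow> ('e sequ \<Rightarrow> real) \<Rightarrow> real \<Rightarrow> 'e sequ \<Rightarrow> real" where
  "normalized_potential f h lam x = f x + ln (h x) - ln (h (shift x)) - ln lam"

definition polynomial_decay ::
    "real \<Rightarrow> (real \<Rightarrow> real) \<Rightarrow> 'e::metric_space sequ measure \<Rightarrow> bool" where
  "polynomial_decay \<epsilon> \<omega> m \<longleftrightarrow>
     (\<forall>\<phi>\<in>hol_space \<omega>. \<forall>\<psi>. integrable m (\<psi> :: 'e sequ \<Rightarrow> real) \<longrightarrow>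
       (\<exists>K>0. \<forall>n\<ge>1. \<bar>(\<integral>x. \<phi> x * \<psi> ((shift ^^ n) x) \<partial>m) - (\<integral>x. \<phi> x \<partial>m) * (\<integral>x. \<psi> x \<partial>m)\<bar>
          \<le> K * real n powr (- \<epsilon>)))"

end

(* Flatness compares the weights of L^n at two points along the same word: L^n \<phi> x is at most
   exp (C \<omega> (d x y)) times L^n \<psi> y as soon as \<phi> \<le> \<psi> along the two branches. For the ratios
   R_n \<phi> = L^n \<phi> / L^n 1 this gives a modulus of continuity of order \<omega>, uniform in n, and the
   contraction osc (R_(n+m) \<phi>) \<le> \<theta> osc (R_n \<phi>) + O(m^(-\<epsilon>)) with \<theta> < 1. Taking m to be a small
   fixed proportion of n + m turns this recursion into osc (R_n \<phi>) = O(n^(-\<epsilon>)).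

   Hence R_n \<phi> tends to a constant, also for indicators of cylinder sets. These constants are
   consistent finite-dimensional marginals, and Kolmogorov's extension theorem provides the measure
   \<nu>; it is conformal for the limit \<lambda> of R_n (L 1). Since R_n of a function of \<nu>-mean zero is bounded
   by its oscillation, L^n 1 / \<lambda>^n is a Cauchy sequence; its limit is h. The normalized operator
   satisfies P^n \<phi> = L^n (h \<phi>) / (\<lambda>^n h), so it decays at the same rate, and the decay of
   correlations follows by duality of P with the shift. *)

theory Submission
  imports Defs
begin

section \<open>Sequence spaces over a compact metric space\<close>

text \<open>The obstacle is the weak modulus: prepending m letters divides distances by 2^m but only
  brings \<omega> down to the order m^(-\<epsilon>), so the Holder seminorm does not contract
  geometrically and no spectral gap is at hand. What contracts is the oscillation, by a Doeblin
  argument: R_(n+m) \<phi> x is a weighted average of R_n \<phi> over the branches of length m at x,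
  and flatness makes the weights at two points comparable branch by branch, uniformly in n and m.
  The price is the variation of R_n \<phi> between the two ends of a common branch, which is the
  error m^(-\<epsilon>). For fixed m this error would never disappear; for m proportional to n it
  has the target order, and the target grows only by a factor close to 1 between n and n - m, which
  \<theta> absorbs.

  The indicator of a Borel cylinder is in general discontinuous, as E need not be discrete. It takes
  equal values at the two ends of every common branch that covers its coordinates, so the decay
  estimate demands regularity only along branches of length at least k.\<close>

instance compact_metric_space \<subseteq> complete_space
proof
  fix X :: "nat \<Rightarrow> 'a" assume "Cauchy X"
  moreover have "Topological_Spaces.complete (UNIV :: 'a set)"
    using compact_UNIV_metric by (rule compact_imp_complete)
  ultimately show "convergent X"
    unfolding metric_space_class.complete_def convergent_def by blast
qed

instance compact_metric_space \<subseteq> polish_space ..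

section \<open>Compactness of X and uniqueness of Borel measures\<close>

lemma compact_UNIV_sequ: "compact (UNIV :: 'e::compact_metric_space sequ set)"
proof -
  have "compact_space (product_topology (\<lambda>_. euclidean :: 'e topology) (UNIV :: nat set))"
    unfolding compact_space_product_topology
    using compact_UNIV_metric[where 'a='e] by (simp add: compact_space_def)
  then show ?thesis by (simp add: compact_space_def euclidean_product_topology)
qed

lemma bounded_range_continuous:
  fixes \<phi> :: "'e::compact_metric_space sequ \<Rightarrow> real"
  assumes "continuous_on UNIV \<phi>"
  shows "bounded (range \<phi>)"
  using compact_continuous_image[OF assms compact_UNIV_sequ] by (rule compact_imp_bounded)

text \<open>Uniform continuity in terms of coordinates: points that agree on ever longer prefixes
  have, by compactness, a common limit along a subsequence. It allows a continuous function to be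
  replaced by one of finitely many coordinates.\<close>

lemma continuous_cylinder_variation:
  fixes \<phi> :: "'e::compact_metric_space sequ \<Rightarrow> real"
  assumes "continuous_on UNIV \<phi>" "\<delta> > 0"
  obtains k where "\<And>u v. (\<forall>i<k. u i = v i) \<Longrightarrow> \<bar>\<phi> u - \<phi> v\<bar> < \<delta>"
proof (rule ccontr)
  assume "\<not> thesis"
  then have "\<forall>k. \<exists>u v. (\<forall>i<k. u i = v i) \<and> \<not> \<bar>\<phi> u - \<phi> v\<bar> < \<delta>"
    using that by blast
  then obtain u v where uv: "\<And>k i. i < k \<Longrightarrow> u k i = v k i" "\<And>k. \<not> \<bar>\<phi> (u k) - \<phi> (v k)\<bar> < \<delta>"
    by metis
  have "seq_compact (UNIV :: 'e sequ set)"
    using compact_UNIV_sequ by (simp add: compact_eq_seq_compact_metric)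
  then obtain l r where r: "strict_mono r" "(u \<circ> r) \<longlonglongrightarrow> l"
    unfolding seq_compact_def by blast
  have "limitin (product_topology (\<lambda>i. euclidean) UNIV) (u \<circ> r) l sequentially"
    using r(2) by (simp add: euclidean_product_topology)
  then have ui: "(\<lambda>k. u (r k) i) \<longlonglongrightarrow> l i" for i
    by (auto simp: limitin_componentwise o_def)
  have "(\<lambda>k. v (r k) i) \<longlonglongrightarrow> l i" for i
  proof (rule Lim_transform_eventually[OF ui])
    have "u (r k) i = v (r k) i" if "k > i" for k
      using that seq_suble[OF r(1), of k] by (intro uv(1)) linarith
    then show "\<forall>\<^sub>F k in sequentially. u (r k) i = v (r k) i"
      using eventually_gt_at_top[of i] by (rule eventually_mono[rotated])
  qed
  then have "limitin (product_topology (\<lambda>i. euclidean) UNIV) (v \<circ> r) l sequentially"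
    by (auto simp: limitin_componentwise o_def)
  then have v: "(v \<circ> r) \<longlonglongrightarrow> l" by (simp add: euclidean_product_topology)
  have c: "isCont \<phi> l" using assms(1) by (simp add: continuous_on_eq_continuous_at)
  have "(\<lambda>k. \<phi> ((u \<circ> r) k) - \<phi> ((v \<circ> r) k)) \<longlonglongrightarrow> \<phi> l - \<phi> l"
    by (intro tendsto_diff isCont_tendsto_compose[OF c] r(2) v)
  then have "(\<lambda>k. \<bar>\<phi> (u (r k)) - \<phi> (v (r k))\<bar>) \<longlonglongrightarrow> 0"
    by (simp add: tendsto_rabs_zero_iff)
  then have "\<forall>\<^sub>F k in sequentially. \<bar>\<phi> (u (r k)) - \<phi> (v (r k))\<bar> < \<delta>"
    using assms(2) by (rule order_tendstoD)
  with uv(2) show False by simp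
qed

text \<open>The indicator of a closed set is the limit of steeper and steeper cutoffs of the
  distance to it, and the closed sets are an intersection-stable generator of the Borel
  sets.\<close>

lemma finite_measure_eqI_continuous:
  fixes M N :: "'a::metric_space measure"
  assumes "finite_measure M" "finite_measure N" and sets: "sets M = sets borel" "sets N = sets borel"
    and eq: "\<And>\<phi> :: 'a \<Rightarrow> real. continuous_on UNIV \<phi> \<Longrightarrow> (\<And>x. \<bar>\<phi> x\<bar> \<le> 1) \<Longrightarrow> (\<integral>x. \<phi> x \<partial>M) = (\<integral>x. \<phi> x \<partial>N)"
  shows "M = N"
proof -
  interpret M: finite_measure M by fact
  interpret N: finite_measure N by fact
  have closed_eq: "measure M F = measure N F" if F: "closed F" for F
  \<comment> \<open>The distance to the empty set is 0 by convention, so the cutoffs below would not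
    converge to its indicator.\<close>
  proof (cases "F = {}")
    case False
    define g where "g k x = max 0 (1 - real k * infdist x F)" for k x
    have g_cont: "continuous_on UNIV (g k)" for k
      unfolding g_def by (intro continuous_intros)
    have g_bound: "\<bar>g k x\<bar> \<le> 1" for k x
      unfolding g_def by (auto simp: infdist_nonneg)
    have g_lim: "(\<lambda>k. g k x) \<longlonglongrightarrow> indicator F x" for x
    proof (cases "x \<in> F")
      case True then show ?thesis by (simp add: g_def)
    next
      case False
      then have "infdist x F > 0"
        using F \<open>F \<noteq> {}\<close> infdist_pos_not_in_closed by auto
      then obtain K :: nat where K: "1 / infdist x F < real K" using reals_Archimedean2 by blast
      have "g k x = 0" if "k \<ge> K" for k
      proof -
        have "1 / infdist x F < real k" using K that by simp
        then show ?thesis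
          using \<open>infdist x F > 0\<close> by (simp add: g_def field_simps)
      qed
      then have "\<forall>\<^sub>F k in sequentially. g k x = indicator F x"
        using False by (auto simp: eventually_sequentially)
      then show ?thesis by (rule tendsto_eventually)
    qed
    have lim: "(\<lambda>k. \<integral>x. g k x \<partial>Q) \<longlonglongrightarrow> measure Q F"
      if "finite_measure Q" "sets Q = sets borel" for Q :: "'a measure"
    proof -
      interpret Q: finite_measure Q by fact
      have meas: "g k \<in> borel_measurable Q" for k
        using borel_measurable_continuous_onI[OF g_cont] measurable_cong_sets[OF that(2) refl] by blast
      have FQ: "F \<in> sets Q" using F that(2) by auto
      have "(\<lambda>k. \<integral>x. g k x \<partial>Q) \<longlonglongrightarrow> (\<integral>x. indicator F x \<partial>Q)"
        using g_lim g_bound meas FQ by (intro integral_dominated_convergence[where w="\<lambda>_. 1"]) auto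
      then show ?thesis using FQ by simp
    qed
    show ?thesis
      using lim[OF assms(1) sets(1)] lim[OF assms(2) sets(2)] eq[OF g_cont g_bound]
      by (auto intro: LIMSEQ_unique)
  qed simp
  show ?thesis
  proof (rule measure_eqI_generator_eq[where E="{F. closed F}" and \<Omega>=UNIV and A="\<lambda>_. UNIV"])
    show "Int_stable {F :: 'a set. closed F}" by (auto simp: Int_stable_def)
    show "sets M = sigma_sets UNIV {F. closed F}" "sets N = sigma_sets UNIV {F. closed F}"
      using sets by (simp_all add: borel_eq_closed)
  qed (auto simp: closed_eq M.emeasure_eq_measure N.emeasure_eq_measure)
qed

section \<open>Inverse branches of the shift\<close>

text \<open>The inverse branch of the n-th power of the shift selected by w, latest letter first.
  Unlike a component of \<open>orbit\<close> it makes sense for n = 0 and carries no restriction,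
  which gives a recursion in n.\<close>

definition prefix_word :: "nat \<Rightarrow> (nat \<Rightarrow> 'e) \<Rightarrow> 'e sequ \<Rightarrow> 'e sequ" where
  "prefix_word n w x = (\<lambda>i. if i < n then w (n - i) else x (i - n))"

lemma prefix_word_0 [simp]: "prefix_word 0 w x = x"
  by (simp add: prefix_word_def)

lemma prefix_word_Suc: "prefix_word (Suc n) w x = prepend (w (Suc n)) (prefix_word n w x)"
  by (auto simp: prefix_word_def prepend_def fun_eq_iff split: nat.splits)

lemma prefix_word_cong: "(\<And>i. 1 \<le> i \<Longrightarrow> i \<le> n \<Longrightarrow> w i = v i) \<Longrightarrow> prefix_word n w x = prefix_word n v x"
  by (auto simp: prefix_word_def)

lemma orbit_eq_prefix_word: "j \<in> {1..n} \<Longrightarrow> orbit n w x j = prefix_word j w x"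
  by (simp add: orbit_def prefix_word_def)

lemma seq_dist_nonneg: "0 \<le> seq_dist x y"
  unfolding seq_dist_def by (intro suminf_nonneg summable_seq_dist) auto

lemma seq_dist_le_1: "seq_dist x y \<le> 1"
proof -
  have "seq_dist x y \<le> (\<Sum>n. (1/2 :: real) ^ Suc n)"
    unfolding seq_dist_def
    by (intro suminf_le summable_seq_dist) (auto simp: power_half_series sums_summable[OF power_half_series] intro!: mult_left_le)
  then show ?thesis using power_half_series by (simp add: sums_iff)
qed

lemma seq_dist_self [simp]: "seq_dist x x = 0"
  by (simp add: seq_dist_def)

lemma seq_dist_commute: "seq_dist x y = seq_dist y x"
  by (simp add: seq_dist_def dist_commute)

lemma seq_dist_pos: "x \<noteq> y \<Longrightarrow> 0 < seq_dist x y"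
proof -
  assume "x \<noteq> y"
  then obtain n where "x n \<noteq> y n" by auto
  then have "0 < (1/2 :: real) ^ Suc n * min (dist (x n) (y n)) 1" by simp
  then show ?thesis
    unfolding seq_dist_def by (intro suminf_pos2[where i=n] summable_seq_dist) auto
qed

lemma seq_dist_prepend: "seq_dist (prepend a x) (prepend a y) = seq_dist x y / 2"
proof -
  have "seq_dist (prepend a x) (prepend a y) = (\<Sum>n. (1/2) * ((1/2) ^ Suc n * min (dist (x n) (y n)) 1))"
    unfolding seq_dist_def
    using suminf_split_head[OF summable_seq_dist[of "prepend a x" "prepend a y"]]
    by (simp add: prepend_def mult.assoc)
  also have "\<dots> = seq_dist x y / 2"
    unfolding seq_dist_def by (subst suminf_mult[OF summable_seq_dist]) simp
  finally show ?thesis .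
qed

lemma seq_dist_prefix_word:
  "seq_dist (prefix_word n w x) (prefix_word n w y) = (1/2) ^ n * seq_dist x y"
  by (induction n) (auto simp: prefix_word_Suc seq_dist_prepend)

lemma seq_dist_tendsto:
  fixes x :: "nat \<Rightarrow> 'e::metric_space sequ"
  assumes "x \<longlonglongrightarrow> l"
  shows "(\<lambda>k. seq_dist (x k) l) \<longlonglongrightarrow> 0"
proof -
  have "uniform_limit UNIV (\<lambda>N y. \<Sum>n<N. (1/2) ^ Suc n * min (dist (l n) (y n)) 1)
      (seq_dist l) sequentially"
    unfolding seq_dist_def
    by (rule Weierstrass_m_test[of _ _ "\<lambda>n. (1/2) ^ Suc n"]) (auto simp: abs_mult)
  then have "continuous_on UNIV (seq_dist l)"
    by (rule uniform_limit_theorem[rotated])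
       (auto intro!: always_eventually continuous_intros continuous_on_product_coordinates)
  then have "isCont (seq_dist l) l" by (simp add: continuous_on_eq_continuous_at)
  from isCont_tendsto_compose[OF this assms] show ?thesis
    by (simp add: seq_dist_commute)
qed

section \<open>A scalar recursion with polynomial error\<close>

text \<open>The recursion is applied with \<open>m = n div q\<close>. The error is then of order
  n^(-\<epsilon>), and the induction hypothesis at n - m exceeds the target at n by a factor of at
  most (1 - 1/q)^(-\<epsilon>), which \<theta> absorbs once q is large. K depends on \<theta> and
  \<epsilon> only, so the bound is linear in N.\<close>

lemma decay_of_affine_recursion:
  fixes \<theta> \<epsilon> :: real
  assumes "0 \<le> \<theta>" "\<theta> < 1" "\<epsilon> > 0"
  obtains K where "K > 0"
    "\<And>D N. (\<And>n. D n \<le> N) \<Longrightarrow> 0 \<le> N \<Longrightarrow>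
      (\<And>n m. m \<ge> 1 \<Longrightarrow> D (n + m) \<le> \<theta> * D n + N * real m powr (- \<epsilon>)) \<Longrightarrow>
      (\<And>n::nat. n \<ge> 1 \<Longrightarrow> D n \<le> K * N * real n powr (- \<epsilon>))"
proof -
  \<comment> \<open>The room between \<theta> and \<open>\<theta>'\<close> pays for the loss factor,
    the room between \<open>\<theta>'\<close> and 1 for the error term.\<close>
  define \<theta>' where "\<theta>' = (1 + \<theta>) / 2"
  have th': "\<theta> < \<theta>'" "\<theta>' < 1" using assms by (auto simp: \<theta>'_def)
  have "(\<lambda>q. \<theta> * (1 - 1 / real q) powr (- \<epsilon>)) \<longlonglongrightarrow> \<theta> * (1 - 0) powr (- \<epsilon>)"
    by (intro tendsto_intros lim_1_over_n) auto
  then have "\<forall>\<^sub>F q in sequentially. \<theta> * (1 - 1 / real q) powr (- \<epsilon>) < \<theta>'"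
    using th' by (intro order_tendstoD(2)) auto
  then obtain q where q: "q \<ge> 2" "\<theta> * (1 - 1 / real q) powr (- \<epsilon>) < \<theta>'"
    using eventually_ge_at_top[of "2::nat"] by (metis (mono_tags, lifting) eventually_conj eventually_happens' sequentially_bot)
  \<comment> \<open>The first entry settles n < q, where D n \<le> N is enough; the second solves (2
    q)^\<epsilon> + \<theta>' K \<le> K.\<close>
  define K where "K = max (real q powr \<epsilon>) ((2 * real q) powr \<epsilon> / (1 - \<theta>'))"
  have K: "K > 0" "real q powr \<epsilon> \<le> K" "(2 * real q) powr \<epsilon> + \<theta>' * K \<le> K"
  proof -
    show "K > 0" using q(1) by (auto simp: K_def less_max_iff_disj)
    show "real q powr \<epsilon> \<le> K" by (simp add: K_def)
    have "(2 * real q) powr \<epsilon> / (1 - \<theta>') \<le> K" by (simp add: K_def)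
    then show "(2 * real q) powr \<epsilon> + \<theta>' * K \<le> K" using th' by (simp add: field_simps)
  qed
  show thesis
  proof (rule that[OF K(1)])
    fix D :: "nat \<Rightarrow> real" and N :: real and n :: nat
    assume D: "\<And>n. D n \<le> N" "0 \<le> N"
      "\<And>n m. m \<ge> 1 \<Longrightarrow> D (n + m) \<le> \<theta> * D n + N * real m powr (- \<epsilon>)" and "n \<ge> 1"
    from \<open>n \<ge> 1\<close> show "D n \<le> K * N * real n powr (- \<epsilon>)"
    proof (induction n rule: less_induct)
      case (less n)
      show ?case
      proof (cases "n < q")
        case True
        have "1 \<le> (real q / real n) powr \<epsilon>"
          using True less.prems assms by (intro ge_one_powr_ge_zero) (auto simp: field_simps)
        also have "\<dots> = real q powr \<epsilon> * real n powr (- \<epsilon>)"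
          using less.prems by (simp add: powr_divide powr_minus field_simps)
        also have "\<dots> \<le> K * real n powr (- \<epsilon>)" using K by (intro mult_right_mono) auto
        finally have "N * 1 \<le> N * (K * real n powr (- \<epsilon>))" using D(2) by (intro mult_left_mono)
        then show ?thesis using D(1)[of n] by (simp add: ac_simps)
      next
        case False
        define m where "m = n div q"
        have m1: "m \<ge> 1" using False q(1) by (simp add: m_def div_greater_zero_iff Suc_le_eq)
        have mq: "m * q \<le> n" "n < (m + 1) * q"
          using q(1) unfolding m_def by (auto simp: algebra_simps dividend_less_times_div)
        have le2: "m * 2 \<le> m * q" using q(1) by simp
        have nm: "n - m < n" "n - m \<ge> 1" "n = (n - m) + m"
          using m1 mq(1) le2 by linarith+
        have "real m * real q \<le> real n" using mq(1) by (metis of_nat_le_iff of_nat_mult)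
        then have lb: "real n * (1 - 1 / real q) \<le> real (n - m)"
          using nm q(1) by (simp add: of_nat_diff field_simps)
        \<comment> \<open>As m \<ge> 1, (m + 1) q \<le> 2 m q; this is the origin of the constant 2
          q.\<close>
        have "n < 2 * m * q" using mq(2) m1 by (rule_tac less_le_trans[OF mq(2)]) (auto)
        then have "real n < real (2 * m * q)" by (simp only: of_nat_less_iff)
        then have mb: "real n / (2 * real q) \<le> real m" using q(1) by (simp add: field_simps)
        have "1 - 1 / real q > 0" using q(1) by simp
        have "real (n - m) powr (- \<epsilon>) \<le> (real n * (1 - 1 / real q)) powr (- \<epsilon>)"
          using lb assms less.prems \<open>1 - 1 / real q > 0\<close> by (intro powr_mono2') auto
        also have "\<dots> = real n powr (- \<epsilon>) * (1 - 1 / real q) powr (- \<epsilon>)"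
          using \<open>1 - 1 / real q > 0\<close> by (simp only: powr_mult)
        finally have a: "real (n - m) powr (- \<epsilon>) \<le> real n powr (- \<epsilon>) * (1 - 1 / real q) powr (- \<epsilon>)" .
        have "real m powr (- \<epsilon>) \<le> (real n / (2 * real q)) powr (- \<epsilon>)"
          using mb assms less.prems q(1) by (intro powr_mono2') auto
        also have "\<dots> = real n powr (- \<epsilon>) * (2 * real q) powr \<epsilon>"
          using less.prems q(1) by (simp add: powr_divide powr_minus field_simps)
        finally have b: "real m powr (- \<epsilon>) \<le> real n powr (- \<epsilon>) * (2 * real q) powr \<epsilon>" .
        have "D n \<le> \<theta> * D (n - m) + N * real m powr (- \<epsilon>)"
          using D(3)[OF m1, of "n - m"] nm by simp
        also have "\<dots> \<le> \<theta> * (K * N * (real n powr (- \<epsilon>) * (1 - 1 / real q) powr (- \<epsilon>)))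
            + N * (real n powr (- \<epsilon>) * (2 * real q) powr \<epsilon>)"
        proof (intro add_mono mult_left_mono b)
          have "D (n - m) \<le> K * N * real (n - m) powr (- \<epsilon>)" using less.IH nm by blast
          also have "\<dots> \<le> K * N * (real n powr (- \<epsilon>) * (1 - 1 / real q) powr (- \<epsilon>))"
            using a K D(2) by (intro mult_left_mono) auto
          finally show "D (n - m) \<le> K * N * (real n powr (- \<epsilon>) * (1 - 1 / real q) powr (- \<epsilon>))" .
        qed (use assms D in auto)
        also have "\<dots> = N * real n powr (- \<epsilon>) * ((\<theta> * (1 - 1 / real q) powr (- \<epsilon>)) * K + (2 * real q) powr \<epsilon>)"
          by (simp add: algebra_simps)
        also have "\<dots> \<le> N * real n powr (- \<epsilon>) * (\<theta>' * K + (2 * real q) powr \<epsilon>)"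
          using q(2) K(1) D(2) by (intro mult_left_mono add_mono mult_right_mono) auto
        also have "\<dots> \<le> N * real n powr (- \<epsilon>) * K"
          using K(3) D(2) by (intro mult_left_mono) auto
        finally show ?thesis by (simp add: ac_simps)
      qed
    qed
  qed
qed

section \<open>Bounded Borel functions\<close>

text \<open>On X this class is stable under the transfer operator and contains both the continuous
  functions and the indicators of cylinders, which have to be iterated before any conformal measure
  is available.\<close>

definition bounded_measurable :: "('a::topological_space \<Rightarrow> real) \<Rightarrow> bool" where
  "bounded_measurable \<phi> \<longleftrightarrow> \<phi> \<in> borel_measurable borel \<and> bounded (range \<phi>)"

lemma bounded_measurableI:
  "\<phi> \<in> borel_measurable borel \<Longrightarrow> (\<And>x. \<bar>\<phi> x\<bar> \<le> b) \<Longrightarrow> bounded_measurable \<phi>"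
  unfolding bounded_measurable_def bounded_iff by auto

lemma bounded_measurableE:
  assumes "bounded_measurable \<phi>"
  obtains b where "b > 0" "\<And>x. \<bar>\<phi> x\<bar> \<le> b"
  using assms unfolding bounded_measurable_def bounded_pos by auto

lemma bounded_measurable_measurable [measurable_dest]:
  "bounded_measurable \<phi> \<Longrightarrow> \<phi> \<in> borel_measurable borel"
  by (simp add: bounded_measurable_def)

lemma bounded_measurable_const [simp]: "bounded_measurable (\<lambda>_. c)"
  by (rule bounded_measurableI[where b="\<bar>c\<bar>"]) auto

lemma bounded_measurable_add:
  assumes "bounded_measurable \<phi>" "bounded_measurable \<psi>"
  shows "bounded_measurable (\<lambda>x. \<phi> x + \<psi> x)"
proof -
  obtain a b where "\<And>x. \<bar>\<phi> x\<bar> \<le> a" "\<And>x. \<bar>\<psi> x\<bar> \<le> b"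
    using assms by (metis bounded_measurableE)
  then show ?thesis using assms[THEN bounded_measurable_measurable]
    by (intro bounded_measurableI[where b="a + b"])
      (auto intro!: order_trans[OF abs_triangle_ineq] add_mono)
qed

lemma bounded_measurable_mult:
  assumes "bounded_measurable \<phi>" "bounded_measurable \<psi>"
  shows "bounded_measurable (\<lambda>x. \<phi> x * \<psi> x)"
proof -
  obtain a b where ab: "\<And>x. \<bar>\<phi> x\<bar> \<le> a" "\<And>x. \<bar>\<psi> x\<bar> \<le> b"
    using assms by (metis bounded_measurableE)
  have "0 \<le> a" using ab(1)[of undefined] by linarith
  then show ?thesis using ab assms[THEN bounded_measurable_measurable]
    by (intro bounded_measurableI[where b="a * b"]) (auto simp: abs_mult intro!: mult_mono)
qed

lemma bounded_measurable_cmult: "bounded_measurable \<phi> \<Longrightarrow> bounded_measurable (\<lambda>x. c * \<phi> x)"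
  by (intro bounded_measurable_mult) auto

lemma bounded_measurable_diff:
  assumes "bounded_measurable \<phi>" "bounded_measurable \<psi>"
  shows "bounded_measurable (\<lambda>x. \<phi> x - \<psi> x)"
  using bounded_measurable_add[OF assms(1) bounded_measurable_cmult[OF assms(2), of "-1"]] by simp

lemma bounded_measurable_continuous:
  fixes \<phi> :: "'e::compact_metric_space sequ \<Rightarrow> real"
  shows "continuous_on UNIV \<phi> \<Longrightarrow> bounded_measurable \<phi>"
  unfolding bounded_measurable_def by (simp add: borel_measurable_continuous_onI bounded_range_continuous)

lemma integrable_bounded_measurable:
  assumes "bounded_measurable \<phi>" "finite_measure M" "sets M = sets borel"
  shows "integrable M \<phi>"
proof -
  interpret finite_measure M by fact
  obtain b where "\<And>x. \<bar>\<phi> x\<bar> \<le> b" using assms by (metis bounded_measurableE)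
  moreover have "\<phi> \<in> borel_measurable M"
    using assms(1,3) measurable_cong_sets[OF assms(3) refl] by (auto simp: bounded_measurable_def)
  ultimately show ?thesis by (intro integrable_const_bound[where B=b]) auto
qed

lemma continuous_prepend: "continuous_on UNIV (\<lambda>p :: 'e::metric_space \<times> 'e sequ. prepend (fst p) (snd p))"
proof (rule continuous_on_coordinatewise_then_product)
  fix i show "continuous_on UNIV (\<lambda>p :: 'e \<times> 'e sequ. prepend (fst p) (snd p) i)"
  proof (cases i)
    case (Suc k)
    have "continuous_on UNIV (\<lambda>p :: 'e \<times> 'e sequ. snd p k)"
      by (rule continuous_on_compose2[OF continuous_on_product_coordinates _ subset_UNIV])
        (intro continuous_intros)
    then show ?thesis by (simp add: prepend_def Suc)
  qed (auto simp: prepend_def intro!: continuous_intros)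
qed

lemma measurable_prepend_pair [measurable]:
  "(\<lambda>p :: 'e::compact_metric_space \<times> 'e sequ. prepend (fst p) (snd p)) \<in> borel \<Otimes>\<^sub>M borel \<rightarrow>\<^sub>M borel"
  using borel_measurable_continuous_onI[OF continuous_prepend[where 'e='e]] by (simp add: borel_prod)

lemma continuous_shift: "continuous_on UNIV (shift :: 'e::topological_space sequ \<Rightarrow> _)"
  unfolding shift_def by (intro continuous_on_coordinatewise_then_product continuous_on_product_coordinates)

lemma shift_prepend [simp]: "shift (prepend a x) = x"
  by (simp add: shift_def prepend_def)

section \<open>The logarithmic modulus and Holder functions\<close>

lemma log_modulus_0 [simp]: "log_modulus \<epsilon> r0 0 = 0"
  by (simp add: log_modulus_def)

lemma log_modulus_nonneg: "0 \<le> log_modulus \<epsilon> r0 r"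
  by (simp add: log_modulus_def)

lemma log_modulus_pos: "r0 > 1 \<Longrightarrow> 0 < r \<Longrightarrow> r \<le> 1 \<Longrightarrow> 0 < log_modulus \<epsilon> r0 r"
  by (simp add: log_modulus_def)

lemma log_modulus_mono:
  assumes "r0 > 1" "\<epsilon> > 0" "0 \<le> s" "s \<le> t" "t \<le> 1"
  shows "log_modulus \<epsilon> r0 s \<le> log_modulus \<epsilon> r0 t"
proof (cases "s = 0")
  case False
  then have "ln (r0 / t) \<le> ln (r0 / s)" "ln (r0 / t) > 0"
    using assms by (auto simp: frac_le)
  then show ?thesis using False assms by (auto simp: log_modulus_def intro!: powr_mono2')
qed (simp add: log_modulus_nonneg)

text \<open>The logarithm turns geometric contraction of distances into linear growth: ln (r0 2^m /
  d) is at least m ln 2, the other terms being nonnegative for r0 > 1 and d \<le> 1. The rate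
  n^(-\<epsilon>) of the theorem originates here.\<close>

lemma log_modulus_dyadic:
  assumes "r0 > 1" "\<epsilon> > 0" "0 \<le> d" "d \<le> 1" "m \<ge> 1"
  shows "log_modulus \<epsilon> r0 ((1/2) ^ m * d) \<le> ln 2 powr (- \<epsilon>) * real m powr (- \<epsilon>)"
proof (cases "d = 0")
  case False
  have "0 < real m * ln 2" using assms by simp
  have "ln (r0 / ((1/2) ^ m * d)) = ln r0 + real m * ln 2 - ln d"
    using assms False by (simp add: ln_div ln_mult ln_realpow)
  moreover have "ln r0 \<ge> 0" "ln d \<le> 0" using assms False by auto
  ultimately have "real m * ln 2 \<le> ln (r0 / ((1/2) ^ m * d))" by linarith
  then have "ln (r0 / ((1/2) ^ m * d)) powr (- \<epsilon>) \<le> (real m * ln 2) powr (- \<epsilon>)"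
    using assms \<open>0 < real m * ln 2\<close> by (intro powr_mono2') auto
  then show ?thesis using False by (simp add: log_modulus_def powr_mult mult.commute)
qed simp

lemma log_modulus_tendsto:
  assumes "continuous_on {0..1} (log_modulus \<epsilon> r0)" "s \<longlonglongrightarrow> 0" "\<And>k. s k \<in> {0..1}"
  shows "(\<lambda>k. log_modulus \<epsilon> r0 (s k)) \<longlonglongrightarrow> 0"
  using continuous_on_tendsto_compose[OF assms(1,2)] assms(3) by simp

text \<open>A real-valued substitute for the extended norm: one constant controls the supremum and
  the Holder seminorm at once, so estimates linear in N turn into estimates by the norm.\<close>

definition hol_bounded :: "(real \<Rightarrow> real) \<Rightarrow> real \<Rightarrow> ('e::metric_space sequ \<Rightarrow> real) \<Rightarrow> bool" where
  "hol_bounded \<omega> N \<phi> \<longleftrightarrow> (\<forall>x. \<bar>\<phi> x\<bar> \<le> N) \<and> (\<forall>x y. \<bar>\<phi> x - \<phi> y\<bar> \<le> N * \<omega> (seq_dist x y))"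

lemma hol_bounded_imp_hol_space:
  assumes "r0 > 1" "hol_bounded (log_modulus \<epsilon> r0) N \<phi>"
  shows "\<phi> \<in> hol_space (log_modulus \<epsilon> r0)"
proof -
  have "ennreal (\<bar>\<phi> x - \<phi> y\<bar> / log_modulus \<epsilon> r0 (seq_dist x y)) \<le> ennreal N" if "x \<noteq> y" for x y
  proof -
    have "0 < log_modulus \<epsilon> r0 (seq_dist x y)"
      using assms(1) that by (intro log_modulus_pos seq_dist_pos seq_dist_le_1)
    then show ?thesis using assms(2)
      by (intro ennreal_leI) (auto simp: hol_bounded_def divide_le_eq)
  qed
  then have "Hol (log_modulus \<epsilon> r0) \<phi> \<le> ennreal N"
    unfolding Hol_def by (auto intro!: SUP_least)
  then have "Hol (log_modulus \<epsilon> r0) \<phi> < \<infinity>"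
    using le_less_trans[OF _ ennreal_less_top] by (simp add: infinity_ennreal_def)
  moreover have "bounded (range \<phi>)"
    using assms(2) by (auto simp: hol_bounded_def bounded_iff)
  ultimately show ?thesis by (simp add: hol_space_def)
qed

text \<open>N is the norm itself and not merely some bound; this keeps the constant in the final
  decay estimate independent of \<phi>.\<close>

lemma hol_space_imp_hol_bounded:
  assumes "r0 > 1" "\<phi> \<in> hol_space (log_modulus \<epsilon> r0)"
  obtains N where "0 \<le> N" "hol_norm (log_modulus \<epsilon> r0) \<phi> = ennreal N"
    "hol_bounded (log_modulus \<epsilon> r0) N \<phi>"
proof -
  let ?\<omega> = "log_modulus \<epsilon> r0"
  obtain b where b: "\<And>x. \<bar>\<phi> x\<bar> \<le> b"
    using assms(2) by (auto simp: hol_space_def bounded_iff)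
  have "sup_norm \<phi> \<le> ennreal b"
    unfolding sup_norm_def using b by (auto intro!: SUP_least ennreal_leI)
  then have fin: "sup_norm \<phi> < \<infinity>" "Hol ?\<omega> \<phi> < \<infinity>"
    using le_less_trans[OF _ ennreal_less_top] assms(2) by (simp_all add: infinity_ennreal_def hol_space_def)
  then obtain s t where st: "0 \<le> s" "sup_norm \<phi> = ennreal s" "0 \<le> t" "Hol ?\<omega> \<phi> = ennreal t"
    by (metis ennreal_cases infinity_ennreal_def less_irrefl)
  have s: "\<bar>\<phi> x\<bar> \<le> s" for x
  proof -
    have "ennreal \<bar>\<phi> x\<bar> \<le> ennreal s"
      unfolding st(2)[symmetric] sup_norm_def by (rule SUP_upper) simp
    then show ?thesis using st(1) by simp
  qed
  have t: "\<bar>\<phi> x - \<phi> y\<bar> \<le> t * ?\<omega> (seq_dist x y)" for x y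
  proof (cases "x = y")
    case False
    then have w: "0 < ?\<omega> (seq_dist x y)"
      using assms(1) by (intro log_modulus_pos seq_dist_pos seq_dist_le_1)
    have "ennreal (\<bar>\<phi> x - \<phi> y\<bar> / ?\<omega> (seq_dist x y)) \<le> ennreal t"
      unfolding st(4)[symmetric] Hol_def using False
      by (intro SUP_upper2[where i="(x, y)"]) auto
    then show ?thesis using st(3) w by (simp add: divide_le_eq)
  qed simp
  show thesis
  proof (rule that[of "s + t"])
    show "hol_norm ?\<omega> \<phi> = ennreal (s + t)" using st by (simp add: hol_norm_def)
    have "t * ?\<omega> (seq_dist x y) \<le> (s + t) * ?\<omega> (seq_dist x y)" for x y
      using st by (intro mult_right_mono log_modulus_nonneg) auto
    then show "hol_bounded ?\<omega> (s + t) \<phi>"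
      unfolding hol_bounded_def using s t st order_trans by (metis add.commute add_increasing)
  qed (use st in simp)
qed

lemma hol_bounded_continuous:
  fixes \<phi> :: "'e::compact_metric_space sequ \<Rightarrow> real"
  assumes "continuous_on {0..1} (log_modulus \<epsilon> r0)" "hol_bounded (log_modulus \<epsilon> r0) N \<phi>"
  shows "continuous_on UNIV \<phi>"
  unfolding continuous_on_sequentially
proof (intro allI ballI impI)
  fix x :: "nat \<Rightarrow> 'e sequ" and l assume x: "(\<forall>n. x n \<in> UNIV) \<and> x \<longlonglongrightarrow> l"
  have "(\<lambda>k. N * log_modulus \<epsilon> r0 (seq_dist (x k) l)) \<longlonglongrightarrow> N * 0"
    using x by (intro tendsto_mult tendsto_const log_modulus_tendsto[OF assms(1)] seq_dist_tendsto)
      (auto simp: seq_dist_nonneg seq_dist_le_1)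
  then have lim: "(\<lambda>k. N * log_modulus \<epsilon> r0 (seq_dist (x k) l)) \<longlonglongrightarrow> 0" by simp
  have "(\<lambda>k. \<phi> (x k) - \<phi> l) \<longlonglongrightarrow> 0"
    using assms(2) by (rule_tac Lim_null_comparison[OF _ lim]) (auto simp: hol_bounded_def)
  then show "(\<phi> \<circ> x) \<longlonglongrightarrow> \<phi> l" by (simp add: LIM_zero_iff o_def)
qed

lemma hol_bounded_mult:
  assumes "hol_bounded \<omega> M \<phi>" "hol_bounded \<omega> N \<psi>"
  shows "hol_bounded \<omega> (2 * M * N) (\<lambda>x. \<phi> x * \<psi> x)"
  unfolding hol_bounded_def
proof (intro conjI allI)
  have M: "\<bar>\<phi> x\<bar> \<le> M" and N: "\<bar>\<psi> x\<bar> \<le> N" for x using assms by (auto simp: hol_bounded_def)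
  have MN: "0 \<le> M" "0 \<le> N" using M[of undefined] N[of undefined] by linarith+
  fix x
  have "\<bar>\<phi> x * \<psi> x\<bar> \<le> M * N" unfolding abs_mult using M N MN by (intro mult_mono) auto
  moreover have "0 \<le> M * N" using MN by simp
  ultimately show "\<bar>\<phi> x * \<psi> x\<bar> \<le> 2 * M * N" by linarith
  fix y
  have "\<phi> x * \<psi> x - \<phi> y * \<psi> y = \<phi> x * (\<psi> x - \<psi> y) + \<psi> y * (\<phi> x - \<phi> y)"
    by (simp add: algebra_simps)
  also have "\<bar>\<dots>\<bar> \<le> \<bar>\<phi> x\<bar> * \<bar>\<psi> x - \<psi> y\<bar> + \<bar>\<psi> y\<bar> * \<bar>\<phi> x - \<phi> y\<bar>"
    by (metis abs_mult abs_triangle_ineq)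
  also have "\<dots> \<le> M * (N * \<omega> (seq_dist x y)) + N * (M * \<omega> (seq_dist x y))"
    using assms MN by (intro add_mono mult_mono) (auto simp: hol_bounded_def)
  finally show "\<bar>\<phi> x * \<psi> x - \<phi> y * \<psi> y\<bar> \<le> 2 * M * N * \<omega> (seq_dist x y)"
    by (simp add: algebra_simps)
qed

section \<open>The transfer operator of a flat potential\<close>

locale flat_system = prob_space \<mu>
  for \<mu> :: "'e::compact_metric_space measure" +
  fixes \<epsilon> r0 C :: real and f :: "'e sequ \<Rightarrow> real"
  assumes sets_mu: "sets \<mu> = sets borel"
    and eps: "\<epsilon> > 0" and r0: "r0 > 1" and C: "C > 0"
    and cont_modulus: "continuous_on {0..1} (log_modulus \<epsilon> r0)"
    and f_hol: "f \<in> hol_space (log_modulus \<epsilon> r0)"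
    and flat: "\<And>n x y. AE (xs, ys) in natural_coupling \<mu> n x y.
      \<bar>birkhoff f n xs - birkhoff f n ys\<bar> \<le> C * log_modulus \<epsilon> r0 (seq_dist x y)"
begin

abbreviation \<omega> where "\<omega> \<equiv> log_modulus \<epsilon> r0"
abbreviation L where "L \<equiv> transfer (prepend_kernel \<mu>) f"

lemma modulus_le_1: "\<omega> (seq_dist x y) \<le> \<omega> 1"
  by (intro log_modulus_mono r0 eps seq_dist_nonneg seq_dist_le_1) simp

lemma continuous_hol_space: "(\<phi> :: 'e sequ \<Rightarrow> real) \<in> hol_space \<omega> \<Longrightarrow> continuous_on UNIV \<phi>"
  by (erule hol_space_imp_hol_bounded[OF r0]) (erule hol_bounded_continuous[OF cont_modulus])

lemma continuous_f: "continuous_on UNIV f"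
  by (rule continuous_hol_space[OF f_hol])

lemma bounded_measurable_exp_f: "bounded_measurable (\<lambda>x. exp (f x))"
  by (intro bounded_measurable_continuous continuous_intros continuous_f)

section \<open>Action on bounded Borel and on continuous functions\<close>

lemma transfer_eq:
  assumes "bounded_measurable \<phi>"
  shows "L \<phi> x = (\<integral>a. exp (f (prepend a x)) * \<phi> (prepend a x) \<partial>\<mu>)"
  by (intro transfer_prepend_kernel sets_mu borel_measurable_continuous_onI[OF continuous_f]
    bounded_measurable_measurable[OF assms])

lemma integrable_prepend:
  assumes "bounded_measurable \<phi>"
  shows "integrable \<mu> (\<lambda>a. \<phi> (prepend a x))"
proof (rule integrable_bounded_measurable[OF _ finite_measure_axioms sets_mu])
  obtain b where b: "\<And>x. \<bar>\<phi> x\<bar> \<le> b" using assms by (metis bounded_measurableE)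
  show "bounded_measurable (\<lambda>a. \<phi> (prepend a x))"
    using b assms by (intro bounded_measurableI[where b=b]) (auto simp: bounded_measurable_def)
qed

lemma integrable_transfer:
  "bounded_measurable \<phi> \<Longrightarrow> integrable \<mu> (\<lambda>a. exp (f (prepend a x)) * \<phi> (prepend a x))"
  using integrable_prepend[OF bounded_measurable_mult[OF bounded_measurable_exp_f]] .

lemma bounded_measurable_transfer:
  assumes "bounded_measurable \<phi>"
  shows "bounded_measurable (L \<phi>)"
proof -
  define \<psi> where "\<psi> x = exp (f x) * \<phi> x" for x
  have \<psi>: "bounded_measurable \<psi>"
    unfolding \<psi>_def by (intro bounded_measurable_mult bounded_measurable_exp_f assms)
  then have [measurable]: "\<psi> \<in> borel_measurable borel" by (simp add: bounded_measurable_def)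
  obtain b where b: "\<And>x. \<bar>\<psi> x\<bar> \<le> b" using \<psi> by (metis bounded_measurableE)
  have L: "L \<phi> = (\<lambda>x. \<integral>a. \<psi> (prepend a x) \<partial>\<mu>)"
    using transfer_eq[OF assms] by (simp add: \<psi>_def fun_eq_iff)
  have [measurable]: "(\<lambda>(x, a). prepend a x) \<in> borel \<Otimes>\<^sub>M borel \<rightarrow>\<^sub>M (borel :: 'e sequ measure)"
    using measurable_compose[OF measurable_pair_swap' measurable_prepend_pair]
    by (simp add: split_beta')
  show ?thesis unfolding L
  proof (rule bounded_measurableI[where b=b])
    have "(\<lambda>(x, a). \<psi> (prepend a x)) \<in> borel_measurable (borel \<Otimes>\<^sub>M borel)"
      using measurable_compose[OF \<open>(\<lambda>(x, a). prepend a x) \<in> _\<close> \<open>\<psi> \<in> _\<close>] by (simp add: split_beta')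
    then have "(\<lambda>(x, a). \<psi> (prepend a x)) \<in> borel_measurable (borel \<Otimes>\<^sub>M \<mu>)"
      using measurable_cong_sets[OF sets_pair_measure_cong[OF refl sets_mu] refl] by blast
    then show "(\<lambda>x. \<integral>a. \<psi> (prepend a x) \<partial>\<mu>) \<in> borel_measurable borel"
      by (rule borel_measurable_lebesgue_integral)
    fix x
    have "\<bar>\<integral>a. \<psi> (prepend a x) \<partial>\<mu>\<bar> \<le> (\<integral>a. \<bar>\<psi> (prepend a x)\<bar> \<partial>\<mu>)"
      by (rule integral_abs_bound)
    also have "\<dots> \<le> (\<integral>a. b \<partial>\<mu>)"
      by (intro integral_mono integrable_abs integrable_prepend \<psi>) (auto simp: b)
    finally show "\<bar>\<integral>a. \<psi> (prepend a x) \<partial>\<mu>\<bar> \<le> b" by (simp add: prob_space)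
  qed
qed

lemma continuous_transfer:
  assumes "continuous_on UNIV \<phi>"
  shows "continuous_on UNIV (L \<phi>)"
  unfolding continuous_on_sequentially
proof (intro allI ballI impI)
  define \<psi> where "\<psi> x = exp (f x) * \<phi> x" for x
  have \<psi>c: "continuous_on UNIV \<psi>"
    unfolding \<psi>_def by (intro continuous_intros assms continuous_f)
  note \<psi> = bounded_measurable_continuous[OF \<psi>c]
  obtain b where b: "\<And>x. \<bar>\<psi> x\<bar> \<le> b" using \<psi> by (metis bounded_measurableE)
  have L: "L \<phi> x = (\<integral>a. \<psi> (prepend a x) \<partial>\<mu>)" for x
    using transfer_eq[OF bounded_measurable_continuous[OF assms]] by (simp add: \<psi>_def)
  fix x :: "nat \<Rightarrow> 'e sequ" and l assume x: "(\<forall>n. x n \<in> UNIV) \<and> x \<longlonglongrightarrow> l"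
  have "(\<lambda>n. \<psi> (prepend a (x n))) \<longlonglongrightarrow> \<psi> (prepend a l)" for a
  proof -
    have "(\<lambda>n. prepend (fst (a, x n)) (snd (a, x n))) \<longlonglongrightarrow> prepend (fst (a, l)) (snd (a, l))"
      using x by (intro continuous_on_tendsto_compose[OF continuous_prepend] tendsto_Pair) auto
    then show ?thesis using continuous_on_tendsto_compose[OF \<psi>c] by simp
  qed
  then have "(\<lambda>n. \<integral>a. \<psi> (prepend a (x n)) \<partial>\<mu>) \<longlonglongrightarrow> (\<integral>a. \<psi> (prepend a l) \<partial>\<mu>)"
    using integrable_prepend[OF \<psi>] b
    by (intro integral_dominated_convergence[where w="\<lambda>_. b"]) (auto dest: borel_measurable_integrable)
  then show "(L \<phi> \<circ> x) \<longlonglongrightarrow> L \<phi> l" by (simp add: L o_def)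
qed

lemma bounded_measurable_iterate: "bounded_measurable \<phi> \<Longrightarrow> bounded_measurable ((L ^^ n) \<phi>)"
  by (induction n) (auto intro: bounded_measurable_transfer)

lemma continuous_iterate: "continuous_on UNIV \<phi> \<Longrightarrow> continuous_on UNIV ((L ^^ n) \<phi>)"
  by (induction n) (auto intro: continuous_transfer)

lemma transfer_add:
  assumes "bounded_measurable \<phi>" "bounded_measurable \<psi>"
  shows "L (\<lambda>x. \<phi> x + \<psi> x) = (\<lambda>x. L \<phi> x + L \<psi> x)"
  using integrable_transfer[OF assms(1)] integrable_transfer[OF assms(2)]
  by (auto simp: fun_eq_iff transfer_eq assms bounded_measurable_add distrib_left)

lemma transfer_cmult:
  assumes "bounded_measurable \<phi>"
  shows "L (\<lambda>x. c * \<phi> x) = (\<lambda>x. c * L \<phi> x)"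
  by (auto simp: fun_eq_iff transfer_eq assms bounded_measurable_cmult mult.left_commute[of _ c])

lemma iterate_add:
  assumes "bounded_measurable \<phi>" "bounded_measurable \<psi>"
  shows "(L ^^ n) (\<lambda>x. \<phi> x + \<psi> x) = (\<lambda>x. (L ^^ n) \<phi> x + (L ^^ n) \<psi> x)"
  by (induction n) (auto simp: transfer_add bounded_measurable_iterate assms)

lemma iterate_cmult:
  assumes "bounded_measurable \<phi>"
  shows "(L ^^ n) (\<lambda>x. c * \<phi> x) = (\<lambda>x. c * (L ^^ n) \<phi> x)"
  by (induction n) (auto simp: transfer_cmult bounded_measurable_iterate assms)

lemma iterate_const: "(L ^^ n) (\<lambda>_. c) = (\<lambda>x. c * (L ^^ n) (\<lambda>_. 1) x)"
  using iterate_cmult[of "\<lambda>_. 1" n c] by simp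

section \<open>Iterates as integrals over words\<close>

text \<open>The logarithm of the weight that the n-th iterate gives to the branch w at x. The sum
  starts at j = 1 because the operator evaluates f after a letter has been prepended.\<close>

definition bsum :: "nat \<Rightarrow> (nat \<Rightarrow> 'e) \<Rightarrow> 'e sequ \<Rightarrow> real" where
  "bsum n w x = (\<Sum>j=1..n. f (prefix_word j w x))"

lemma bsum_Suc: "bsum (Suc n) w x = bsum n w x + f (prefix_word (Suc n) w x)"
  by (simp add: bsum_def)

lemma birkhoff_orbit: "birkhoff f n (orbit n w x) = bsum n w x"
  unfolding birkhoff_def bsum_def by (intro sum.cong refl) (simp add: orbit_eq_prefix_word)

text \<open>The coupling is the image of the product measure on words, so its null sets pull back to
  null sets of words. The exceptional set may depend on x and y, which is harmless since words are
  integrated out for a fixed pair.\<close>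

lemma bsum_flat:
  "AE w in PiM {1..n} (\<lambda>_. \<mu>). \<bar>bsum n w x - bsum n w y\<bar> \<le> C * \<omega> (seq_dist x y)"
proof -
  have "AE w in PiM {1..n} (\<lambda>_. \<mu>). case (orbit n w x, orbit n w y) of (xs, ys) \<Rightarrow>
      \<bar>birkhoff f n xs - birkhoff f n ys\<bar> \<le> C * \<omega> (seq_dist x y)"
    using flat[of n x y] unfolding natural_coupling_def
    by (rule AE_distrD[rotated]) (intro measurable_Pair measurable_orbit sets_mu)
  then show ?thesis by (simp add: birkhoff_orbit)
qed

lemma measurable_prefix_word:
  assumes "j \<le> n"
  shows "(\<lambda>w. prefix_word j w x) \<in> PiM {1..n} (\<lambda>_. \<mu>) \<rightarrow>\<^sub>M borel"
proof (cases "j = 0")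
  case False
  then have j: "j \<in> {1..n}" using assms by auto
  have "(\<lambda>w. orbit n w x j) \<in> PiM {1..n} (\<lambda>_. \<mu>) \<rightarrow>\<^sub>M borel"
    using measurable_compose[OF measurable_orbit[OF sets_mu] measurable_component_singleton[OF j]] .
  then show ?thesis by (simp add: orbit_eq_prefix_word[OF j])
qed simp

lemma integrable_prefix_word:
  assumes "bounded_measurable \<phi>"
  shows "integrable (PiM {1..n} (\<lambda>_. \<mu>)) (\<lambda>w. exp (bsum n w x) * \<phi> (prefix_word n w x))"
proof -
  interpret P: prob_space "PiM {1..n} (\<lambda>_. \<mu>)"
    by (intro prob_space_PiM prob_space_axioms)
  obtain b where b: "b > 0" "\<And>x. \<bar>\<phi> x\<bar> \<le> b" using assms by (metis bounded_measurableE)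
  obtain F where F: "\<And>x. \<bar>f x\<bar> \<le> F"
    using bounded_measurable_continuous[OF continuous_f] by (metis bounded_measurableE)
  note [measurable] = measurable_prefix_word bounded_measurable_measurable[OF assms]
    borel_measurable_continuous_onI[OF continuous_f]
  show ?thesis
  proof (rule P.integrable_const_bound[where B="exp (real n * F) * b"])
    have "bsum n w x \<le> real n * F" for w
    proof -
      have "bsum n w x \<le> (\<Sum>j=1..n. F)"
        unfolding bsum_def using F by (intro sum_mono) (metis abs_le_D1)
      then show ?thesis by simp
    qed
    then show "AE w in PiM {1..n} (\<lambda>_. \<mu>). norm (exp (bsum n w x) * \<phi> (prefix_word n w x)) \<le> exp (real n * F) * b"
      using b by (auto simp: abs_mult intro!: mult_mono)
    have "(\<lambda>w. f (prefix_word j w x)) \<in> borel_measurable (PiM {1..n} (\<lambda>_. \<mu>))" if "j \<in> {1..n}" for j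
      using that by (intro measurable_compose[OF measurable_prefix_word borel_measurable_continuous_onI[OF continuous_f]]) auto
    then show "(\<lambda>w. exp (bsum n w x) * \<phi> (prefix_word n w x)) \<in> borel_measurable (PiM {1..n} (\<lambda>_. \<mu>))"
      unfolding bsum_def by measurable
  qed
qed

text \<open>The letter of index \<open>Suc n\<close> is prepended last and enters only the last
  summand of \<open>bsum\<close>. Integrating it out first replaces \<phi> by
  \<open>L \<phi>\<close> on words of length n, hence the induction over all \<phi>.\<close>

lemma iterate_eq_integral:
  assumes "bounded_measurable \<phi>"
  shows "(L ^^ n) \<phi> x = (\<integral>w. exp (bsum n w x) * \<phi> (prefix_word n w x) \<partial>PiM {1..n} (\<lambda>_. \<mu>))"
  using assms
proof (induction n arbitrary: \<phi>)
  case 0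
  interpret P: prob_space "PiM {1..0::nat} (\<lambda>_. \<mu>)"
    by (intro prob_space_PiM prob_space_axioms)
  show ?case using P.prob_space by (simp add: bsum_def)
next
  case (Suc n)
  interpret product_sigma_finite "\<lambda>_::nat. \<mu>" by standard
  have ins: "{1..Suc n} = insert (Suc n) {1..n}" by auto
  have cong: "prefix_word j (w(Suc n := a)) x = prefix_word j w x" if "j \<le> n" for j w a
    using that by (intro prefix_word_cong) auto
  have bs: "bsum n (w(Suc n := a)) x = bsum n w x" for w a
    unfolding bsum_def by (intro sum.cong refl arg_cong[of _ _ f] cong) auto
  have pt: "exp (bsum (Suc n) (w(Suc n := a)) x) * \<phi> (prefix_word (Suc n) (w(Suc n := a)) x)
      = exp (bsum n w x) * (exp (f (prepend a (prefix_word n w x))) * \<phi> (prepend a (prefix_word n w x)))" for w a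
    by (simp add: bsum_Suc bs prefix_word_Suc cong exp_add)
  have "(\<integral>w. exp (bsum (Suc n) w x) * \<phi> (prefix_word (Suc n) w x) \<partial>PiM {1..Suc n} (\<lambda>_. \<mu>))
      = (\<integral>w. exp (bsum n w x) * L \<phi> (prefix_word n w x) \<partial>PiM {1..n} (\<lambda>_. \<mu>))"
    using integrable_prefix_word[OF Suc.prems, of "Suc n" x] unfolding ins
    by (subst product_integral_insert) (auto simp: pt transfer_eq[OF Suc.prems])
  also have "\<dots> = (L ^^ Suc n) \<phi> x"
    using Suc.IH[OF bounded_measurable_transfer[OF Suc.prems]] by (simp add: funpow_Suc_right del: funpow.simps)
  finally show ?case ..
qed

text \<open>The only place where flatness enters.\<close>

lemma iterate_compare:
  assumes "bounded_measurable \<phi>" "bounded_measurable \<psi>" "\<And>z. 0 \<le> \<psi> z"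
    and le: "\<And>w. \<phi> (prefix_word n w x) \<le> \<psi> (prefix_word n w y)"
  shows "(L ^^ n) \<phi> x \<le> exp (C * \<omega> (seq_dist x y)) * (L ^^ n) \<psi> y"
proof -
  let ?d = "C * \<omega> (seq_dist x y)"
  have "(\<integral>w. exp (bsum n w x) * \<phi> (prefix_word n w x) \<partial>PiM {1..n} (\<lambda>_. \<mu>))
      \<le> (\<integral>w. exp ?d * (exp (bsum n w y) * \<psi> (prefix_word n w y)) \<partial>PiM {1..n} (\<lambda>_. \<mu>))"
  proof (rule integral_mono_AE)
    show "AE w in PiM {1..n} (\<lambda>_. \<mu>). exp (bsum n w x) * \<phi> (prefix_word n w x)
        \<le> exp ?d * (exp (bsum n w y) * \<psi> (prefix_word n w y))"
      using bsum_flat[of n x y]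
    proof eventually_elim
      case (elim w)
      \<comment> \<open>The values are exchanged while the weight at x is kept; then the weights are
        exchanged in front of the nonnegative value of \<psi>. The sign of \<phi> does not
        enter.\<close>
      have "exp (bsum n w x) * \<phi> (prefix_word n w x) \<le> exp (bsum n w x) * \<psi> (prefix_word n w y)"
        by (simp add: le)
      also have "\<dots> \<le> exp (?d + bsum n w y) * \<psi> (prefix_word n w y)"
        using elim assms(3) by (intro mult_right_mono) auto
      finally show ?case by (simp add: exp_add mult.assoc)
    qed
  qed (use integrable_prefix_word assms in auto)
  then show ?thesis by (simp add: iterate_eq_integral assms)
qed

end

section \<open>Oscillation of the ratios\<close>

lemma Sup_minus_Inf_le:
  fixes h :: "'a \<Rightarrow> real"
  assumes "\<And>x y. h x - h y \<le> b"
  shows "Sup (range h) - Inf (range h) \<le> b"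
proof -
  have "h x - b \<le> Inf (range h)" for x
    using assms[of x] by (intro cINF_greatest) (auto simp: algebra_simps)
  then have "h x \<le> b + Inf (range h)" for x by (simp add: algebra_simps)
  then have "Sup (range h) \<le> b + Inf (range h)" by (intro cSUP_least) auto
  then show ?thesis by simp
qed

context flat_system
begin

section \<open>Comparability of the iterates of 1\<close>

lemma iterate_mono:
  assumes "bounded_measurable \<phi>" "bounded_measurable \<psi>" "\<And>z. \<phi> z \<le> \<psi> z"
  shows "(L ^^ n) \<phi> x \<le> (L ^^ n) \<psi> x"
  unfolding iterate_eq_integral[OF assms(1)] iterate_eq_integral[OF assms(2)]
  by (intro integral_mono integrable_prefix_word assms mult_left_mono) auto

definition mass :: "nat \<Rightarrow> 'e sequ \<Rightarrow> real" where
  "mass n = (L ^^ n) (\<lambda>_. 1)"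

lemma bounded_measurable_mass: "bounded_measurable (mass n)"
  unfolding mass_def by (intro bounded_measurable_iterate) simp

lemma iterate_mass: "(L ^^ m) (mass n) = mass (n + m)"
  by (simp add: mass_def add.commute[of n] funpow_add)

text \<open>Only strict positivity is at stake, to allow division: the bound found here is
  exponentially small or large in n. Bounds uniform in n come from flatness.\<close>

lemma mass_lower_bound: obtains c where "c > 0" "\<And>x. c \<le> mass n x"
proof -
  obtain F where F: "\<And>x. \<bar>f x\<bar> \<le> F"
    using bounded_measurable_continuous[OF continuous_f] by (metis bounded_measurableE)
  have "exp (- F) ^ n \<le> mass n x" for x
  proof (induction n arbitrary: x)
    case (Suc n)
    have "exp (- F) ^ Suc n = (\<integral>a. exp (- F) * exp (- F) ^ n \<partial>\<mu>)"
      by (simp add: prob_space)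
    also have "\<dots> \<le> (\<integral>a. exp (f (prepend a x)) * mass n (prepend a x) \<partial>\<mu>)"
      using F Suc.IH by (intro integral_mono integrable_transfer bounded_measurable_mass mult_mono)
        (auto simp: abs_le_iff minus_le_iff)
    also have "\<dots> = mass (Suc n) x"
      using transfer_eq[OF bounded_measurable_mass, of n x] by (simp add: mass_def)
    finally show ?case .
  qed (simp add: mass_def)
  then show thesis using that[of "exp (- F) ^ n"] by auto
qed

lemma mass_pos: "0 < mass n x"
  using mass_lower_bound[of n] by (metis less_le_trans)

lemma mass_compare: "mass n x \<le> exp (C * \<omega> (seq_dist x y)) * mass n y"
  unfolding mass_def by (rule iterate_compare) auto

text \<open>The flatness factor at the largest possible distance 1. It acts as a Harnack constant:
  \<open>mass n\<close> at any two points differs at most by this factor, for every n.\<close>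

definition ratio_bound :: real where "ratio_bound = exp (C * \<omega> 1)"

lemma exp_modulus_le: "exp (C * \<omega> (seq_dist x y)) \<le> ratio_bound"
  unfolding ratio_bound_def using C modulus_le_1 by simp

lemma ratio_bound_ge_1: "1 \<le> ratio_bound"
  using C log_modulus_nonneg by (simp add: ratio_bound_def)

lemma mass_le: "mass n x \<le> ratio_bound * mass n y"
  using mass_compare[of n x y] exp_modulus_le[of x y] mass_pos[of n y]
  by (meson less_eq_real_def mult_right_mono order_trans)

section \<open>Ratios as averages, their contraction and regularity\<close>

text \<open>Dividing by \<open>mass n\<close> makes a positive operator that fixes constants, that
  is, an average over words of length n with weights proportional to
  \<open>exp (bsum n w x)\<close>.\<close>

definition ratio :: "nat \<Rightarrow> ('e sequ \<Rightarrow> real) \<Rightarrow> 'e sequ \<Rightarrow> real" where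
  "ratio n \<phi> x = (L ^^ n) \<phi> x / mass n x"

lemma iterate_eq_ratio: "(L ^^ n) \<phi> x = mass n x * ratio n \<phi> x"
  using mass_pos[of n x] by (simp add: ratio_def)

lemma iterate_iterate: "(L ^^ m) ((L ^^ n) \<phi>) x = mass (n + m) x * ratio (n + m) \<phi> x"
  by (simp add: iterate_eq_ratio[symmetric] add.commute[of n] funpow_add)

lemma ratio_add:
  "bounded_measurable \<phi> \<Longrightarrow> bounded_measurable \<psi> \<Longrightarrow>
    ratio n (\<lambda>x. \<phi> x + \<psi> x) x = ratio n \<phi> x + ratio n \<psi> x"
  by (simp add: ratio_def iterate_add add_divide_distrib)

lemma ratio_cmult: "bounded_measurable \<phi> \<Longrightarrow> ratio n (\<lambda>x. c * \<phi> x) x = c * ratio n \<phi> x"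
  by (simp add: ratio_def iterate_cmult)

lemma ratio_const: "ratio n (\<lambda>_. c) x = c"
  using mass_pos[of n x] iterate_const[of n c] by (simp add: ratio_def mass_def)

lemma ratio_mono:
  "bounded_measurable \<phi> \<Longrightarrow> bounded_measurable \<psi> \<Longrightarrow> (\<And>z. \<phi> z \<le> \<psi> z) \<Longrightarrow> ratio n \<phi> x \<le> ratio n \<psi> x"
  using mass_pos[of n x] by (auto simp: ratio_def intro!: divide_right_mono iterate_mono)

lemma ratio_abs_le: "bounded_measurable \<phi> \<Longrightarrow> (\<And>z. \<bar>\<phi> z\<bar> \<le> N) \<Longrightarrow> \<bar>ratio n \<phi> x\<bar> \<le> N"
  using ratio_mono[of \<phi> "\<lambda>_. N" n x] ratio_mono[of "\<lambda>_. - N" \<phi> n x]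
  by (simp add: ratio_const abs_le_iff minus_le_iff)

text \<open>\<open>ratio (n + m) \<phi> x\<close> is an average of \<open>ratio n \<phi>\<close>
  over the branches of length m at x, with weights proportional to \<open>exp (bsum m w x)\<close>
  times \<open>mass n\<close> at the end of the branch. Lower bounds follow by passing to
  -\<phi>.\<close>

lemma ratio_step_mono:
  assumes "bounded_measurable \<phi>" "\<And>z. ratio n \<phi> z \<le> b"
  shows "ratio (n + m) \<phi> x \<le> b"
proof -
  have "(L ^^ n) \<phi> z \<le> b * mass n z" for z
    using assms(2)[of z] mass_pos[of n z] by (simp add: ratio_def divide_le_eq)
  then have "(L ^^ m) ((L ^^ n) \<phi>) x \<le> (L ^^ m) (\<lambda>z. b * mass n z) x"
    by (intro iterate_mono bounded_measurable_iterate bounded_measurable_cmult bounded_measurable_mass assms)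
  then show ?thesis
    using mass_pos[of "n + m" x]
    by (simp add: iterate_cmult bounded_measurable_mass iterate_mass ratio_def divide_le_eq
        add.commute[of n] funpow_add)
qed

text \<open>Let s and t be the excess over a at x and at y, and B = \<open>ratio_bound\<close>. Both
  are averages of nonnegative values over common branches, so s \<le> B^3 (t + W). Hence t \<ge> s /
  B^3 - W and s - t \<le> (1 - 1 / B^3) s + W. One factor B comes from the weights of the branches,
  one from \<open>mass n\<close> at their ends, one from the normalising
  \<open>mass (n + m)\<close>.\<close>

lemma ratio_contraction:
  assumes \<phi>: "bounded_measurable \<phi>"
    and bd: "\<And>z. a \<le> ratio n \<phi> z" "\<And>z. ratio n \<phi> z \<le> a + r"
    and W: "\<And>w. \<bar>ratio n \<phi> (prefix_word m w x) - ratio n \<phi> (prefix_word m w y)\<bar> \<le> W"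
  shows "ratio (n + m) \<phi> x - ratio (n + m) \<phi> y \<le> (1 - 1 / ratio_bound ^ 3) * r + W"
proof -
  let ?B = ratio_bound
  let ?s = "ratio (n + m) \<phi> x - a" and ?t = "ratio (n + m) \<phi> y - a"
  have B: "1 \<le> ?B" by (rule ratio_bound_ge_1)
  have W0: "0 \<le> W" using W by (rule order_trans[OF abs_ge_zero])
  \<comment> \<open>Multiplying \<open>ratio n \<phi> + b\<close> by \<open>mass n\<close> turns
    averages back into iterates of L, for which branches can be compared. The choices b = - a and b
    = W - a give the two sides; the added W makes the second dominate the first at the other end of
    a branch.\<close>
  define F where "F b z = (L ^^ n) \<phi> z + b * mass n z" for b z
  have F_eq: "F b z = mass n z * (ratio n \<phi> z + b)" for b z
    by (simp add: F_def iterate_eq_ratio algebra_simps)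
  have F_bm: "bounded_measurable (F b)" for b
    unfolding F_def
    by (intro bounded_measurable_add bounded_measurable_cmult bounded_measurable_mass bounded_measurable_iterate \<phi>)
  have F_iter: "(L ^^ m) (F b) z = mass (n + m) z * (ratio (n + m) \<phi> z + b)" for b z
    unfolding F_def
    by (simp add: iterate_add iterate_cmult bounded_measurable_cmult bounded_measurable_mass
        bounded_measurable_iterate \<phi> iterate_mass iterate_iterate distrib_left)
  have nn: "0 \<le> ratio n \<phi> z + (W - a)" for z using bd(1)[of z] W0 by linarith
  have cmp: "(L ^^ m) (F (- a)) x \<le> exp (C * \<omega> (seq_dist x y)) * (L ^^ m) (\<lambda>z. ?B * F (W - a) z) y"
  proof (rule iterate_compare)
    show "0 \<le> ?B * F (W - a) z" for z
      using nn mass_pos[of n z] B by (simp add: F_eq)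
    fix w let ?u = "prefix_word m w x" and ?v = "prefix_word m w y"
    have "F (- a) ?u \<le> mass n ?u * (ratio n \<phi> ?v + (W - a))"
      unfolding F_eq using W[of w] mass_pos[of n ?u] by (intro mult_left_mono) auto
    also have "\<dots> \<le> (?B * mass n ?v) * (ratio n \<phi> ?v + (W - a))"
      using nn mass_le by (intro mult_right_mono)
    finally show "F (- a) ?u \<le> ?B * F (W - a) ?v" by (simp add: F_eq)
  qed (intro bounded_measurable_cmult F_bm)+
  have t0: "0 \<le> ?t + W"
  proof -
    \<comment> \<open>The lower bound a persists because -a is an upper bound for the averages of
      -\<phi>.\<close>
    have "- ratio (n + m) \<phi> y \<le> - a"
      using ratio_step_mono[of "\<lambda>x. -1 * \<phi> x" n "- a" m y] bd(1)
      by (simp only: ratio_cmult \<phi> bounded_measurable_cmult) simp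
    then show ?thesis using W0 by simp
  qed
  have "mass (n + m) x * ?s \<le> exp (C * \<omega> (seq_dist x y)) * (?B * (mass (n + m) y * (?t + W)))"
    using cmp by (simp add: iterate_cmult F_bm F_iter algebra_simps)
  also have "\<dots> \<le> ?B * (?B * ((?B * mass (n + m) x) * (?t + W)))"
    using exp_modulus_le[of x y] mass_le[of "n + m" y x] B t0
      mass_pos[of "n + m" y] mass_pos[of "n + m" x]
    by (intro mult_mono mult_nonneg_nonneg) auto
  finally have "mass (n + m) x * ?s \<le> mass (n + m) x * (?B ^ 3 * (?t + W))"
    by (simp add: power3_eq_cube ac_simps)
  then have "?s \<le> ?B ^ 3 * (?t + W)" using mass_pos[of "n + m" x] by simp
  then have "?s / ?B ^ 3 \<le> ?t + W" using B by (simp add: field_simps)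
  then have "?s - ?t \<le> (1 - 1 / ?B ^ 3) * ?s + W" by (simp add: algebra_simps)
  also have "\<dots> \<le> (1 - 1 / ?B ^ 3) * r + W"
    using ratio_step_mono[OF \<phi> bd(2), of m x] B
    by (intro add_mono mult_left_mono) (auto simp: field_simps)
  finally show ?thesis by simp
qed

lemma exp_minus_one_le: "0 \<le> t \<Longrightarrow> exp t - 1 \<le> t * exp (t :: real)"
proof -
  have "1 + - t \<le> exp (- t)" by (rule exp_ge_add_one_self)
  then have "(1 - t) * exp t \<le> exp (- t) * exp t" by (intro mult_right_mono) auto
  then show ?thesis by (simp add: algebra_simps flip: exp_add)
qed

text \<open>The part 4 C comes from the two weight comparisons, whose defect of order 2 C \<omega>
  multiplies values of size at most 2 N; the 1 comes from the variation of \<phi> along the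
  branches.\<close>

definition regularity_const :: real where
  "regularity_const = (4 * C + 1) * ratio_bound ^ 2"

lemma regularity_const_pos: "0 < regularity_const"
  unfolding regularity_const_def using C ratio_bound_ge_1
  by (intro mult_pos_pos zero_less_power) linarith+

text \<open>After \<phi> is shifted by N to become nonnegative, the numerators and the denominators
  each compare up to a factor exp (C \<omega>). Their joint defect exp (2 C \<omega>) - 1 is of
  order \<omega>, with constants that do not involve n.\<close>

lemma ratio_regular:
  assumes \<phi>: "bounded_measurable \<phi>" and N: "\<And>z. \<bar>\<phi> z\<bar> \<le> N"
    and var: "\<And>w. \<bar>\<phi> (prefix_word n w x) - \<phi> (prefix_word n w y)\<bar> \<le> N * \<omega> (seq_dist x y)"
  shows "ratio n \<phi> x - ratio n \<phi> y \<le> regularity_const * N * \<omega> (seq_dist x y)"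
proof -
  let ?B = ratio_bound and ?w = "\<omega> (seq_dist x y)"
  let ?e = "exp (C * ?w)"
  have N0: "0 \<le> N" using N by (rule order_trans[OF abs_ge_zero])
  have w0: "0 \<le> ?w" by (rule log_modulus_nonneg)
  have F_bm: "bounded_measurable (\<lambda>z. \<phi> z + c)" for c by (intro bounded_measurable_add \<phi>) simp
  have F_iter: "(L ^^ n) (\<lambda>z. \<phi> z + c) z = mass n z * (ratio n \<phi> z + c)" for c z
    by (simp add: iterate_add \<phi> iterate_const[of n c] distrib_left flip: mass_def)
      (simp add: iterate_eq_ratio)
  have "(L ^^ n) (\<lambda>z. \<phi> z + N) x \<le> ?e * (L ^^ n) (\<lambda>z. \<phi> z + (N + N * ?w)) y"
  proof (rule iterate_compare)
    show "0 \<le> \<phi> z + (N + N * ?w)" for z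
      using N[of z] N0 w0 by (auto simp: abs_le_iff intro: add_nonneg_nonneg)
        (smt (verit) mult_nonneg_nonneg)
    show "\<phi> (prefix_word n w x) + N \<le> \<phi> (prefix_word n w y) + (N + N * ?w)" for w
      using var[of w] by (simp add: abs_le_iff)
  qed (rule F_bm)+
  then have "mass n x * (ratio n \<phi> x + N) \<le> ?e * (mass n y * (ratio n \<phi> y + (N + N * ?w)))"
    by (simp add: F_iter)
  also have "\<dots> \<le> ?e * ((?e * mass n x) * (ratio n \<phi> y + (N + N * ?w)))"
  proof (intro mult_left_mono mult_right_mono)
    show "mass n y \<le> ?e * mass n x" using mass_compare[of n y x] by (simp add: seq_dist_commute)
    have "0 \<le> N * ?w" using N0 w0 by simp
    then show "0 \<le> ratio n \<phi> y + (N + N * ?w)"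
      using ratio_abs_le[OF \<phi> N, of n y] by linarith
  qed auto
  finally have "mass n x * (ratio n \<phi> x + N) \<le> mass n x * (?e ^ 2 * (ratio n \<phi> y + (N + N * ?w)))"
    by (simp add: power2_eq_square ac_simps)
  then have le: "ratio n \<phi> x + N \<le> ?e ^ 2 * (ratio n \<phi> y + (N + N * ?w))"
    using mass_pos[of n x] by simp
  have e2: "?e ^ 2 \<le> ?B ^ 2" using exp_modulus_le[of x y] by (intro power_mono) auto
  have "?e ^ 2 - 1 \<le> 2 * C * ?w * ?e ^ 2"
    using exp_minus_one_le[of "2 * C * ?w"] C w0 by (simp add: mult.assoc exp_double)
  also have "\<dots> \<le> 2 * C * ?w * ?B ^ 2" using e2 C w0 by (intro mult_left_mono) auto
  finally have e1: "?e ^ 2 - 1 \<le> 2 * C * ?w * ?B ^ 2" .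
  have "ratio n \<phi> x - ratio n \<phi> y \<le> (?e ^ 2 - 1) * (ratio n \<phi> y + N) + ?e ^ 2 * (N * ?w)"
    using le by (simp add: algebra_simps)
  also have "\<dots> \<le> (2 * C * ?w * ?B ^ 2) * (2 * N) + ?B ^ 2 * (N * ?w)"
    using e1 e2 ratio_abs_le[OF \<phi> N, of n y] N0 w0 C
    by (intro add_mono mult_mono mult_nonneg_nonneg) (auto simp: abs_le_iff)
  also have "\<dots> = regularity_const * N * ?w" by (simp add: regularity_const_def algebra_simps)
  finally show ?thesis .
qed

text \<open>Regularity of the ratio, used at the two ends of a branch of length m, gives the error
  m^(-\<epsilon>) of the contraction, and the scalar recursion does the rest. The delay k admits
  indicators of cylinders, whose values agree along common branches only once these are long
  enough.\<close>

lemma ratio_oscillation_decay: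
  obtains K where "K > 0"
    "\<And>\<phi> N k j x y. bounded_measurable \<phi> \<Longrightarrow> (\<And>z. \<bar>\<phi> z\<bar> \<le> N) \<Longrightarrow>
      (\<And>n w x y. n \<ge> k \<Longrightarrow> \<bar>\<phi> (prefix_word n w x) - \<phi> (prefix_word n w y)\<bar> \<le> N * \<omega> (seq_dist x y)) \<Longrightarrow>
      j \<ge> 1 \<Longrightarrow> \<bar>ratio (k + j) \<phi> x - ratio (k + j) \<phi> y\<bar> \<le> K * N * real j powr (- \<epsilon>)"
proof -
  define \<theta> where "\<theta> = 1 - 1 / ratio_bound ^ 3"
  have "1 \<le> ratio_bound ^ 3" using ratio_bound_ge_1 by (rule one_le_power)
  moreover have "0 < ratio_bound" using ratio_bound_ge_1 by linarith
  ultimately have \<theta>: "0 \<le> \<theta>" "\<theta> < 1" by (auto simp: \<theta>_def divide_le_eq_1)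
  obtain K where K: "K > 0"
    "\<And>D N n. (\<And>n. D n \<le> N) \<Longrightarrow> 0 \<le> N \<Longrightarrow>
      (\<And>n m. m \<ge> 1 \<Longrightarrow> D (n + m) \<le> \<theta> * D n + N * real m powr (- \<epsilon>)) \<Longrightarrow>
      n \<ge> 1 \<Longrightarrow> D n \<le> K * N * real (n::nat) powr (- \<epsilon>)"
    using decay_of_affine_recursion[OF \<theta> eps] by metis
  \<comment> \<open>One multiple of N has to serve both hypotheses of the recursion: the a priori
    bound 2 N on the oscillation and the coefficient of m^(-\<epsilon>).\<close>
  define A where "A = max 2 (regularity_const * ln 2 powr (- \<epsilon>))"
  have A: "A \<ge> 2" "A \<ge> regularity_const * ln 2 powr (- \<epsilon>)" by (auto simp: A_def)
  show thesis
  proof (rule that[of "K * A"])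
    show "K * A > 0" using K(1) A(1) by simp
    fix \<phi> :: "'e sequ \<Rightarrow> real" and N k j x y
    assume \<phi>: "bounded_measurable \<phi>" and N: "\<And>z. \<bar>\<phi> z\<bar> \<le> N"
      and var: "\<And>n w x y. n \<ge> k \<Longrightarrow> \<bar>\<phi> (prefix_word n w x) - \<phi> (prefix_word n w y)\<bar> \<le> N * \<omega> (seq_dist x y)"
      and j: "(j :: nat) \<ge> 1"
    have N0: "0 \<le> N" using N by (rule order_trans[OF abs_ge_zero])
    have reg: "\<bar>ratio (k + i) \<phi> x - ratio (k + i) \<phi> y\<bar> \<le> regularity_const * N * \<omega> (seq_dist x y)" for i x y
      using ratio_regular[OF \<phi> N var, of "k + i" x y] ratio_regular[OF \<phi> N var, of "k + i" y x]
      by (simp add: seq_dist_commute abs_le_iff)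
    define D where "D i = Sup (range (ratio (k + i) \<phi>)) - Inf (range (ratio (k + i) \<phi>))" for i
    have bdd: "bdd_above (range (ratio i \<phi>))" "bdd_below (range (ratio i \<phi>))" for i
      using ratio_abs_le[OF \<phi> N, of i]
      by (auto simp: bdd_above_def bdd_below_def abs_le_iff intro: exI[of _ N] exI[of _ "- N"])
        (metis minus_le_iff)
    have le_D: "ratio (k + i) \<phi> x - ratio (k + i) \<phi> y \<le> D i" for i x y
      unfolding D_def using bdd by (intro diff_mono cSUP_upper cINF_lower) auto
    have "D j \<le> K * (A * N) * real j powr (- \<epsilon>)"
    proof (rule K(2))
      fix i
      have "ratio (k + i) \<phi> x - ratio (k + i) \<phi> y \<le> 2 * N" for x y
        using ratio_abs_le[OF \<phi> N, of "k + i" x] ratio_abs_le[OF \<phi> N, of "k + i" y] by linarith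
      then have "D i \<le> 2 * N" unfolding D_def by (rule Sup_minus_Inf_le)
      also have "\<dots> \<le> A * N" using A N0 by (intro mult_right_mono)
      finally show "D i \<le> A * N" .
      fix m :: nat assume m: "m \<ge> 1"
      let ?W = "regularity_const * N * (ln 2 powr (- \<epsilon>) * real m powr (- \<epsilon>))"
      have "D (i + m) \<le> \<theta> * D i + ?W"
        unfolding D_def[of "i + m"]
      proof (rule Sup_minus_Inf_le)
        fix x y
        show "ratio (k + (i + m)) \<phi> x - ratio (k + (i + m)) \<phi> y \<le> \<theta> * D i + ?W"
          unfolding \<theta>_def add.assoc[symmetric]
        proof (rule ratio_contraction[OF \<phi>])
          show "Inf (range (ratio (k + i) \<phi>)) \<le> ratio (k + i) \<phi> z" for z
            using bdd by (intro cINF_lower) auto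
          show "ratio (k + i) \<phi> z \<le> Inf (range (ratio (k + i) \<phi>)) + D i" for z
            unfolding D_def using bdd by (auto intro!: cSUP_upper)
          fix w
          have "\<omega> (seq_dist (prefix_word m w x) (prefix_word m w y)) \<le> ln 2 powr (- \<epsilon>) * real m powr (- \<epsilon>)"
            unfolding seq_dist_prefix_word
            by (intro log_modulus_dyadic r0 eps seq_dist_nonneg seq_dist_le_1 m)
          then show "\<bar>ratio (k + i) \<phi> (prefix_word m w x) - ratio (k + i) \<phi> (prefix_word m w y)\<bar> \<le> ?W"
            using reg[of i "prefix_word m w x" "prefix_word m w y"] N0 regularity_const_pos
            by (elim order_trans) (intro mult_left_mono mult_nonneg_nonneg, auto)
        qed
      qed
      also have "?W \<le> A * N * real m powr (- \<epsilon>)"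
        using mult_right_mono[OF A(2), of "N * real m powr (- \<epsilon>)"] N0 by (simp add: ac_simps)
      finally show "D (i + m) \<le> \<theta> * D i + A * N * real m powr (- \<epsilon>)" by simp
    qed (use A N0 j in auto)
    then show "\<bar>ratio (k + j) \<phi> x - ratio (k + j) \<phi> y\<bar> \<le> K * A * N * real j powr (- \<epsilon>)"
      using le_D[of j x y] le_D[of j y x] by (simp add: abs_le_iff mult.assoc)
  qed
qed

end

section \<open>Construction of the conformal measure\<close>

definition cylinder :: "nat set \<Rightarrow> (nat \<Rightarrow> 'e) set \<Rightarrow> 'e sequ set" where
  "cylinder J B = {x. restrict x J \<in> B}"

lemma measurable_restrict_sequ:
  "(\<lambda>x :: 'e::second_countable_topology sequ. restrict x J) \<in> borel \<rightarrow>\<^sub>M PiM J (\<lambda>_. borel)"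
  using measurable_restrict_subset[of J UNIV "\<lambda>_. borel :: 'e measure"]
    measurable_cong_sets[OF sets_PiM_equal_borel refl] by blast

lemma sets_cylinder [measurable]:
  "B \<in> sets (PiM J (\<lambda>_. borel)) \<Longrightarrow> cylinder J (B :: (nat \<Rightarrow> 'e::second_countable_topology) set) \<in> sets borel"
  using measurable_sets[OF measurable_restrict_sequ, of B J] by (simp add: cylinder_def vimage_def)

lemma bounded_measurable_indicator: "A \<in> sets borel \<Longrightarrow> bounded_measurable (indicator A)"
  by (rule bounded_measurableI[where b=1]) (auto simp: indicator_def)

text \<open>Padding k coordinates with \<open>undefined\<close> is a measurable section of the
  restriction. Since A ignores the later coordinates, it is recovered from its preimage under this
  section.\<close>

lemma cylinder_of_prefix_set:
  fixes A :: "'e::compact_metric_space sequ set"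
  assumes "A \<in> sets borel" and dep: "\<And>u v. (\<forall>i<k. u i = v i) \<Longrightarrow> u \<in> A \<longleftrightarrow> v \<in> A"
  obtains B where "B \<in> sets (PiM {..<k} (\<lambda>_. borel))" "A = cylinder {..<k} B"
proof -
  define ext where "ext b = (\<lambda>i. if i < k then b i else undefined)" for b :: "nat \<Rightarrow> 'e"
  have "ext \<in> PiM {..<k} (\<lambda>_. borel) \<rightarrow>\<^sub>M PiM UNIV (\<lambda>_. borel)"
  proof (rule measurable_PiM_single')
    show "(\<lambda>b. ext b i) \<in> PiM {..<k} (\<lambda>_. borel) \<rightarrow>\<^sub>M borel" for i
      by (cases "i < k") (auto simp: ext_def intro: measurable_component_singleton)
  qed auto
  then have "ext \<in> PiM {..<k} (\<lambda>_. borel) \<rightarrow>\<^sub>M borel"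
    using measurable_cong_sets[OF refl sets_PiM_equal_borel] by blast
  then have B: "ext -` A \<inter> space (PiM {..<k} (\<lambda>_. borel)) \<in> sets (PiM {..<k} (\<lambda>_. borel))"
    using assms(1) by (rule measurable_sets)
  have "x \<in> A \<longleftrightarrow> ext (restrict x {..<k}) \<in> A" for x
    by (rule dep) (simp add: ext_def)
  then have "A = cylinder {..<k} (ext -` A \<inter> space (PiM {..<k} (\<lambda>_. borel)))"
    by (auto simp: cylinder_def space_PiM)
  with B show thesis by (rule that)
qed

context flat_system
begin

section \<open>Functions whose ratios converge to a constant\<close>

text \<open>A relation and not a functional, since convergence is established only for functions
  with some regularity. The limit has to be the same at all points; it is the candidate for the
  integral of \<phi>.\<close>

definition ratio_limit :: "('e sequ \<Rightarrow> real) \<Rightarrow> real \<Rightarrow> bool" where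
  "ratio_limit \<phi> c \<longleftrightarrow> bounded_measurable \<phi> \<and> (\<forall>x. (\<lambda>n. ratio n \<phi> x) \<longlonglongrightarrow> c)"

lemma ratio_limit_unique: "ratio_limit \<phi> c \<Longrightarrow> ratio_limit \<phi> d \<Longrightarrow> c = d"
  unfolding ratio_limit_def by (meson LIMSEQ_unique)

lemma ratio_limit_const: "ratio_limit (\<lambda>_. c) c"
  by (simp add: ratio_limit_def ratio_const)

lemma ratio_limit_add: "ratio_limit \<phi> c \<Longrightarrow> ratio_limit \<psi> d \<Longrightarrow> ratio_limit (\<lambda>x. \<phi> x + \<psi> x) (c + d)"
  by (auto simp: ratio_limit_def ratio_add bounded_measurable_add intro: tendsto_add)

lemma ratio_limit_cmult: "ratio_limit \<phi> c \<Longrightarrow> ratio_limit (\<lambda>x. a * \<phi> x) (a * c)"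
  by (auto simp: ratio_limit_def ratio_cmult bounded_measurable_cmult intro: tendsto_intros)

lemma ratio_limit_sum:
  "finite S \<Longrightarrow> (\<And>i. i \<in> S \<Longrightarrow> ratio_limit (\<phi> i) (c i)) \<Longrightarrow> ratio_limit (\<lambda>x. \<Sum>i\<in>S. \<phi> i x) (\<Sum>i\<in>S. c i)"
  by (induction S rule: finite_induct) (auto simp: ratio_limit_const ratio_limit_add)

lemma ratio_limit_mono:
  assumes "ratio_limit \<phi> c" "ratio_limit \<psi> d" "\<And>z. \<phi> z \<le> \<psi> z"
  shows "c \<le> d"
  using assms LIMSEQ_le[of "\<lambda>n. ratio n \<phi> undefined" c "\<lambda>n. ratio n \<psi> undefined" d]
  by (auto simp: ratio_limit_def intro!: exI[of _ 0] ratio_mono)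

text \<open>A bound at a single time k is enough, because all later ratios are averages of those at
  time k.\<close>

lemma ratio_limit_le:
  assumes "ratio_limit \<phi> c" "\<And>z. ratio k \<phi> z \<le> b"
  shows "c \<le> b"
proof (rule LIMSEQ_le_const2)
  show "(\<lambda>n. ratio n \<phi> undefined) \<longlonglongrightarrow> c" using assms(1) by (simp add: ratio_limit_def)
  have "ratio n \<phi> undefined \<le> b" if "n \<ge> k" for n
    using ratio_step_mono[OF _ assms(2), of "n - k"] assms(1) that by (simp add: ratio_limit_def)
  then show "\<exists>N. \<forall>n\<ge>N. ratio n \<phi> undefined \<le> b" by blast
qed

text \<open>Later ratios stay between the extreme values of earlier ones, and the width of that
  interval tends to 0: a nested interval argument.\<close>

lemma ratio_limit_exists:
  assumes \<phi>: "bounded_measurable \<phi>" and N: "\<And>z. \<bar>\<phi> z\<bar> \<le> N"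
    and var: "\<And>n w x y. n \<ge> k \<Longrightarrow> \<bar>\<phi> (prefix_word n w x) - \<phi> (prefix_word n w y)\<bar> \<le> N * \<omega> (seq_dist x y)"
  obtains c where "ratio_limit \<phi> c"
proof -
  obtain K where K: "\<And>j x y. j \<ge> 1 \<Longrightarrow> \<bar>ratio (k + j) \<phi> x - ratio (k + j) \<phi> y\<bar> \<le> K * N * real j powr (- \<epsilon>)"
    using ratio_oscillation_decay \<phi> N var by metis
  have bd: "\<bar>ratio (k + j + m) \<phi> x - ratio (k + j) \<phi> y\<bar> \<le> K * N * real j powr (- \<epsilon>)"
    if "j \<ge> 1" for j m x y
  proof -
    have "ratio (k + j + m) \<phi> x \<le> ratio (k + j) \<phi> y + K * N * real j powr (- \<epsilon>)"
      using K[OF that] by (intro ratio_step_mono[where n="k + j"] \<phi>) (simp add: abs_le_iff algebra_simps)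
    moreover have "ratio (k + j + m) (\<lambda>z. -1 * \<phi> z) x \<le> - ratio (k + j) \<phi> y + K * N * real j powr (- \<epsilon>)"
      using K[OF that] by (intro ratio_step_mono[where n="k + j"] bounded_measurable_cmult \<phi>)
        (simp only: ratio_cmult[OF \<phi>], simp add: abs_le_iff algebra_simps)
    then have "- ratio (k + j + m) \<phi> x \<le> - ratio (k + j) \<phi> y + K * N * real j powr (- \<epsilon>)"
      by (simp only: ratio_cmult[OF \<phi>])
    ultimately show ?thesis by (simp add: abs_le_iff)
  qed
  have lim0: "(\<lambda>j. K * N * real j powr (- \<epsilon>)) \<longlonglongrightarrow> 0"
  proof -
    have "(\<lambda>j. real j powr (- \<epsilon>)) \<longlonglongrightarrow> 0"
      by (intro tendsto_neg_powr filterlim_real_sequentially) (use eps in auto)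
    from tendsto_mult[OF tendsto_const this, of "K * N"] show ?thesis by simp
  qed
  \<comment> \<open>Uniformity in both points yields the Cauchy property at one point and the
    independence of the limit from the point.\<close>
  have small: "\<exists>M. \<forall>n\<ge>M. \<forall>x y. \<bar>ratio n \<phi> x - ratio M \<phi> y\<bar> < e" if "e > 0" for e
  proof -
    have "\<forall>\<^sub>F j in sequentially. K * N * real j powr (- \<epsilon>) < e"
      using lim0 that by (rule order_tendstoD)
    then obtain j where j: "K * N * real j powr (- \<epsilon>) < e" "j \<ge> 1"
      using eventually_ge_at_top[of "1::nat"]
      by (metis (mono_tags, lifting) eventually_conj eventually_happens' sequentially_bot)
    have "\<bar>ratio n \<phi> x - ratio (k + j) \<phi> y\<bar> < e" if "n \<ge> k + j" for n x y
      using bd[OF j(2), of "n - (k + j)" x y] j(1) that by simp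
    then show ?thesis by blast
  qed
  have "Cauchy (\<lambda>n. ratio n \<phi> undefined)"
  proof (rule CauchyI)
    fix e :: real assume "e > 0"
    then obtain M where M: "\<And>n x y. n \<ge> M \<Longrightarrow> \<bar>ratio n \<phi> x - ratio M \<phi> y\<bar> < e / 2"
      using small[of "e / 2"] by auto
    have "norm (ratio m \<phi> undefined - ratio n \<phi> undefined) < e" if "m \<ge> M" "n \<ge> M" for m n
      using M[OF that(1), of undefined undefined] M[OF that(2), of undefined undefined]
      unfolding real_norm_def by linarith
    then show "\<exists>M. \<forall>m\<ge>M. \<forall>n\<ge>M. norm (ratio m \<phi> undefined - ratio n \<phi> undefined) < e" by blast
  qed
  then obtain c where c: "(\<lambda>n. ratio n \<phi> undefined) \<longlonglongrightarrow> c"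
    using Cauchy_convergent convergent_def by blast
  have "(\<lambda>n. ratio n \<phi> x) \<longlonglongrightarrow> c" for x
  proof -
    have "(\<lambda>n. ratio n \<phi> x - ratio n \<phi> undefined) \<longlonglongrightarrow> 0"
    proof (rule LIMSEQ_I)
      fix e :: real assume "e > 0"
      then obtain M where M: "\<And>n x y. n \<ge> M \<Longrightarrow> \<bar>ratio n \<phi> x - ratio M \<phi> y\<bar> < e / 2"
        using small[of "e / 2"] by auto
      have "norm (ratio n \<phi> x - ratio n \<phi> undefined - 0) < e" if "n \<ge> M" for n
        using M[OF that, of x undefined] M[OF that, of undefined undefined]
        unfolding real_norm_def by linarith
      then show "\<exists>M. \<forall>n\<ge>M. norm (ratio n \<phi> x - ratio n \<phi> undefined - 0) < e" by blast
    qed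
    from tendsto_add[OF this c] show ?thesis by simp
  qed
  then show thesis using \<phi> by (intro that[of c]) (simp add: ratio_limit_def)
qed

lemma hol_bounded_variation:
  assumes "hol_bounded \<omega> N \<phi>"
  shows "\<bar>\<phi> (prefix_word n w x) - \<phi> (prefix_word n w y)\<bar> \<le> N * \<omega> (seq_dist x y)"
proof -
  have "0 \<le> N" using assms unfolding hol_bounded_def by (meson abs_ge_zero order_trans)
  have "(1/2) ^ n * seq_dist x y \<le> 1 * seq_dist x y"
    by (intro mult_right_mono seq_dist_nonneg power_le_one) auto
  then have "\<omega> (seq_dist (prefix_word n w x) (prefix_word n w y)) \<le> \<omega> (seq_dist x y)"
    unfolding seq_dist_prefix_word
    by (intro log_modulus_mono r0 eps seq_dist_le_1) (auto simp: seq_dist_nonneg)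
  then have "N * \<omega> (seq_dist (prefix_word n w x) (prefix_word n w y)) \<le> N * \<omega> (seq_dist x y)"
    using \<open>0 \<le> N\<close> by (rule mult_left_mono)
  then show ?thesis using assms unfolding hol_bounded_def by (meson order_trans)
qed

text \<open>\<open>ratio n (L \<phi>)\<close> is \<open>mass (Suc n) / mass n\<close> times
  \<open>ratio (Suc n) \<phi>\<close>, and the first factor is \<open>ratio n (L 1)\<close>. Thus l
  becomes the eigenvalue of the dual operator.\<close>

lemma ratio_limit_transfer:
  assumes "ratio_limit \<phi> c" "ratio_limit (L (\<lambda>_. 1)) l"
  shows "ratio_limit (L \<phi>) (l * c)"
proof -
  have eq: "ratio n (L \<phi>) x = ratio n (L (\<lambda>_. 1)) x * ratio (Suc n) \<phi> x" for n x
    using mass_pos[of n x] mass_pos[of "Suc n" x]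
    by (simp add: ratio_def mass_def funpow_Suc_right del: funpow.simps)
  have "(\<lambda>n. ratio n (L \<phi>) x) \<longlonglongrightarrow> l * c" for x
    unfolding eq using assms
    by (intro tendsto_mult) (auto simp: ratio_limit_def intro: LIMSEQ_Suc)
  then show ?thesis using assms by (simp add: ratio_limit_def bounded_measurable_transfer)
qed

lemma ratio_limit_cylinder_exists:
  assumes "finite J" "B \<in> sets (PiM J (\<lambda>_. borel))"
  obtains c where "ratio_limit (indicator (cylinder J B)) c"
proof -
  obtain k where k: "J \<subseteq> {..<k}" using assms(1) finite_nat_iff_bounded by blast
  show thesis
  proof (rule ratio_limit_exists[of "indicator (cylinder J B)" 1 k])
    \<comment> \<open>A word of length n \<ge> k fills every coordinate in J, so the indicator does
      not see x or y at all.\<close>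
    fix n and w :: "nat \<Rightarrow> 'e" and x y assume "k \<le> n"
    then have "restrict (prefix_word n w x) J = restrict (prefix_word n w y) J"
      using k by (auto simp: prefix_word_def restrict_def fun_eq_iff)
    then show "\<bar>indicator (cylinder J B) (prefix_word n w x) - indicator (cylinder J B) (prefix_word n w y)\<bar>
        \<le> 1 * \<omega> (seq_dist x y)"
      by (simp add: cylinder_def indicator_def log_modulus_nonneg)
  qed (use assms that in \<open>auto intro: bounded_measurable_indicator simp: indicator_def\<close>)
qed

section \<open>Finite-dimensional marginals and their extension\<close>

definition cylinder_mass :: "'e sequ set \<Rightarrow> real" where
  "cylinder_mass A = (THE c. ratio_limit (indicator A) c)"

lemma ratio_limit_cylinder:
  assumes "finite J" "B \<in> sets (PiM J (\<lambda>_. borel))"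
  shows "ratio_limit (indicator (cylinder J B)) (cylinder_mass (cylinder J B))"
  using ratio_limit_cylinder_exists[OF assms] ratio_limit_unique
  unfolding cylinder_mass_def by (metis theI)

lemma cylinder_mass_nonneg:
  "finite J \<Longrightarrow> B \<in> sets (PiM J (\<lambda>_. borel)) \<Longrightarrow> 0 \<le> cylinder_mass (cylinder J B)"
  by (rule ratio_limit_mono[OF ratio_limit_const ratio_limit_cylinder]) auto

text \<open>This replaces the limit over n by one fixed time k, at the cost of a constant. The
  indicator depends on the word alone for words of length k, so only weights are compared: one
  factor \<open>ratio_bound\<close> for the numerator, one for the denominator.\<close>

lemma cylinder_mass_le:
  assumes J: "finite J" "J \<subseteq> {..<k}" and B: "B \<in> sets (PiM J (\<lambda>_. borel))"
  shows "cylinder_mass (cylinder J B) \<le> ratio_bound ^ 2 * ratio k (indicator (cylinder J B)) x"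
proof (rule ratio_limit_le[OF ratio_limit_cylinder[OF J(1) B]])
  fix z
  let ?\<phi> = "indicator (cylinder J B) :: 'e sequ \<Rightarrow> real"
  have \<phi>: "bounded_measurable ?\<phi>" using B by (intro bounded_measurable_indicator sets_cylinder)
  have res: "restrict (prefix_word k w z) J = restrict (prefix_word k w x) J" for w
    using J(2) by (auto simp: prefix_word_def restrict_def fun_eq_iff)
  have "(L ^^ k) ?\<phi> z \<le> exp (C * \<omega> (seq_dist z x)) * (L ^^ k) ?\<phi> x"
    by (rule iterate_compare[OF \<phi> \<phi>]) (auto simp: cylinder_def res indicator_def)
  also have "\<dots> \<le> ratio_bound * (mass k x * ratio k ?\<phi> x)"
    using iterate_mono[OF bounded_measurable_const[of 0] \<phi>, of k x] iterate_const[of k 0]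
    unfolding iterate_eq_ratio[symmetric]
    by (intro mult_right_mono exp_modulus_le) (auto simp: indicator_def)
  also have "\<dots> \<le> ratio_bound * ((ratio_bound * mass k z) * ratio k ?\<phi> x)"
    using ratio_mono[OF bounded_measurable_const[of 0] \<phi>, of k x] ratio_bound_ge_1 mass_le[of k x z]
    by (intro mult_left_mono mult_right_mono) (auto simp: ratio_const)
  finally show "ratio k ?\<phi> z \<le> ratio_bound ^ 2 * ratio k ?\<phi> x"
    unfolding iterate_eq_ratio using mass_pos[of k z]
    by (simp add: power2_eq_square mult.left_commute[of _ "mass k z"] mult.assoc)
qed

text \<open>\<open>measure_of\<close> yields the null measure unless the set function is a measure,
  so the content lies in \<open>emeasure_marginal\<close>.\<close>

definition marginal :: "nat set \<Rightarrow> (nat \<Rightarrow> 'e) measure" where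
  "marginal J = measure_of (space (PiM J (\<lambda>_. borel))) (sets (PiM J (\<lambda>_. borel)))
    (\<lambda>B. ennreal (cylinder_mass (cylinder J B)))"

lemma sets_marginal [simp]: "sets (marginal J) = sets (PiM J (\<lambda>_. borel))"
  and space_marginal [simp]: "space (marginal J) = space (PiM J (\<lambda>_. borel))"
  by (simp_all add: marginal_def sets_measure_of_conv space_measure_of_conv sets.space_closed sets.sigma_sets_eq)

lemma iterate_tendsto_zero:
  assumes "\<And>i. A i \<in> sets borel" "decseq A" "(\<Inter>i. A i) = {}"
  shows "(\<lambda>i. (L ^^ k) (indicator (A i)) x) \<longlonglongrightarrow> 0"
proof -
  have bm: "bounded_measurable (indicator (A i) :: 'e sequ \<Rightarrow> real)" for i
    by (intro bounded_measurable_indicator assms)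
  have "(\<lambda>i. \<integral>w. exp (bsum k w x) * indicator (A i) (prefix_word k w x) \<partial>PiM {1..k} (\<lambda>_. \<mu>))
      \<longlonglongrightarrow> (\<integral>w. 0 \<partial>PiM {1..k} (\<lambda>_. \<mu>))"
  proof (rule integral_dominated_convergence[where w="\<lambda>w. exp (bsum k w x)"])
    show "integrable (PiM {1..k} (\<lambda>_. \<mu>)) (\<lambda>w. exp (bsum k w x))"
      using integrable_prefix_word[of "\<lambda>_. 1" k x] by simp
    have "(\<lambda>i. indicator (A i) z :: real) \<longlonglongrightarrow> 0" for z
      using LIMSEQ_indicator_decseq[OF assms(2), of z] assms(3) by (simp add: indicator_def)
    then show "AE w in PiM {1..k} (\<lambda>_. \<mu>). (\<lambda>i. exp (bsum k w x) * indicator (A i) (prefix_word k w x)) \<longlonglongrightarrow> 0"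
      by (intro AE_I2 tendsto_mult_right_zero)
  qed (use integrable_prefix_word[OF bm] in \<open>auto simp: indicator_def dest: borel_measurable_integrable\<close>)
  then show ?thesis by (simp add: iterate_eq_integral[OF bm])
qed

text \<open>Additivity survives the limit of ratios, but continuity at the empty set need not: two
  limits would have to be exchanged. The bound by a ratio at a fixed time k removes one of them, and
  dominated convergence over words of length k handles the other.\<close>

lemma emeasure_marginal:
  assumes J: "finite J" and B: "B \<in> sets (PiM J (\<lambda>_. borel))"
  shows "emeasure (marginal J) B = ennreal (cylinder_mass (cylinder J B))"
  unfolding marginal_def
proof (rule emeasure_measure_of_sigma[OF sets.sigma_algebra_axioms _ _ B])
  let ?S = "sets (PiM J (\<lambda>_. borel :: 'e measure))" and ?m = "\<lambda>B. ennreal (cylinder_mass (cylinder J B))"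
  have "(indicator (cylinder J {}) :: 'e sequ \<Rightarrow> real) = (\<lambda>_. 0)"
    by (simp add: cylinder_def fun_eq_iff)
  then have "cylinder_mass (cylinder J {}) = 0"
    using ratio_limit_unique[OF ratio_limit_cylinder[OF J sets.empty_sets], of 0] ratio_limit_const[of 0] by simp
  then show pos: "positive ?S ?m" by (simp add: positive_def)
  have add: "additive ?S ?m"
    unfolding additive_def
  proof (intro ballI impI)
    fix A B assume AB: "A \<in> ?S" "B \<in> ?S" "A \<inter> B = {}"
    have "(\<lambda>x. indicator (cylinder J A) x + indicator (cylinder J B) x)
        = (indicator (cylinder J (A \<union> B)) :: _ \<Rightarrow> real)"
      using AB by (auto simp: fun_eq_iff cylinder_def indicator_def)
    then have "cylinder_mass (cylinder J (A \<union> B)) = cylinder_mass (cylinder J A) + cylinder_mass (cylinder J B)"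
      using ratio_limit_unique[OF ratio_limit_cylinder[OF J sets.Un[OF AB(1,2)]]]
        ratio_limit_add[OF ratio_limit_cylinder[OF J AB(1)] ratio_limit_cylinder[OF J AB(2)]] by simp
    then show "?m (A \<union> B) = ?m A + ?m B"
      using cylinder_mass_nonneg[OF J] AB by (simp add: ennreal_plus)
  qed
  show "countably_additive ?S ?m"
  proof (rule sets.empty_continuous_imp_countably_additive[OF pos add])
    fix A assume A: "range A \<subseteq> ?S" "decseq A" "(\<Inter>i. A i) = {}"
    obtain k where k: "J \<subseteq> {..<k}" using J finite_nat_iff_bounded by blast
    let ?c = "\<lambda>i. ratio_bound ^ 2 * ratio k (indicator (cylinder J (A i))) undefined"
    have AS: "A i \<in> ?S" for i using A(1) by auto
    have "decseq (\<lambda>i. cylinder J (A i))" "(\<Inter>i. cylinder J (A i)) = {}"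
      using A(2,3) by (auto simp: decseq_def cylinder_def)
    then have "(\<lambda>i. (L ^^ k) (indicator (cylinder J (A i))) undefined) \<longlonglongrightarrow> 0"
      by (intro iterate_tendsto_zero sets_cylinder AS)
    then have "?c \<longlonglongrightarrow> ratio_bound ^ 2 * (0 / mass k undefined)"
      unfolding ratio_def using mass_pos[of k undefined] by (intro tendsto_intros) auto
    then have "?c \<longlonglongrightarrow> 0" by simp
    then have "(\<lambda>i. cylinder_mass (cylinder J (A i))) \<longlonglongrightarrow> 0"
      by (rule tendsto_sandwich[OF _ _ tendsto_const, rotated 2])
        (use cylinder_mass_nonneg[OF J AS] cylinder_mass_le[OF J k AS] in auto)
    then show "(\<lambda>i. ?m (A i)) \<longlonglongrightarrow> 0"
      using tendsto_ennrealI by fastforce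
  qed simp
qed

text \<open>Consistency is automatic: \<open>cylinder_mass\<close> depends on the set of points
  only, not on the index set through which the cylinder is presented.\<close>

lemma polish_projective_marginal: "polish_projective UNIV marginal"
proof (intro polish_projective.intro projective_family.intro)
  fix J H :: "nat set" assume JH: "J \<subseteq> H" "finite H"
  then have J: "finite J" using finite_subset by blast
  show "marginal J = distr (marginal H) (PiM J (\<lambda>_. borel)) (\<lambda>f. restrict f J)"
  proof (rule measure_eqI)
    fix B assume "B \<in> sets (marginal J)"
    then have B: "B \<in> sets (PiM J (\<lambda>_. borel))" by simp
    have meas: "(\<lambda>f. restrict f J) \<in> marginal H \<rightarrow>\<^sub>M PiM J (\<lambda>_. borel)"
      using measurable_restrict_subset[OF JH(1), of "\<lambda>_. borel"] measurable_cong_sets[OF sets_marginal refl] by blast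
    have "emeasure (distr (marginal H) (PiM J (\<lambda>_. borel)) (\<lambda>f. restrict f J)) B
        = emeasure (marginal H) ((\<lambda>f. restrict f J) -` B \<inter> space (marginal H))"
      using meas B by (rule emeasure_distr)
    also have "\<dots> = ennreal (cylinder_mass (cylinder H ((\<lambda>f. restrict f J) -` B \<inter> space (marginal H))))"
      using measurable_sets[OF meas B] by (intro emeasure_marginal JH) simp
    also have "cylinder H ((\<lambda>f. restrict f J) -` B \<inter> space (marginal H)) = cylinder J B"
      using JH(1) by (auto simp: cylinder_def space_PiM Int_absorb1)
    finally show "emeasure (marginal J) B = emeasure (distr (marginal H) (PiM J (\<lambda>_. borel)) (\<lambda>f. restrict f J)) B"
      unfolding emeasure_marginal[OF J B] by (rule sym)
  qed simp
next
  fix J :: "nat set" assume J: "finite J"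
  have "cylinder J (space (PiM J (\<lambda>_. borel :: 'e measure))) = UNIV"
    by (auto simp: cylinder_def space_PiM)
  then have "(indicator (cylinder J (space (PiM J (\<lambda>_. borel)))) :: 'e sequ \<Rightarrow> real) = (\<lambda>_. 1)"
    by (simp add: fun_eq_iff)
  then have "cylinder_mass (cylinder J (space (PiM J (\<lambda>_. borel)))) = 1"
    using ratio_limit_unique[OF ratio_limit_cylinder[OF J sets.top], of 1] ratio_limit_const[of 1] by simp
  then show "prob_space (marginal J)"
    by (intro prob_spaceI) (simp add: emeasure_marginal J)
qed

section \<open>The limit measure and its conformality\<close>

text \<open>The extension theorem identifies limits of ratios with \<nu> on cylinders only. A
  continuous \<phi> is uniformly close to a function of finitely many coordinates with finitely many
  values, and both the ratios and the integral are 1-Lipschitz in the supremum norm.\<close>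

lemma limit_measure_exists:
  obtains \<nu> :: "'e sequ measure" where "prob_space \<nu>" "sets \<nu> = sets borel"
    "\<And>\<phi>. continuous_on UNIV \<phi> \<Longrightarrow> ratio_limit \<phi> (\<integral>x. \<phi> x \<partial>\<nu>)"
proof -
  interpret P: polish_projective UNIV marginal by (rule polish_projective_marginal)
  define \<nu> where "\<nu> = P.lim"
  have prob: "prob_space \<nu>" unfolding \<nu>_def by (rule P.P.prob_space_axioms)
  have sets: "sets \<nu> = sets borel" unfolding \<nu>_def by (simp add: sets_PiM_equal_borel)
  interpret \<nu>: prob_space \<nu> by fact
  have cyl: "ratio_limit (indicator (cylinder J B)) (measure \<nu> (cylinder J B))"
    if J: "finite J" and B: "B \<in> sets (PiM J (\<lambda>_. borel))" for J B
  proof -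
    have "prod_emb UNIV (\<lambda>_. borel) J B = cylinder J B"
      by (auto simp: prod_emb_def cylinder_def)
    then have "emeasure \<nu> (cylinder J B) = ennreal (cylinder_mass (cylinder J B))"
      using P.emeasure_lim_emb[of J B] J B by (simp add: \<nu>_def emeasure_marginal)
    then have "measure \<nu> (cylinder J B) = cylinder_mass (cylinder J B)"
      using cylinder_mass_nonneg[OF J B] by (simp add: measure_def)
    then show ?thesis using ratio_limit_cylinder[OF J B] by simp
  qed
  have simple: "ratio_limit \<psi> (\<integral>x. \<psi> x \<partial>\<nu>)"
    if [measurable]: "\<psi> \<in> borel_measurable borel" and fin: "finite (range \<psi>)"
      and dep: "\<And>u v. (\<forall>i<k. u i = v i) \<Longrightarrow> \<psi> u = \<psi> v" for \<psi> k
  proof -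
    have eq: "\<psi> = (\<lambda>x. \<Sum>a\<in>range \<psi>. a * indicator (\<psi> -` {a}) x)"
    proof
      fix x
      have "(\<Sum>a\<in>range \<psi>. a * indicator (\<psi> -` {a}) x) = (\<Sum>a\<in>range \<psi>. if \<psi> x = a then a else 0)"
        by (intro sum.cong) (auto simp: indicator_def)
      then show "\<psi> x = (\<Sum>a\<in>range \<psi>. a * indicator (\<psi> -` {a}) x)"
        using fin by (simp add: sum.delta)
    qed
    have A: "\<psi> -` {a} \<in> sets borel" for a
      using measurable_sets[OF that(1), of "{a}"] by simp
    have "ratio_limit (\<lambda>x. \<Sum>a\<in>range \<psi>. a * indicator (\<psi> -` {a}) x) (\<Sum>a\<in>range \<psi>. a * measure \<nu> (\<psi> -` {a}))"
    proof (intro ratio_limit_sum fin ratio_limit_cmult)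
      fix a
      have "u \<in> \<psi> -` {a} \<longleftrightarrow> v \<in> \<psi> -` {a}" if "\<forall>i<k. u i = v i" for u v
        using dep[OF that] by simp
      then obtain B where "B \<in> sets (PiM {..<k} (\<lambda>_. borel))" "\<psi> -` {a} = cylinder {..<k} B"
        by (rule cylinder_of_prefix_set[OF A])
      then show "ratio_limit (indicator (\<psi> -` {a})) (measure \<nu> (\<psi> -` {a}))"
        using cyl[of "{..<k}" B] by simp
    qed
    moreover have "(\<integral>x. (\<Sum>a\<in>range \<psi>. a * indicator (\<psi> -` {a}) x) \<partial>\<nu>) = (\<Sum>a\<in>range \<psi>. a * measure \<nu> (\<psi> -` {a}))"
      using A sets by (subst Bochner_Integration.integral_sum)
        (auto intro!: integrable_mult_right integrable_real_indicator simp: less_top[symmetric])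
    ultimately show ?thesis using eq by simp
  qed
  show thesis
  proof (rule that[OF prob sets])
    fix \<phi> :: "'e sequ \<Rightarrow> real" assume \<phi>: "continuous_on UNIV \<phi>"
    note \<phi>_bm = bounded_measurable_continuous[OF \<phi>]
    have int: "integrable \<nu> \<psi>" if "bounded_measurable \<psi>" for \<psi>
      by (rule integrable_bounded_measurable[OF that \<nu>.finite_measure_axioms sets])
    have "(\<lambda>n. ratio n \<phi> x) \<longlonglongrightarrow> (\<integral>x. \<phi> x \<partial>\<nu>)" for x
    proof (rule LIMSEQ_I)
      fix e :: real assume e: "e > 0"
      \<comment> \<open>The errors 2 \<delta>, \<delta> and 2 \<delta> add up to less than
        e.\<close>
      define \<delta> where "\<delta> = e / 8"
      have \<delta>: "\<delta> > 0" using e by (simp add: \<delta>_def)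
      obtain k where k: "\<And>u v. (\<forall>i<k. u i = v i) \<Longrightarrow> \<bar>\<phi> u - \<phi> v\<bar> < \<delta>"
        using continuous_cylinder_variation[OF \<phi> \<delta>] by blast
      \<comment> \<open>\<open>cut\<close> makes \<phi> depend on k coordinates at a cost below
        \<delta>; rounding down to multiples of \<delta> then leaves finitely many values.\<close>
      define cut where "cut x = (\<lambda>i. if i < k then x i else undefined)" for x :: "'e sequ"
      define \<psi> where "\<psi> x = \<delta> * of_int \<lfloor>\<phi> (cut x) / \<delta>\<rfloor>" for x
      have "continuous_on UNIV cut"
      proof (rule continuous_on_coordinatewise_then_product)
        show "continuous_on UNIV (\<lambda>x. cut x i)" for i
          unfolding cut_def by (cases "i < k") (auto intro: continuous_on_product_coordinates)
      qed
      then have [measurable]: "(\<lambda>x. \<phi> (cut x)) \<in> borel_measurable borel"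
        by (intro borel_measurable_continuous_onI continuous_on_compose2[OF \<phi>]) auto
      have \<psi>_meas: "\<psi> \<in> borel_measurable borel" unfolding \<psi>_def by measurable
      obtain b where b: "\<And>x. \<bar>\<phi> x\<bar> \<le> b" using \<phi>_bm by (metis bounded_measurableE)
      have "range \<psi> \<subseteq> (\<lambda>j. \<delta> * of_int j) ` {\<lfloor>- b / \<delta>\<rfloor>..\<lfloor>b / \<delta>\<rfloor>}"
      proof
        fix y assume "y \<in> range \<psi>"
        then obtain x where x: "y = \<delta> * of_int \<lfloor>\<phi> (cut x) / \<delta>\<rfloor>" by (auto simp: \<psi>_def)
        have "- b / \<delta> \<le> \<phi> (cut x) / \<delta>" "\<phi> (cut x) / \<delta> \<le> b / \<delta>"
          using b[of "cut x"] \<delta> by (intro divide_right_mono; simp add: abs_le_iff minus_le_iff)+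
        then show "y \<in> (\<lambda>j. \<delta> * of_int j) ` {\<lfloor>- b / \<delta>\<rfloor>..\<lfloor>b / \<delta>\<rfloor>}"
          unfolding x by (intro imageI) (auto intro: floor_mono)
      qed
      then have fin: "finite (range \<psi>)" by (rule finite_subset) simp
      have \<psi>_lim: "ratio_limit \<psi> (\<integral>x. \<psi> x \<partial>\<nu>)"
      proof (rule simple[OF \<psi>_meas fin])
        show "\<psi> u = \<psi> v" if "\<forall>i<k. u i = v i" for u v
        proof -
          have "cut u = cut v" using that by (auto simp: cut_def)
          then show ?thesis by (simp add: \<psi>_def)
        qed
      qed
      then have \<psi>_bm: "bounded_measurable \<psi>" by (simp add: ratio_limit_def)
      have near: "\<bar>\<phi> x - \<psi> x\<bar> \<le> 2 * \<delta>" for x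
      proof -
        have "\<bar>\<phi> x - \<phi> (cut x)\<bar> < \<delta>" by (rule k) (simp add: cut_def)
        moreover have "\<bar>\<phi> (cut x) - \<psi> x\<bar> \<le> \<delta>"
        proof -
          have "\<delta> * (\<phi> (cut x) / \<delta>) \<le> \<delta> * (of_int \<lfloor>\<phi> (cut x) / \<delta>\<rfloor> + 1)"
              "\<delta> * of_int \<lfloor>\<phi> (cut x) / \<delta>\<rfloor> \<le> \<delta> * (\<phi> (cut x) / \<delta>)"
            using \<delta> by (intro mult_left_mono; linarith)+
          moreover have "\<delta> * (\<phi> (cut x) / \<delta>) = \<phi> (cut x)" using \<delta> by simp
          ultimately show ?thesis using \<delta> by (simp add: \<psi>_def distrib_left abs_le_iff)
        qed
        ultimately show ?thesis by linarith
      qed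
      have dev: "\<bar>ratio n \<phi> x - ratio n \<psi> x\<bar> \<le> 2 * \<delta>" for n
        using ratio_abs_le[OF bounded_measurable_diff[OF \<phi>_bm \<psi>_bm] near, of n x]
          ratio_add[OF \<phi>_bm bounded_measurable_cmult[OF \<psi>_bm, of "-1"], of n x] ratio_cmult[OF \<psi>_bm, of n "-1" x]
        by simp
      have "\<bar>(\<integral>x. \<phi> x \<partial>\<nu>) - (\<integral>x. \<psi> x \<partial>\<nu>)\<bar> = \<bar>\<integral>x. \<phi> x - \<psi> x \<partial>\<nu>\<bar>"
        using int[OF \<phi>_bm] int[OF \<psi>_bm] by simp
      also have "\<dots> \<le> (\<integral>x. \<bar>\<phi> x - \<psi> x\<bar> \<partial>\<nu>)" by (rule integral_abs_bound)
      also have "\<dots> \<le> (\<integral>x. 2 * \<delta> \<partial>\<nu>)"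
        using int[OF \<phi>_bm] int[OF \<psi>_bm] near by (intro integral_mono) auto
      finally have devi: "\<bar>(\<integral>x. \<phi> x \<partial>\<nu>) - (\<integral>x. \<psi> x \<partial>\<nu>)\<bar> \<le> 2 * \<delta>" by (simp add: \<nu>.prob_space)
      have "(\<lambda>n. ratio n \<psi> x) \<longlonglongrightarrow> (\<integral>x. \<psi> x \<partial>\<nu>)" using \<psi>_lim by (simp add: ratio_limit_def)
      from LIMSEQ_D[OF this \<delta>] obtain n0 where n0: "\<And>n. n \<ge> n0 \<Longrightarrow> \<bar>ratio n \<psi> x - (\<integral>x. \<psi> x \<partial>\<nu>)\<bar> < \<delta>"
        by auto
      have "norm (ratio n \<phi> x - (\<integral>x. \<phi> x \<partial>\<nu>)) < e" if "n \<ge> n0" for n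
      proof -
        have "e = 8 * \<delta>" by (simp add: \<delta>_def)
        then show ?thesis
          using dev[of n] devi n0[OF that] \<delta> unfolding real_norm_def by linarith
      qed
      then show "\<exists>n0. \<forall>n\<ge>n0. norm (ratio n \<phi> x - (\<integral>x. \<phi> x \<partial>\<nu>)) < e" by blast
    qed
    then show "ratio_limit \<phi> (\<integral>x. \<phi> x \<partial>\<nu>)" using \<phi>_bm by (simp add: ratio_limit_def)
  qed
qed

lemma conformal_measure_exists:
  obtains lam \<nu> where "lam > 0" "conformal_measure L lam \<nu>"
proof -
  obtain \<nu> :: "'e sequ measure" where \<nu>: "prob_space \<nu>" "sets \<nu> = sets borel"
    "\<And>\<phi>. continuous_on UNIV \<phi> \<Longrightarrow> ratio_limit \<phi> (\<integral>x. \<phi> x \<partial>\<nu>)"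
    by (rule limit_measure_exists) (rule that)
  \<comment> \<open>By the property of \<nu> this is the limit of
    \<open>mass (Suc n) x / mass n x\<close>, the growth rate of the iterates of 1.\<close>
  let ?l = "\<integral>x. L (\<lambda>_. 1) x \<partial>\<nu>"
  have l: "ratio_limit (L (\<lambda>_. 1)) ?l" by (intro \<nu>(3) continuous_transfer) simp
  obtain c where c: "c > 0" "\<And>x. c \<le> mass 1 x" using mass_lower_bound by blast
  have "c \<le> ?l" by (rule ratio_limit_mono[OF ratio_limit_const l]) (use c(2) in \<open>simp add: mass_def\<close>)
  show thesis
  proof (rule that)
    show "?l > 0" using c(1) \<open>c \<le> ?l\<close> by linarith
    show "conformal_measure L ?l \<nu>"
      unfolding conformal_measure_def
    proof (intro conjI \<nu> allI impI)
      fix \<phi> :: "'e sequ \<Rightarrow> real" assume \<phi>: "continuous_on UNIV \<phi>"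
      show "(\<integral>x. L \<phi> x \<partial>\<nu>) = ?l * (\<integral>x. \<phi> x \<partial>\<nu>)"
        using ratio_limit_unique[OF \<nu>(3)[OF continuous_transfer[OF \<phi>]] ratio_limit_transfer[OF \<nu>(3)[OF \<phi>] l]] .
    qed
  qed
qed

end

section \<open>Eigenfunction and decay\<close>

text \<open>From here on \<nu> is any conformal measure; its construction is forgotten.\<close>

locale conformal_system = flat_system \<mu> \<epsilon> r0 C f
  for \<mu> :: "'e::compact_metric_space measure" and \<epsilon> r0 C f +
  fixes lam :: real and \<nu> :: "'e sequ measure"
  assumes lam: "lam > 0" and conformal: "conformal_measure L lam \<nu>"
begin

lemma sets_nu: "sets \<nu> = sets borel" and prob_nu: "prob_space \<nu>"
  and transfer_nu: "continuous_on UNIV \<phi> \<Longrightarrow> (\<integral>x. L \<phi> x \<partial>\<nu>) = lam * (\<integral>x. \<phi> x \<partial>\<nu>)"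
  using conformal by (auto simp: conformal_measure_def)

sublocale nu: prob_space \<nu> by (rule prob_nu)

lemma integrable_nu: "bounded_measurable \<phi> \<Longrightarrow> integrable \<nu> \<phi>"
  using nu.finite_measure_axioms sets_nu by (intro integrable_bounded_measurable)

lemma iterate_nu: "continuous_on UNIV \<phi> \<Longrightarrow> (\<integral>x. (L ^^ n) \<phi> x \<partial>\<nu>) = lam ^ n * (\<integral>x. \<phi> x \<partial>\<nu>)"
  by (induction n) (auto simp: transfer_nu continuous_iterate)

lemma mass_nu: "(\<integral>x. mass n x \<partial>\<nu>) = lam ^ n"
  using iterate_nu[of "\<lambda>_. 1" n] nu.prob_space by (simp add: mass_def)

text \<open>If the ratio exceeded \<delta> at x, it would be at least some \<eta> > 0 everywhere.
  Then the integral of \<open>(L ^^ n) \<phi>\<close> would be at least \<eta> lam^n, whereas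
  conformality makes it lam^n times the mean of \<phi>, which is 0.\<close>

lemma zero_mean_ratio_le:
  assumes \<phi>: "continuous_on UNIV \<phi>" "(\<integral>x. \<phi> x \<partial>\<nu>) = 0"
    and osc: "\<And>x y. ratio n \<phi> x - ratio n \<phi> y \<le> \<delta>"
  shows "ratio n \<phi> x \<le> \<delta>"
proof (rule ccontr)
  assume "\<not> ratio n \<phi> x \<le> \<delta>"
  define \<eta> where "\<eta> = ratio n \<phi> x - \<delta>"
  have \<eta>: "\<eta> > 0" using \<open>\<not> _\<close> by (simp add: \<eta>_def)
  have "\<eta> * mass n y \<le> (L ^^ n) \<phi> y" for y
    using osc[of x y] mass_pos[of n y] by (simp add: iterate_eq_ratio \<eta>_def mult.commute)
  then have "(\<integral>y. \<eta> * mass n y \<partial>\<nu>) \<le> (\<integral>y. (L ^^ n) \<phi> y \<partial>\<nu>)"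
    by (intro integral_mono integrable_nu bounded_measurable_cmult bounded_measurable_mass
        bounded_measurable_iterate bounded_measurable_continuous \<phi>)
  then show False
    using \<eta> zero_less_power[OF lam, of n] by (simp add: mass_nu iterate_nu \<phi> mult_le_0_iff)
qed

lemma zero_mean_decay:
  obtains K where "K > 0"
    "\<And>\<phi> N n x. hol_bounded \<omega> N \<phi> \<Longrightarrow> (\<integral>x. \<phi> x \<partial>\<nu>) = 0 \<Longrightarrow> n \<ge> 1 \<Longrightarrow>
      \<bar>ratio n \<phi> x\<bar> \<le> K * N * real n powr (- \<epsilon>)"
proof -
  obtain K where K: "K > 0"
    "\<And>\<phi> N k j x y. bounded_measurable \<phi> \<Longrightarrow> (\<And>z. \<bar>\<phi> z\<bar> \<le> N) \<Longrightarrow>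
      (\<And>n w x y. n \<ge> k \<Longrightarrow> \<bar>\<phi> (prefix_word n w x) - \<phi> (prefix_word n w y)\<bar> \<le> N * \<omega> (seq_dist x y)) \<Longrightarrow>
      j \<ge> 1 \<Longrightarrow> \<bar>ratio (k + j) \<phi> x - ratio (k + j) \<phi> y\<bar> \<le> K * N * real j powr (- \<epsilon>)"
    using ratio_oscillation_decay by metis
  show thesis
  proof (rule that[OF K(1)])
    fix \<phi> :: "'e sequ \<Rightarrow> real" and N and n :: nat and x
    assume \<phi>: "hol_bounded \<omega> N \<phi>" and zero: "(\<integral>x. \<phi> x \<partial>\<nu>) = 0" and n: "n \<ge> 1"
    have cont: "continuous_on UNIV \<phi>" by (rule hol_bounded_continuous[OF cont_modulus \<phi>])
    note bm = bounded_measurable_continuous[OF cont]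
    \<comment> \<open>Holder functions are regular along branches of every length, so the delay is k
      = 0.\<close>
    have "\<bar>ratio (0 + n) \<phi> x - ratio (0 + n) \<phi> y\<bar> \<le> K * N * real n powr (- \<epsilon>)" for x y
      using \<phi> by (intro K(2) bm hol_bounded_variation n) (auto simp: hol_bounded_def)
    then have osc: "\<bar>ratio n \<phi> x - ratio n \<phi> y\<bar> \<le> K * N * real n powr (- \<epsilon>)" for x y by simp
    have "ratio n \<phi> x \<le> K * N * real n powr (- \<epsilon>)"
      by (rule zero_mean_ratio_le[OF cont zero]) (use osc in \<open>auto simp: abs_le_iff\<close>)
    moreover have "ratio n (\<lambda>z. -1 * \<phi> z) x \<le> K * N * real n powr (- \<epsilon>)"
    proof (rule zero_mean_ratio_le)
      show "continuous_on UNIV (\<lambda>z. -1 * \<phi> z)" by (intro continuous_intros cont)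
      show "(\<integral>x. -1 * \<phi> x \<partial>\<nu>) = 0" using zero by simp
      show "ratio n (\<lambda>z. -1 * \<phi> z) x - ratio n (\<lambda>z. -1 * \<phi> z) y \<le> K * N * real n powr (- \<epsilon>)" for x y
        unfolding ratio_cmult[OF bm] using osc[of x y] by (auto simp: abs_le_iff)
    qed
    ultimately show "\<bar>ratio n \<phi> x\<bar> \<le> K * N * real n powr (- \<epsilon>)"
      unfolding ratio_cmult[OF bm] by (simp add: abs_le_iff)
  qed
qed

section \<open>The eigenfunction\<close>

definition nmass :: "nat \<Rightarrow> 'e sequ \<Rightarrow> real" where
  "nmass n x = mass n x / lam ^ n"

lemma nmass_pos: "0 < nmass n x"
  using mass_pos lam by (simp add: nmass_def)

text \<open>The \<nu>-mean of \<open>nmass n\<close> is 1, so comparability of any two values places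
  each of them between \<open>1 / ratio_bound\<close> and \<open>ratio_bound\<close>.\<close>

lemma nmass_le: "nmass n x \<le> ratio_bound"
proof -
  have "(\<integral>y. mass n x \<partial>\<nu>) \<le> (\<integral>y. ratio_bound * mass n y \<partial>\<nu>)"
    by (intro integral_mono integrable_nu bounded_measurable_cmult bounded_measurable_mass mass_le) simp
  then show ?thesis using lam by (simp add: nmass_def mass_nu nu.prob_space divide_le_eq)
qed

lemma nmass_ge: "1 / ratio_bound \<le> nmass n x"
proof -
  have "(\<integral>y. mass n y \<partial>\<nu>) \<le> (\<integral>y. ratio_bound * mass n x \<partial>\<nu>)"
    by (intro integral_mono integrable_nu bounded_measurable_mass mass_le) simp
  then show ?thesis using lam ratio_bound_ge_1 by (simp add: nmass_def mass_nu nu.prob_space field_simps)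
qed

text \<open>C \<open>ratio_bound\<close>^2 is the Holder constant: the defect exp (C \<omega>) - 1
  contributes C \<open>ratio_bound\<close> \<omega>, the size of \<open>nmass\<close> the other
  factor. Raising C to C + 1 makes the same number bound the supremum as well.\<close>

definition hol_const :: real where "hol_const = (C + 1) * ratio_bound ^ 2"

lemma hol_const_ge: "ratio_bound \<le> hol_const"
proof -
  have "1 * (ratio_bound * 1) \<le> (C + 1) * (ratio_bound * ratio_bound)"
    using ratio_bound_ge_1 C by (intro mult_mono) auto
  then show ?thesis by (simp add: hol_const_def power2_eq_square)
qed

lemma hol_bounded_nmass: "hol_bounded \<omega> hol_const (nmass n)"
proof -
  have le: "nmass n x - nmass n y \<le> hol_const * \<omega> (seq_dist x y)" for x y
  proof -
    let ?w = "\<omega> (seq_dist x y)"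
    have w: "0 \<le> ?w" by (rule log_modulus_nonneg)
    have "nmass n x \<le> exp (C * ?w) * nmass n y"
      using divide_right_mono[OF mass_compare[of n x y], of "lam ^ n"] lam by (simp add: nmass_def)
    then have "nmass n x - nmass n y \<le> (exp (C * ?w) - 1) * nmass n y" by (simp add: algebra_simps)
    also have "\<dots> \<le> (C * ?w * ratio_bound) * ratio_bound"
    proof (intro mult_mono nmass_le)
      have "exp (C * ?w) - 1 \<le> C * ?w * exp (C * ?w)" using C w by (intro exp_minus_one_le) simp
      also have "\<dots> \<le> C * ?w * ratio_bound" using C w exp_modulus_le by (intro mult_left_mono) auto
      finally show "exp (C * ?w) - 1 \<le> C * ?w * ratio_bound" .
    qed (use C w ratio_bound_ge_1 nmass_pos[of n y] in auto)
    also have "\<dots> = C * ratio_bound ^ 2 * ?w" by (simp add: power2_eq_square)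
    also have "\<dots> \<le> hol_const * ?w"
      unfolding hol_const_def using w by (intro mult_right_mono) auto
    finally show ?thesis .
  qed
  show ?thesis
    unfolding hol_bounded_def
  proof (intro conjI allI)
    fix x show "\<bar>nmass n x\<bar> \<le> hol_const"
      using nmass_le[of n x] hol_const_ge nmass_pos[of n x] by simp
    fix y show "\<bar>nmass n x - nmass n y\<bar> \<le> hol_const * \<omega> (seq_dist x y)"
      using le[of x y] le[of y x] by (simp add: abs_le_iff seq_dist_commute)
  qed
qed

lemma continuous_nmass: "continuous_on UNIV (nmass n)"
  by (rule hol_bounded_continuous[OF cont_modulus hol_bounded_nmass])

lemma nmass_nu: "(\<integral>x. nmass n x \<partial>\<nu>) = 1"
  using lam by (simp add: nmass_def mass_nu)

text \<open>\<open>nmass (n + m) - nmass n\<close> equals \<open>nmass n\<close> times the ratio at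
  time n of \<open>nmass m - 1\<close>. The latter has mean zero and a Holder bound uniform in m,
  the added 1 in \<open>?N\<close> accounting for the subtracted mean.\<close>

lemma nmass_Cauchy:
  obtains K where "K > 0" "\<And>n m x. n \<ge> 1 \<Longrightarrow> \<bar>nmass (n + m) x - nmass n x\<bar> \<le> K * real n powr (- \<epsilon>)"
proof -
  obtain K where K: "K > 0"
    "\<And>\<phi> N n x. hol_bounded \<omega> N \<phi> \<Longrightarrow> (\<integral>x. \<phi> x \<partial>\<nu>) = 0 \<Longrightarrow> n \<ge> 1 \<Longrightarrow>
      \<bar>ratio n \<phi> x\<bar> \<le> K * N * real n powr (- \<epsilon>)"
    using zero_mean_decay by metis
  let ?N = "hol_const + 1"
  have N: "?N > 0" using hol_const_ge ratio_bound_ge_1 by linarith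
  show thesis
  proof (rule that[of "ratio_bound * (K * ?N)"])
    show "ratio_bound * (K * ?N) > 0" using K(1) N ratio_bound_ge_1 by (intro mult_pos_pos) auto
    fix n m :: nat and x assume n: "n \<ge> 1"
    have bm: "bounded_measurable (nmass m)" by (intro bounded_measurable_continuous continuous_nmass)
    have hb: "hol_bounded \<omega> ?N (\<lambda>z. nmass m z + (-1))"
      unfolding hol_bounded_def
    proof (intro conjI allI)
      fix x
      have "\<bar>nmass m x + (-1)\<bar> \<le> \<bar>nmass m x\<bar> + \<bar>-1\<bar>" by (rule abs_triangle_ineq)
      moreover have "\<bar>nmass m x\<bar> \<le> hol_const" using hol_bounded_nmass by (simp add: hol_bounded_def)
      ultimately show "\<bar>nmass m x + (-1)\<bar> \<le> ?N" by simp
      fix y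
      have "\<bar>nmass m x - nmass m y\<bar> \<le> hol_const * \<omega> (seq_dist x y)"
        using hol_bounded_nmass by (simp add: hol_bounded_def)
      also have "\<dots> \<le> ?N * \<omega> (seq_dist x y)" by (intro mult_right_mono log_modulus_nonneg) simp
      finally show "\<bar>nmass m x + (-1) - (nmass m y + (-1))\<bar> \<le> ?N * \<omega> (seq_dist x y)" by simp
    qed
    have z: "(\<integral>x. nmass m x + (-1) \<partial>\<nu>) = 0"
      using integrable_nu[OF bm] by (simp add: nmass_nu nu.prob_space)
    have "ratio n (nmass m) x = nmass (n + m) x / nmass n x"
      using ratio_cmult[OF bounded_measurable_mass, of n "1 / lam ^ m" m x] lam mass_pos[of n x]
      by (simp add: nmass_def[abs_def] ratio_def iterate_mass power_add add.commute)
    then have eq: "ratio n (\<lambda>z. nmass m z + (-1)) x = (nmass (n + m) x - nmass n x) / nmass n x"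
      unfolding ratio_add[OF bm bounded_measurable_const] ratio_const
      using nmass_pos[of n x] by (simp add: diff_divide_distrib)
    have "\<bar>nmass (n + m) x - nmass n x\<bar> = nmass n x * \<bar>ratio n (\<lambda>z. nmass m z + (-1)) x\<bar>"
      unfolding eq using nmass_pos[of n x] by (simp add: abs_divide)
    also have "\<dots> \<le> ratio_bound * (K * ?N * real n powr (- \<epsilon>))"
      using K(2)[OF hb z n] nmass_le nmass_pos[of n x] ratio_bound_ge_1 by (intro mult_mono) auto
    finally show "\<bar>nmass (n + m) x - nmass n x\<bar> \<le> ratio_bound * (K * ?N) * real n powr (- \<epsilon>)"
      by (simp add: mult.assoc)
  qed
qed

definition h :: "'e sequ \<Rightarrow> real" where "h x = lim (\<lambda>n. nmass n x)"

lemma nmass_tendsto: "(\<lambda>n. nmass n x) \<longlonglongrightarrow> h x"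
proof -
  obtain K where K: "K > 0" "\<And>n m x. n \<ge> 1 \<Longrightarrow> \<bar>nmass (n + m) x - nmass n x\<bar> \<le> K * real n powr (- \<epsilon>)"
    using nmass_Cauchy by metis
  have "Cauchy (\<lambda>n. nmass n x)"
  proof (rule CauchyI)
    fix e :: real assume "e > 0"
    have "(\<lambda>n. real n powr (- \<epsilon>)) \<longlonglongrightarrow> 0"
      by (intro tendsto_neg_powr filterlim_real_sequentially) (use eps in auto)
    from tendsto_mult[OF tendsto_const this, of K]
    have "\<forall>\<^sub>F n in sequentially. K * real n powr (- \<epsilon>) < e / 2"
      using \<open>e > 0\<close> by (intro order_tendstoD(2)) auto
    then obtain M where M: "K * real M powr (- \<epsilon>) < e / 2" "M \<ge> 1"
      using eventually_ge_at_top[of "1::nat"]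
      by (metis (mono_tags, lifting) eventually_conj eventually_happens' sequentially_bot)
    have near: "\<bar>nmass n x - nmass M x\<bar> < e / 2" if "n \<ge> M" for n
      using K(2)[OF M(2), of "n - M" x] M(1) that by simp
    have "norm (nmass m x - nmass n x) < e" if "m \<ge> M" "n \<ge> M" for m n
      using near[OF that(1)] near[OF that(2)] unfolding real_norm_def by linarith
    then show "\<exists>M. \<forall>m\<ge>M. \<forall>n\<ge>M. norm (nmass m x - nmass n x) < e" by blast
  qed
  then show ?thesis unfolding h_def using Cauchy_convergent convergent_LIMSEQ_iff by blast
qed

lemma h_le: "h x \<le> ratio_bound"
  by (rule LIMSEQ_le_const2[OF nmass_tendsto]) (use nmass_le in auto)

lemma h_ge: "1 / ratio_bound \<le> h x"
  by (rule LIMSEQ_le_const[OF nmass_tendsto]) (use nmass_ge in auto)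

lemma h_pos: "0 < h x"
  using h_ge ratio_bound_ge_1 by (metis less_le_trans zero_less_divide_1_iff zero_less_one)

lemma hol_bounded_h: "hol_bounded \<omega> hol_const h"
  unfolding hol_bounded_def
proof (intro conjI allI)
  fix x show "\<bar>h x\<bar> \<le> hol_const" using h_le[of x] hol_const_ge h_pos[of x] by simp
  fix y
  have "(\<lambda>n. \<bar>nmass n x - nmass n y\<bar>) \<longlonglongrightarrow> \<bar>h x - h y\<bar>"
    by (intro tendsto_intros nmass_tendsto)
  then show "\<bar>h x - h y\<bar> \<le> hol_const * \<omega> (seq_dist x y)"
    by (rule LIMSEQ_le_const2) (use hol_bounded_nmass in \<open>auto simp: hol_bounded_def\<close>)
qed

lemma continuous_h: "continuous_on UNIV h"
  by (rule hol_bounded_continuous[OF cont_modulus hol_bounded_h])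

lemma bounded_measurable_h: "bounded_measurable h"
  by (intro bounded_measurable_continuous continuous_h)

text \<open>Up to the factor \<open>lam\<close>, L merely raises the index of \<open>nmass\<close>;
  dominated convergence passes to the limit.\<close>

lemma transfer_h: "L h x = lam * h x"
proof -
  have bm: "bounded_measurable (nmass n)" for n by (intro bounded_measurable_continuous continuous_nmass)
  have eq: "L (nmass n) x = lam * nmass (Suc n) x" for n
    using transfer_cmult[OF bounded_measurable_mass, of "1 / lam ^ n" n] lam
    by (simp add: nmass_def[abs_def] mass_def)
  obtain b where b: "\<And>x. \<bar>exp (f x)\<bar> \<le> b" using bounded_measurable_exp_f by (metis bounded_measurableE)
  have "(\<lambda>n. L (nmass n) x) \<longlonglongrightarrow> L h x"
    unfolding transfer_eq[OF bm] transfer_eq[OF bounded_measurable_h]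
  proof (rule integral_dominated_convergence[where w="\<lambda>_. b * ratio_bound"])
    show "AE a in \<mu>. norm (exp (f (prepend a x)) * nmass n (prepend a x)) \<le> b * ratio_bound" for n
      using b nmass_le nmass_pos order_trans[OF abs_ge_zero b]
      by (intro AE_I2) (auto simp: abs_mult less_imp_le intro!: mult_mono)
    show "AE a in \<mu>. (\<lambda>n. exp (f (prepend a x)) * nmass n (prepend a x)) \<longlonglongrightarrow> exp (f (prepend a x)) * h (prepend a x)"
      by (intro AE_I2 tendsto_intros nmass_tendsto)
  qed (use integrable_transfer bm bounded_measurable_h in \<open>auto dest: borel_measurable_integrable\<close>)
  moreover have "(\<lambda>n. L (nmass n) x) \<longlonglongrightarrow> lam * h x"
    unfolding eq by (intro tendsto_intros LIMSEQ_Suc nmass_tendsto)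
  ultimately show ?thesis by (rule LIMSEQ_unique)
qed

lemma iterate_h: "(L ^^ n) h = (\<lambda>x. lam ^ n * h x)"
proof (induction n)
  case (Suc n)
  have "(L ^^ Suc n) h = L (\<lambda>x. lam ^ n * h x)" by (simp add: Suc.IH)
  also have "\<dots> = (\<lambda>x. lam ^ n * L h x)" by (rule transfer_cmult[OF bounded_measurable_h])
  finally show ?case by (simp add: transfer_h ac_simps)
qed simp

lemma h_nu: "(\<integral>x. h x \<partial>\<nu>) = 1"
proof -
  have bm: "bounded_measurable (nmass n)" for n by (intro bounded_measurable_continuous continuous_nmass)
  have "(\<lambda>n. \<integral>x. nmass n x \<partial>\<nu>) \<longlonglongrightarrow> (\<integral>x. h x \<partial>\<nu>)"
    using integrable_nu[OF bm] integrable_nu[OF bounded_measurable_h] nmass_tendsto nmass_le nmass_pos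
    by (intro integral_dominated_convergence[where w="\<lambda>_. ratio_bound"])
      (auto simp: less_imp_le dest: borel_measurable_integrable)
  then show ?thesis by (simp add: nmass_nu LIMSEQ_const_iff)
qed

section \<open>The normalized operator\<close>

abbreviation P where "P \<equiv> transfer (prepend_kernel \<mu>) (normalized_potential f h lam)"

text \<open>At \<open>prepend a x\<close> the term with the shift is h x, which does not depend on a
  and leaves the integral.\<close>

lemma normalized_eq:
  assumes "bounded_measurable \<phi>"
  shows "P \<phi> x = L (\<lambda>z. h z * \<phi> z) x / (lam * h x)"
proof -
  have cont: "continuous_on UNIV (normalized_potential f h lam)"
    unfolding normalized_potential_def
    by (intro continuous_intros continuous_f continuous_h continuous_on_compose2[OF continuous_h continuous_shift])
      (auto simp: less_imp_neq[OF h_pos, symmetric])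
  have "P \<phi> x = (\<integral>a. exp (normalized_potential f h lam (prepend a x)) * \<phi> (prepend a x) \<partial>\<mu>)"
    by (intro transfer_prepend_kernel sets_mu borel_measurable_continuous_onI cont bounded_measurable_measurable assms)
  also have "\<dots> = (\<integral>a. (exp (f (prepend a x)) * (h (prepend a x) * \<phi> (prepend a x))) / (lam * h x) \<partial>\<mu>)"
    using lam h_pos
    by (intro Bochner_Integration.integral_cong refl)
      (simp add: normalized_potential_def exp_add exp_diff field_simps)
  also have "\<dots> = L (\<lambda>z. h z * \<phi> z) x / (lam * h x)"
    by (simp add: transfer_eq bounded_measurable_mult bounded_measurable_h assms)
  finally show ?thesis .
qed

lemma inverse_h_bounded_measurable: "bounded_measurable (\<lambda>x. 1 / h x)"
  using less_imp_neq[OF h_pos] by (intro bounded_measurable_continuous continuous_intros continuous_h) auto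

lemma normalized_eq_fun:
  "bounded_measurable \<phi> \<Longrightarrow> P \<phi> = (\<lambda>x. (1 / lam) * (L (\<lambda>z. h z * \<phi> z) x * (1 / h x)))"
  by (auto simp: normalized_eq fun_eq_iff)

lemma bounded_measurable_normalized: "bounded_measurable \<phi> \<Longrightarrow> bounded_measurable (P \<phi>)"
  by (subst normalized_eq_fun, assumption)
    (intro bounded_measurable_cmult bounded_measurable_mult bounded_measurable_transfer
      inverse_h_bounded_measurable bounded_measurable_h)

lemma continuous_normalized:
  assumes "continuous_on UNIV \<phi>"
  shows "continuous_on UNIV (P \<phi>)"
  unfolding normalized_eq_fun[OF bounded_measurable_continuous[OF assms]]
  using less_imp_neq[OF h_pos] by (intro continuous_intros continuous_transfer continuous_h assms) auto

text \<open>P is \<open>L / lam\<close> conjugated by multiplication with h, so the inner factors h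
  cancel in the powers.\<close>

lemma normalized_iterate:
  assumes "bounded_measurable \<phi>"
  shows "(P ^^ n) \<phi> x = (L ^^ n) (\<lambda>z. h z * \<phi> z) x / (lam ^ n * h x)"
  using assms
proof (induction n arbitrary: \<phi> x)
  case 0 then show ?case using h_pos[of x] by simp
next
  case (Suc n)
  have "(\<lambda>z. h z * P \<phi> z) = (\<lambda>z. (1 / lam) * L (\<lambda>z. h z * \<phi> z) z)"
    using h_pos less_imp_neq[OF h_pos] by (auto simp: normalized_eq[OF Suc.prems] fun_eq_iff)
  moreover have bmL: "bounded_measurable (L (\<lambda>z. h z * \<phi> z))"
    by (intro bounded_measurable_transfer bounded_measurable_mult bounded_measurable_h Suc.prems)
  ultimately have "(P ^^ Suc n) \<phi> x = (1 / lam) * (L ^^ n) (L (\<lambda>z. h z * \<phi> z)) x / (lam ^ n * h x)"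
    using Suc.IH[OF bounded_measurable_normalized[OF Suc.prems], of x]
    by (simp only: funpow_Suc_right o_apply iterate_cmult)
  then show ?case by (simp add: funpow_Suc_right del: funpow.simps)
qed

section \<open>The stationary measure\<close>

abbreviation m where "m \<equiv> density \<nu> (\<lambda>x. ennreal (h x))"

lemma borel_nu: "\<phi> \<in> borel_measurable borel \<Longrightarrow> \<phi> \<in> borel_measurable \<nu>"
  using measurable_cong_sets[OF sets_nu refl] by blast

lemma sets_m: "sets m = sets borel"
  using sets_nu by simp

lemma borel_m: "\<phi> \<in> borel_measurable borel \<Longrightarrow> \<phi> \<in> borel_measurable m"
  using measurable_cong_sets[OF sets_m refl] by blast

lemma measurable_h: "h \<in> borel_measurable \<nu>"
  by (intro borel_nu bounded_measurable_measurable bounded_measurable_h)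

lemma prob_m: "prob_space m"
proof (rule prob_spaceI)
  have "emeasure m (space m) = (\<integral>\<^sup>+x. ennreal (h x) \<partial>\<nu>)"
    using measurable_h by (simp add: emeasure_density cong: nn_integral_cong)
  also have "\<dots> = ennreal (\<integral>x. h x \<partial>\<nu>)"
    by (intro nn_integral_eq_integral integrable_nu bounded_measurable_h AE_I2 less_imp_le h_pos)
  finally show "emeasure m (space m) = 1" by (simp add: h_nu)
qed

sublocale m: prob_space m by (rule prob_m)

lemma integral_m: "\<phi> \<in> borel_measurable borel \<Longrightarrow> (\<integral>x. \<phi> x \<partial>m) = (\<integral>x. h x * \<phi> x \<partial>\<nu>)"
  using measurable_h h_pos by (subst integral_density) (auto intro: borel_nu simp: less_imp_le)

lemma integrable_m: "bounded_measurable \<phi> \<Longrightarrow> integrable m \<phi>"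
  by (intro integrable_bounded_measurable m.finite_measure_axioms sets_m)

lemma stationary:
  assumes "continuous_on UNIV \<phi>"
  shows "(\<integral>x. P \<phi> x \<partial>m) = (\<integral>x. \<phi> x \<partial>m)"
proof -
  have bm: "bounded_measurable \<phi>" by (rule bounded_measurable_continuous[OF assms])
  have "(\<integral>x. P \<phi> x \<partial>m) = (\<integral>x. h x * P \<phi> x \<partial>\<nu>)"
    by (intro integral_m bounded_measurable_measurable bounded_measurable_normalized bm)
  also have "\<dots> = (\<integral>x. L (\<lambda>z. h z * \<phi> z) x / lam \<partial>\<nu>)"
    using less_imp_neq[OF h_pos] by (simp add: normalized_eq[OF bm])
  also have "\<dots> = (\<integral>x. h x * \<phi> x \<partial>\<nu>)"
    using lam transfer_nu[of "\<lambda>z. h z * \<phi> z"] by (simp add: continuous_intros continuous_h assms)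
  also have "\<dots> = (\<integral>x. \<phi> x \<partial>m)"
    by (intro integral_m[symmetric] bounded_measurable_measurable bm)
  finally show ?thesis .
qed

text \<open>Mean zero of \<phi> for m is mean zero of h \<phi> for \<nu>, so the decay of ratios
  applies to h \<phi>; the remaining factor is \<open>nmass n / h\<close>.\<close>

lemma normalized_decay:
  obtains K where "K > 0"
    "\<And>\<phi> N n x. hol_bounded \<omega> N \<phi> \<Longrightarrow> (\<integral>x. \<phi> x \<partial>m) = 0 \<Longrightarrow> n \<ge> 1 \<Longrightarrow>
      \<bar>(P ^^ n) \<phi> x\<bar> \<le> K * N * real n powr (- \<epsilon>)"
proof -
  obtain K where K: "K > 0"
    "\<And>\<phi> N n x. hol_bounded \<omega> N \<phi> \<Longrightarrow> (\<integral>x. \<phi> x \<partial>\<nu>) = 0 \<Longrightarrow> n \<ge> 1 \<Longrightarrow>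
      \<bar>ratio n \<phi> x\<bar> \<le> K * N * real n powr (- \<epsilon>)"
    using zero_mean_decay by metis
  let ?B = ratio_bound
  have B: "1 \<le> ?B" by (rule ratio_bound_ge_1)
  show thesis
  \<comment> \<open>\<open>2 * hol_const * N\<close> is the Holder bound of the product h \<phi>;
    \<open>?B ^ 2\<close> bounds \<open>nmass n / h\<close>.\<close>
  proof (rule that[of "K * (2 * hol_const) * ?B ^ 2"])
    show "K * (2 * hol_const) * ?B ^ 2 > 0"
      using K(1) hol_const_ge B by (intro mult_pos_pos) auto
    fix \<phi> :: "'e sequ \<Rightarrow> real" and N and n :: nat and x
    assume \<phi>: "hol_bounded \<omega> N \<phi>" and zero: "(\<integral>x. \<phi> x \<partial>m) = 0" and n: "n \<ge> 1"
    have bm: "bounded_measurable \<phi>"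
      by (intro bounded_measurable_continuous hol_bounded_continuous[OF cont_modulus \<phi>])
    have rat: "\<bar>ratio n (\<lambda>z. h z * \<phi> z) x\<bar> \<le> K * (2 * hol_const * N) * real n powr (- \<epsilon>)"
      using zero integral_m[OF bounded_measurable_measurable[OF bm]]
      by (intro K(2) hol_bounded_mult hol_bounded_h \<phi> n) simp
    have quot: "nmass n x / h x \<le> ?B ^ 2"
    proof -
      have "1 \<le> ?B * h x" using h_ge[of x] B by (simp add: field_simps)
      then have "?B * 1 \<le> ?B * (?B * h x)" using B by (intro mult_left_mono) auto
      then have "nmass n x \<le> ?B * (?B * h x)" using nmass_le[of n x] by simp
      then show ?thesis using h_pos[of x] by (simp add: divide_le_eq power2_eq_square mult.assoc)
    qed
    have "\<bar>ratio n (\<lambda>z. h z * \<phi> z) x\<bar> * (nmass n x / h x)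
        \<le> K * (2 * hol_const * N) * real n powr (- \<epsilon>) * ?B ^ 2"
    proof (intro mult_mono rat quot)
      show "0 \<le> K * (2 * hol_const * N) * real n powr (- \<epsilon>)"
        using rat by (rule order_trans[OF abs_ge_zero])
      show "0 \<le> nmass n x / h x" using nmass_pos[of n x] h_pos[of x] by simp
    qed
    moreover have "(P ^^ n) \<phi> x = ratio n (\<lambda>z. h z * \<phi> z) x * (nmass n x / h x)"
      using mass_pos[of n x] by (simp add: normalized_iterate[OF bm] iterate_eq_ratio nmass_def)
    then have "\<bar>(P ^^ n) \<phi> x\<bar> = \<bar>ratio n (\<lambda>z. h z * \<phi> z) x\<bar> * (nmass n x / h x)"
      using nmass_pos[of n x] h_pos[of x] by (simp add: abs_mult)
    ultimately show "\<bar>(P ^^ n) \<phi> x\<bar> \<le> K * (2 * hol_const) * ?B ^ 2 * N * real n powr (- \<epsilon>)"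
      by (simp add: ac_simps)
  qed
qed

section \<open>Duality with the shift\<close>

lemma normalized_nonneg:
  assumes "bounded_measurable \<phi>" "\<And>z. 0 \<le> \<phi> z"
  shows "0 \<le> P \<phi> x"
  using lam h_pos assms less_imp_le[OF h_pos]
  by (auto simp: normalized_eq transfer_eq bounded_measurable_mult bounded_measurable_h
      intro!: divide_nonneg_pos integral_nonneg)

text \<open>On every preimage \<open>prepend a x\<close> the factor \<open>\<psi> (shift z)\<close>
  has the constant value \<psi> x. This is the algebraic source of the duality.\<close>

lemma normalized_mult_shift:
  assumes "bounded_measurable \<phi>" "bounded_measurable \<psi>" "bounded_measurable (\<lambda>z. \<psi> (shift z))"
  shows "P (\<lambda>z. \<phi> z * \<psi> (shift z)) x = P \<phi> x * \<psi> x"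
  using assms
  by (simp add: normalized_eq transfer_eq bounded_measurable_mult bounded_measurable_h
      flip: mult.assoc integral_mult_left_zero)

lemma measurable_shift: "shift \<in> borel \<rightarrow>\<^sub>M (borel :: 'e sequ measure)"
  by (intro borel_measurable_continuous_onI continuous_shift)

text \<open>Stationarity only speaks about continuous functions; an equality of measures extends it to
  all Borel functions.\<close>

lemma distr_shift_density:
  assumes \<phi>: "continuous_on UNIV \<phi>" and nn: "\<And>z. 0 \<le> \<phi> z"
  shows "distr (density m (\<lambda>x. ennreal (\<phi> x))) borel shift = density m (\<lambda>x. ennreal (P \<phi> x))"
proof (rule finite_measure_eqI_continuous)
  note bm = bounded_measurable_continuous[OF \<phi>]
  have fin: "finite_measure (density m (\<lambda>x. ennreal (\<psi> x)))"
    if "bounded_measurable \<psi>" "\<And>z. 0 \<le> \<psi> z" for \<psi>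
  proof (rule finite_measureI)
    have "emeasure (density m (\<lambda>x. ennreal (\<psi> x))) (space m)
        = (\<integral>\<^sup>+x. ennreal (\<psi> x) * indicator (space m) x \<partial>m)"
      using borel_m[OF bounded_measurable_measurable[OF that(1)]]
      by (intro emeasure_density) auto
    also have "\<dots> = (\<integral>\<^sup>+x. ennreal (\<psi> x) \<partial>m)"
      by (rule nn_integral_cong) simp
    also have "\<dots> = ennreal (\<integral>x. \<psi> x \<partial>m)"
      by (intro nn_integral_eq_integral integrable_m that AE_I2)
    finally show "emeasure (density m (\<lambda>x. ennreal (\<psi> x))) (space (density m (\<lambda>x. ennreal (\<psi> x)))) \<noteq> \<infinity>"
      by simp
  qed
  have sh: "shift \<in> density m (\<lambda>x. ennreal (\<phi> x)) \<rightarrow>\<^sub>M borel"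
    using measurable_shift by (simp add: measurable_cong_sets[OF sets_nu refl])
  show "finite_measure (distr (density m (\<lambda>x. ennreal (\<phi> x))) borel shift)"
    by (rule finite_measure.finite_measure_distr[OF fin[OF bm nn] sh])
  show "finite_measure (density m (\<lambda>x. ennreal (P \<phi> x)))"
    by (intro fin bounded_measurable_normalized normalized_nonneg bm nn)
  show "sets (density m (\<lambda>x. ennreal (P \<phi> x))) = sets borel" using sets_nu by simp
  fix g :: "'e sequ \<Rightarrow> real" assume g: "continuous_on UNIV g"
  note g_bm = bounded_measurable_continuous[OF g]
  have gs: "continuous_on UNIV (\<lambda>x. g (shift x))"
    by (rule continuous_on_compose2[OF g continuous_shift]) simp
  note gs_bm = bounded_measurable_continuous[OF gs]
  have "(\<integral>x. g x \<partial>distr (density m (\<lambda>x. ennreal (\<phi> x))) borel shift) = (\<integral>x. g (shift x) \<partial>density m (\<lambda>x. ennreal (\<phi> x)))"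
    by (intro integral_distr sh bounded_measurable_measurable g_bm)
  also have "\<dots> = (\<integral>x. \<phi> x * g (shift x) \<partial>m)"
    using nn borel_m[OF bounded_measurable_measurable[OF gs_bm]] borel_m[OF bounded_measurable_measurable[OF bm]]
    by (subst integral_density) auto
  \<comment> \<open>Stationarity is used for the product of \<phi> with g after the shift, which is
    again continuous.\<close>
  also have "\<dots> = (\<integral>x. P (\<lambda>z. \<phi> z * g (shift z)) x \<partial>m)"
    by (intro stationary[symmetric] continuous_intros \<phi> gs)
  also have "\<dots> = (\<integral>x. P \<phi> x * g x \<partial>m)"
    by (simp add: normalized_mult_shift bm g_bm gs_bm)
  also have "\<dots> = (\<integral>x. g x \<partial>density m (\<lambda>x. ennreal (P \<phi> x)))"
    using normalized_nonneg[OF bm nn] borel_m[OF bounded_measurable_measurable[OF g_bm]]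
      borel_m[OF bounded_measurable_measurable[OF bounded_measurable_normalized[OF bm]]]
    by (subst integral_density) auto
  finally show "(\<integral>x. g x \<partial>distr (density m (\<lambda>x. ennreal (\<phi> x))) borel shift)
      = (\<integral>x. g x \<partial>density m (\<lambda>x. ennreal (P \<phi> x)))" .
qed simp

text \<open>Both sides integrate \<psi> against one measure in two descriptions: the image of \<phi>
  dm under the shift, and P \<phi> dm. This covers unbounded \<psi>, as correlations with integrable
  functions demand. The sign condition lets \<phi> serve as a density.\<close>

lemma integral_mult_shift:
  assumes \<phi>: "continuous_on UNIV \<phi>" and nn: "\<And>z. 0 \<le> \<phi> z" and \<psi>: "\<psi> \<in> borel_measurable borel"
  shows "(\<integral>x. \<phi> x * \<psi> (shift x) \<partial>m) = (\<integral>x. P \<phi> x * (\<psi> x :: real) \<partial>m)"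
proof -
  note bm = bounded_measurable_continuous[OF \<phi>]
  have \<psi>s: "(\<lambda>x. \<psi> (shift x)) \<in> borel_measurable borel"
    using measurable_compose[OF measurable_shift \<psi>] .
  have sh: "shift \<in> density m (\<lambda>x. ennreal (\<phi> x)) \<rightarrow>\<^sub>M borel"
    using measurable_shift by (simp add: measurable_cong_sets[OF sets_nu refl])
  have "(\<integral>x. \<phi> x * \<psi> (shift x) \<partial>m) = (\<integral>x. \<psi> (shift x) \<partial>density m (\<lambda>x. ennreal (\<phi> x)))"
    using nn borel_m[OF \<psi>s] borel_m[OF bounded_measurable_measurable[OF bm]]
    by (subst integral_density) auto
  also have "\<dots> = (\<integral>x. \<psi> x \<partial>distr (density m (\<lambda>x. ennreal (\<phi> x))) borel shift)"
    by (intro integral_distr[symmetric] sh \<psi>)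
  also have "\<dots> = (\<integral>x. \<psi> x \<partial>density m (\<lambda>x. ennreal (P \<phi> x)))"
    by (simp only: distr_shift_density[OF \<phi> nn])
  also have "\<dots> = (\<integral>x. P \<phi> x * \<psi> x \<partial>m)"
    using normalized_nonneg[OF bm nn] borel_m[OF \<psi>]
      borel_m[OF bounded_measurable_measurable[OF bounded_measurable_normalized[OF bm]]]
    by (subst integral_density) auto
  finally show ?thesis .
qed

lemma measurable_funpow_shift: "shift ^^ n \<in> borel \<rightarrow>\<^sub>M (borel :: 'e sequ measure)"
  by (induction n) (auto intro: measurable_compose[OF _ measurable_shift])

lemma integral_mult_funpow_shift:
  assumes "continuous_on UNIV \<phi>" "\<And>z. 0 \<le> \<phi> z" and \<psi>: "\<psi> \<in> borel_measurable borel"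
  shows "(\<integral>x. \<phi> x * \<psi> ((shift ^^ n) x) \<partial>m) = (\<integral>x. (P ^^ n) \<phi> x * (\<psi> x :: real) \<partial>m)"
  using assms(1,2)
proof (induction n arbitrary: \<phi>)
  case (Suc n)
  have "(\<integral>x. \<phi> x * \<psi> ((shift ^^ Suc n) x) \<partial>m) = (\<integral>x. P \<phi> x * \<psi> ((shift ^^ n) x) \<partial>m)"
    using integral_mult_shift[OF Suc.prems measurable_compose[OF measurable_funpow_shift \<psi>], of n]
    by (simp add: funpow_Suc_right del: funpow.simps)
  also have "\<dots> = (\<integral>x. (P ^^ n) (P \<phi>) x * \<psi> x \<partial>m)"
    using Suc.prems by (intro Suc.IH continuous_normalized normalized_nonneg bounded_measurable_continuous)
  finally show ?case by (simp add: funpow_Suc_right del: funpow.simps)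
qed simp

text \<open>As h is an eigenfunction, P fixes constants. This undoes the shift that makes an
  observable nonnegative.\<close>

lemma normalized_iterate_add_const:
  assumes "bounded_measurable \<phi>"
  shows "(P ^^ n) (\<lambda>z. \<phi> z + b) x = (P ^^ n) \<phi> x + b"
proof -
  have "(L ^^ n) (\<lambda>z. h z * (\<phi> z + b)) x = (L ^^ n) (\<lambda>z. h z * \<phi> z) x + b * (lam ^ n * h x)"
    using iterate_add[OF bounded_measurable_mult[OF bounded_measurable_h assms]
        bounded_measurable_cmult[OF bounded_measurable_h, of b], of n] iterate_cmult[OF bounded_measurable_h, of n b]
    by (simp add: iterate_h distrib_left mult.commute[of b])
  then show ?thesis
    using lam h_pos[of x]
    by (simp add: normalized_iterate assms bounded_measurable_add add_divide_distrib)
qed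

text \<open>P fixes 1, so the density identity for \<phi> = 1 is invariance of m under the shift. It
  carries integrability of an observable over to its shifts.\<close>

lemma distr_shift: "distr m borel shift = m"
proof -
  have "P (\<lambda>_. 1) x = 1" for x
    using normalized_eq[of "\<lambda>_. 1" x] lam h_pos[of x] by (simp add: transfer_h)
  then show ?thesis using distr_shift_density[of "\<lambda>_. 1"] by (simp add: density_1)
qed

lemma integrable_funpow_shift:
  assumes "integrable m (\<psi> :: _ \<Rightarrow> real)"
  shows "integrable m (\<lambda>x. \<psi> ((shift ^^ n) x))"
proof (induction n)
  case (Suc n)
  have "shift \<in> m \<rightarrow>\<^sub>M borel"
    using measurable_shift measurable_cong_sets[OF sets_m refl] by blast
  moreover have "integrable (distr m borel shift) (\<lambda>x. \<psi> ((shift ^^ n) x))"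
    using Suc by (simp only: distr_shift)
  ultimately have "integrable m (\<lambda>x. \<psi> ((shift ^^ n) (shift x)))"
    by (rule integrable_distr)
  then show ?case by (simp add: funpow_Suc_right del: funpow.simps)
qed (use assms in simp)

section \<open>Decay of correlations and of the supremum norm\<close>

lemma hol_bounded_add_const:
  assumes "hol_bounded \<omega> N \<phi>"
  shows "hol_bounded \<omega> (N + \<bar>c\<bar>) (\<lambda>x. \<phi> x + c)"
  unfolding hol_bounded_def
proof (intro conjI allI)
  fix x
  have "\<bar>\<phi> x\<bar> \<le> N" using assms by (simp add: hol_bounded_def)
  then show "\<bar>\<phi> x + c\<bar> \<le> N + \<bar>c\<bar>" by linarith
  fix y
  have "\<bar>\<phi> x - \<phi> y\<bar> \<le> N * \<omega> (seq_dist x y)" using assms by (simp add: hol_bounded_def)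
  also have "\<dots> \<le> (N + \<bar>c\<bar>) * \<omega> (seq_dist x y)"
    by (intro mult_right_mono log_modulus_nonneg) simp
  finally show "\<bar>\<phi> x + c - (\<phi> y + c)\<bar> \<le> (N + \<bar>c\<bar>) * \<omega> (seq_dist x y)" by simp
qed

text \<open>Centring \<phi> and moving the n shifts onto it by duality leaves the integral of
  \<open>(P ^^ n) \<phi>0\<close> times \<psi>, at most the supremum norm of the first times the L^1
  norm of \<psi>.\<close>

lemma decay_of_correlations: "polynomial_decay \<epsilon> \<omega> m"
  unfolding polynomial_decay_def
proof (intro ballI allI impI)
  fix \<phi> \<psi> :: "'e sequ \<Rightarrow> real" assume \<phi>: "\<phi> \<in> hol_space \<omega>" and \<psi>: "integrable m \<psi>"
  obtain K where K: "K > 0"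
    "\<And>\<phi> N n x. hol_bounded \<omega> N \<phi> \<Longrightarrow> (\<integral>x. \<phi> x \<partial>m) = 0 \<Longrightarrow> n \<ge> 1 \<Longrightarrow>
      \<bar>(P ^^ n) \<phi> x\<bar> \<le> K * N * real n powr (- \<epsilon>)"
    using normalized_decay by metis
  obtain N0 where N0: "hol_bounded \<omega> N0 \<phi>" by (rule hol_space_imp_hol_bounded[OF r0 \<phi>])
  define c where "c = (\<integral>x. \<phi> x \<partial>m)"
  define N where "N = N0 + \<bar>- c\<bar>"
  define \<phi>0 where "\<phi>0 x = \<phi> x + (- c)" for x
  have hb: "hol_bounded \<omega> N \<phi>0"
    unfolding N_def \<phi>0_def by (rule hol_bounded_add_const[OF N0])
  then have N: "\<bar>\<phi>0 x\<bar> \<le> N" for x by (simp add: hol_bounded_def)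
  have N_nn: "0 \<le> N" using N by (rule order_trans[OF abs_ge_zero])
  have cont: "continuous_on UNIV \<phi>0" by (rule hol_bounded_continuous[OF cont_modulus hb])
  note bm = bounded_measurable_continuous[OF cont]
  have "integrable m \<phi>" by (intro integrable_m bounded_measurable_continuous continuous_hol_space \<phi>)
  then have zero: "(\<integral>x. \<phi>0 x \<partial>m) = 0"
    using m.prob_space by (simp add: \<phi>0_def c_def)
  have \<psi>_meas: "\<psi> \<in> borel_measurable borel"
    using borel_measurable_integrable[OF \<psi>] measurable_cong_sets[OF sets_m refl] by blast
  let ?I = "\<integral>x. \<bar>\<psi> x\<bar> \<partial>m"
  show "\<exists>K>0. \<forall>n\<ge>1. \<bar>(\<integral>x. \<phi> x * \<psi> ((shift ^^ n) x) \<partial>m) - (\<integral>x. \<phi> x \<partial>m) * (\<integral>x. \<psi> x \<partial>m)\<bar>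
      \<le> K * real n powr (- \<epsilon>)"
  \<comment> \<open>The summand 1 keeps the constant positive when N or the L^1 norm of \<psi>
    vanishes.\<close>
  proof (intro exI[of _ "K * N * ?I + 1"] conjI allI impI)
    have "0 \<le> K * N * ?I" using K(1) N_nn by (intro mult_nonneg_nonneg integral_nonneg) auto
    then show "0 < K * N * ?I + 1" by linarith
    fix n :: nat assume n: "1 \<le> n"
    let ?\<psi>n = "\<lambda>x. \<psi> ((shift ^^ n) x)" and ?r = "real n powr (- \<epsilon>)"
    have \<psi>n: "integrable m ?\<psi>n" by (rule integrable_funpow_shift[OF \<psi>])
    have bdd_mult: "integrable m (\<lambda>x. \<rho> x * g x)" if \<rho>: "bounded_measurable \<rho>" and g: "integrable m g" for \<rho> g :: "'e sequ \<Rightarrow> real"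
    proof -
      obtain b where "\<And>x. \<bar>\<rho> x\<bar> \<le> b" using \<rho> by (metis bounded_measurableE)
      then have "AE x in m. norm (\<rho> x * g x) \<le> norm (b * g x)"
        unfolding real_norm_def abs_mult
        by (intro AE_I2 mult_right_mono) (auto intro: order_trans[OF _ abs_ge_self])
      moreover have "integrable m (\<lambda>x. b * g x)" using g by simp
      moreover have "(\<lambda>x. \<rho> x * g x) \<in> borel_measurable m"
        by (intro borel_measurable_times borel_m[OF bounded_measurable_measurable[OF \<rho>]]
            borel_measurable_integrable[OF g])
      ultimately show ?thesis by (rule Bochner_Integration.integrable_bound[rotated 2])
    qed
    have Pn_bm: "bounded_measurable ((P ^^ n) \<phi>0)"
      by (induction n) (auto intro: bm bounded_measurable_normalized)
    have inv: "(\<integral>x. ?\<psi>n x \<partial>m) = (\<integral>x. \<psi> x \<partial>m)"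
      using integral_mult_funpow_shift[of "\<lambda>_. 1", OF _ _ \<psi>_meas, of n]
        normalized_iterate[of "\<lambda>_. 1" n] lam less_imp_neq[OF h_pos] by (simp add: iterate_h)
    \<comment> \<open>Duality is available for nonnegative functions, so it is applied to \<phi>0 +
      N. The extra terms on the two sides agree by invariance of m.\<close>
    have "(\<integral>x. (\<phi>0 x + N) * ?\<psi>n x \<partial>m) = (\<integral>x. (P ^^ n) (\<lambda>z. \<phi>0 z + N) x * \<psi> x \<partial>m)"
    proof (rule integral_mult_funpow_shift[OF _ _ \<psi>_meas])
      show "continuous_on UNIV (\<lambda>x. \<phi>0 x + N)" by (intro continuous_intros cont)
      show "0 \<le> \<phi>0 z + N" for z using N[of z] by linarith
    qed
    then have dual: "(\<integral>x. \<phi>0 x * ?\<psi>n x \<partial>m) = (\<integral>x. (P ^^ n) \<phi>0 x * \<psi> x \<partial>m)"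
      using bdd_mult[OF bm \<psi>n] bdd_mult[OF Pn_bm \<psi>] \<psi>n \<psi>
      by (simp add: normalized_iterate_add_const[OF bm] distrib_right inv)
    have "(\<lambda>x. \<phi> x * ?\<psi>n x) = (\<lambda>x. \<phi>0 x * ?\<psi>n x + c * ?\<psi>n x)"
      by (simp add: \<phi>0_def fun_eq_iff algebra_simps)
    then have "(\<integral>x. \<phi> x * ?\<psi>n x \<partial>m) = (\<integral>x. \<phi>0 x * ?\<psi>n x \<partial>m) + c * (\<integral>x. \<psi> x \<partial>m)"
      using bdd_mult[OF bm \<psi>n] \<psi>n by (simp add: inv)
    then have "\<bar>(\<integral>x. \<phi> x * ?\<psi>n x \<partial>m) - (\<integral>x. \<phi> x \<partial>m) * (\<integral>x. \<psi> x \<partial>m)\<bar> = \<bar>\<integral>x. (P ^^ n) \<phi>0 x * \<psi> x \<partial>m\<bar>"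
      by (simp add: dual c_def)
    also have "\<dots> \<le> (\<integral>x. \<bar>(P ^^ n) \<phi>0 x * \<psi> x\<bar> \<partial>m)" by (rule integral_abs_bound)
    also have "\<dots> \<le> (\<integral>x. K * N * ?r * \<bar>\<psi> x\<bar> \<partial>m)"
    proof (rule integral_mono)
      show "integrable m (\<lambda>x. \<bar>(P ^^ n) \<phi>0 x * \<psi> x\<bar>)" by (intro integrable_abs bdd_mult Pn_bm \<psi>)
      show "\<bar>(P ^^ n) \<phi>0 x * \<psi> x\<bar> \<le> K * N * ?r * \<bar>\<psi> x\<bar>" for x
        unfolding abs_mult by (intro mult_right_mono K(2) hb zero n) auto
    qed (use \<psi> in simp)
    also have "\<dots> = K * N * ?I * ?r" by simp
    also have "\<dots> \<le> (K * N * ?I + 1) * ?r" by (intro mult_right_mono) auto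
    finally show "\<bar>(\<integral>x. \<phi> x * ?\<psi>n x \<partial>m) - (\<integral>x. \<phi> x \<partial>m) * (\<integral>x. \<psi> x \<partial>m)\<bar> \<le> (K * N * ?I + 1) * ?r" .
  qed
qed

lemma sup_norm_decay:
  "\<exists>C>0. \<forall>\<phi>\<in>hol_space \<omega>. (\<integral>x. \<phi> x \<partial>m) = 0 \<longrightarrow>
     (\<forall>n\<ge>1. sup_norm ((P ^^ n) \<phi>) \<le> ennreal C * hol_norm \<omega> \<phi> / ennreal (real n powr \<epsilon>))"
proof -
  obtain K where K: "K > 0"
    "\<And>\<phi> N n x. hol_bounded \<omega> N \<phi> \<Longrightarrow> (\<integral>x. \<phi> x \<partial>m) = 0 \<Longrightarrow> n \<ge> 1 \<Longrightarrow>
      \<bar>(P ^^ n) \<phi> x\<bar> \<le> K * N * real n powr (- \<epsilon>)"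
    using normalized_decay by metis
  show ?thesis
  proof (intro exI[of _ K] conjI K(1) ballI allI impI)
    fix \<phi> :: "'e sequ \<Rightarrow> real" and n :: nat
    assume \<phi>: "\<phi> \<in> hol_space \<omega>" and zero: "(\<integral>x. \<phi> x \<partial>m) = 0" and n: "1 \<le> n"
    obtain N where N: "0 \<le> N" "hol_norm \<omega> \<phi> = ennreal N" "hol_bounded \<omega> N \<phi>"
      by (rule hol_space_imp_hol_bounded[OF r0 \<phi>])
    have "K * N * real n powr (- \<epsilon>) = K * N / real n powr \<epsilon>"
      by (simp add: powr_minus field_simps)
    then have "sup_norm ((P ^^ n) \<phi>) \<le> ennreal (K * N / real n powr \<epsilon>)"
      unfolding sup_norm_def using K(2)[OF N(3) zero n] by (auto intro!: SUP_least ennreal_leI)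
    also have "\<dots> = ennreal K * hol_norm \<omega> \<phi> / ennreal (real n powr \<epsilon>)"
      using N(1) K(1) n by (simp add: N(2) divide_ennreal flip: ennreal_mult)
    finally show "sup_norm ((P ^^ n) \<phi>) \<le> ennreal K * hol_norm \<omega> \<phi> / ennreal (real n powr \<epsilon>)" .
  qed
qed

end

theorem theorem5p6:
  fixes \<mu> :: "'e::compact_metric_space measure"
    and \<epsilon> r0 :: real
    and f :: "'e sequ \<Rightarrow> real"
  assumes "prob_space \<mu>" and "sets \<mu> = sets borel"
    and "\<epsilon> > 0"
    and "r0 > 1" and "continuous_on {0..1} (log_modulus \<epsilon> r0)" and "strict_mono_on {0..1} (log_modulus \<epsilon> r0)" and "concave_on {0..1} (log_modulus \<epsilon> r0)"
    and "f \<in> hol_space (log_modulus \<epsilon> r0)"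
    and "flat_potential (log_modulus \<epsilon> r0) (natural_coupling \<mu>) f"
  shows "\<exists>lam h \<nu>. lam > 0 \<and> h \<in> hol_space (log_modulus \<epsilon> r0) \<and> (\<forall>x. h x > 0) \<and>
     (\<forall>x. transfer (prepend_kernel \<mu>) f h x = lam * h x) \<and>
     conformal_measure (transfer (prepend_kernel \<mu>) f) lam \<nu> \<and>
     integrable \<nu> h \<and> (\<integral>x. h x \<partial>\<nu>) = 1 \<and>
     (let m = density \<nu> (\<lambda>x. ennreal (h x));
          L = transfer (prepend_kernel \<mu>) (normalized_potential f h lam)
      in stationary_measure L m \<and>
         (\<exists>C>0. \<forall>\<phi>\<in>hol_space (log_modulus \<epsilon> r0). (\<integral>x. \<phi> x \<partial>m) = 0 \<longrightarrow>
            (\<forall>n\<ge>1. sup_norm ((L ^^ n) \<phi>) \<le> ennreal C * hol_norm (log_modulus \<epsilon> r0) \<phi> / ennreal (real n powr \<epsilon>))) \<and>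
         polynomial_decay \<epsilon> (log_modulus \<epsilon> r0) m)"
proof -
  obtain C where "C > 0" and "\<And>n x y. AE (xs, ys) in natural_coupling \<mu> n x y.
      \<bar>birkhoff f n xs - birkhoff f n ys\<bar> \<le> C * log_modulus \<epsilon> r0 (seq_dist x y)"
    using assms(9) unfolding flat_potential_def by blast
  then interpret flat_system \<mu> \<epsilon> r0 C f
    using assms by (intro flat_system.intro flat_system_axioms.intro)
  obtain lam \<nu> where "lam > 0" "conformal_measure L lam \<nu>"
    by (rule conformal_measure_exists)
  then interpret conformal_system \<mu> \<epsilon> r0 C f lam \<nu> by unfold_locales
  have "stationary_measure P m"
    unfolding stationary_measure_def using prob_m sets_m stationary by blast
  then show ?thesis
    using lam hol_bounded_imp_hol_space[OF r0 hol_bounded_h] h_pos transfer_h conformal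
      integrable_nu[OF bounded_measurable_h] h_nu sup_norm_decay decay_of_correlations
    unfolding Let_def by (intro exI[of _ lam] exI[of _ h] exI[of _ \<nu>]) blast
qed

end
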